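(* Let $(\mathcal W,S)$ be an irreducible Coxeter system with $S$ finite, and let $c\in\mathcal W$ be a Coxeter element. (a) For any $X\in\mathfrak M(c)$, the word $\rho(X)$ is reduced if and only if $X=W_\Psi$ for some $\Psi\in\mathfrak i(c)$. Hence $\mathrm{Red}\,\mathfrak M(c)$ is the image of the map $\xi:\mathfrak i(c)\to\mathfrak M(c)$, $\xi(\Psi)=W_\Psi$, and the map $\xi:\mathfrak i(c)\to\mathrm{Red}\,\mathfrak M(c)$ is bijective. (b) The map $\rho:\mathrm{Red}\,\mathfrak M(c)\to\mathcal W$ is order-embedding (with respect to $\preceq$ on $\mathrm{Red}\,\mathfrak M(c)$ and the left weak order $\le_L$ on $\mathcal W$), hence injective. (c) The maps of (a) and (b) are bijections between $\mathfrak i(c)$, $\mathrm{Red}\,\mathfrak M(c)$, and the set of elements of $\mathcal W$ having a $c$-admissible reduced expression.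
   Context: Coxeter setting. $(\mathcal W,S)$ has Coxeter matrix $(m(s,s'))_{s,s'\in S}$. Its Coxeter graph $\Gamma$ has vertex set $\Gamma_0$ with a fixed bijection $\rho:\Gamma_0\to S$; distinct vertices $x,y$ are joined by an edge (exactly one) iff $2<m(\rho(x),\rho(y))\le\infty$; irreducible means that $\Gamma$ is connected. Graph monoid. $\mathfrak M$ is the quotient of the free monoid on $\Gamma_0$ by the congruence generated by $vw\sim wv$ for all distinct $v,w\in\Gamma_0$ not joined by an edge. Its elements are written as words $X=x_l\cdots x_1$ ($x_j\in\Gamma_0$, $l\ge 0$; $1$ is the empty word); $\ell(X)=l$; $\mathrm{Supp}\,X=\{x_1,\dots,x_l\}$; $X$ is multiplicity-free if the $x_j$ are pairwise distinct. The letter $\rho$ also denotes the induced monoid homomorphism $\mathfrak M\to\mathcal W$. Partial order on $\mathfrak M$: $Y\preceq X$ iff $X=UY$ for some $U\in\mathfrak M$. The word $\rho(X)$ is reduced if $\ell(X)=\ell(\rho(X))$, the Coxeter length of the element $\rho(X)$. For $\mathfrak A\subset\mathfrak M$, $\mathrm{Red}\,\mathfrak A$ is the set of $Z\in\mathfrak A$ for which $\rho(Z)$ is reduced. Left weak order: $u\le_L v$ in $\mathcal W$ iff $v=s_ks_{k-1}\cdots s_1u$ for some $s_i\in S$ with $\ell(s_i\cdots s_1u)=\ell(u)+i$ for $0\le i\le k$. A map $f$ of posets is order-embedding if $x\le y\iff f(x)\le f(y)$. Roots. $\mathbb V$ is the real vector space with basis $\{\alpha_s\mid s\in S\}$ and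 symmetric bilinear form $B(\alpha_s,\alpha_{s'})=-2\cos\frac{\pi}{m(s,s')}$ (with $\frac{\pi}{\infty}=0$). $\mathcal W$ acts on $\mathbb V$ by $s\lambda=\lambda-B(\alpha_s,\lambda)\alpha_s$. The roots are the vectors $w(\alpha_s)$, $w\in\mathcal W$, $s\in S$. A root is positive ($>0$), resp. negative ($<0$), if all its coordinates in the basis $\{\alpha_s\}$ are $\ge 0$, resp. $\le 0$. Coxeter element and admissible words. $c=s_n\cdots s_1$, where $s_1,\dots,s_n$ are all the elements of $S$ in some order, and $v_j=\rho^{-1}(s_j)$. The $c$-orientation of $\Gamma$ directs each edge between $v_i$ and $v_j$ with $j>i$ as $v_j\to v_i$ (it depends only on the element $c$); $(\Gamma,c)$ denotes the resulting acyclic quiver. A sink is a vertex at which no arrow starts. A word $X=x_l\cdots x_1$ is $c$-admissible if $x_1$ is a sink for the $c$-orientation and, for $1<j\le l$, $x_j$ is a sink for the orientation obtained from the $c$-orientation by reversing all arrows incident to $x_1$, then all arrows incident to $x_2$, and so on up to $x_{j-1}$. This is well defined on elements of $\mathfrak M$; $\mathfrak M(c)\subset\mathfrak M$ is the set of $c$-admissible elements. It is known that $(\mathfrak M(c),\preceq)$ is a lattice, with join $\vee$. An element $w\in\mathcal W$ has a $c$-admissible reduced expression if $w=\rho(X)$ with $X\in\mathfrak M(c)$ and $\rho(X)$ reduced. Preprojective roots. A root $\alpha>0$ is $c$-preprojective if $\rho(X)\alpha<0$ for some $X\in\mathfrak M(c)$; $\mathcal P(c)$ is the set of $c$-preprojective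 roots. For every finite $\Psi\subset\mathcal P(c)$ the set $\{X\in\mathfrak M(c)\mid \rho(X)\alpha<0\text{ for all }\alpha\in\Psi\}$ has a unique $\preceq$-least element, denoted $W_\Psi$ (so $W_\emptyset=1$); write $W_\alpha=W_{\{\alpha\}}$. Principal words. $\Gamma_0$ is a poset: $x\le y$ iff there is a directed path (possibly trivial) from $x$ to $y$ in $(\Gamma,c)$. A filter is an upward closed subset; $\langle x\rangle=\{y\mid y\ge x\}$. The hull $H_c(\Theta)$ of a filter $\Theta$ is the smallest filter containing $\Theta$ and every vertex of $\Gamma_0\setminus\Theta$ joined by an edge to a vertex of $\Theta$. For $r>0$ and $x\in\Gamma_0$, $W_{r,x}\in\mathfrak M$ is the element $X_r\cdots X_1$ where (i) each $X_j$ is multiplicity-free and $c$-admissible; (ii) $\mathrm{Supp}\,X_r=\langle x\rangle$; (iii) $H_c(\mathrm{Supp}\,X_{j+1})=\mathrm{Supp}\,X_j$ for $0<j<r$. (For each filter there is exactly one multiplicity-free $c$-admissible element with that support, so $W_{r,x}$ is well defined.) $\mathfrak P(c)\subset\mathfrak M(c)$, the set of $c$-principal elements, consists of all $W_{r,x}$ together with the empty word. One has $W_\alpha\in\mathfrak P(c)$ for all $\alpha\in\mathcal P(c)$. Independence. A finite subset $\{X_1,\dots,X_m\}$ of $\mathfrak P(c)$ ($m$ distinct elements) is independent if whenever $X_1\vee\dots\vee X_m=Y_1\vee\dots\vee Y_q$ with all $Y_j\in\mathfrak P(c)$, then $m\le q$. A finite subset $\{\alpha_1,\dots,\alpha_m\}$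 of $\mathcal P(c)$ is independent if $\{W_{\alpha_1},\dots,W_{\alpha_m}\}$ is an independent subset of $\mathfrak P(c)$ (the $W_{\alpha_i}$ are distinct for distinct $\alpha_i$); the empty set is independent, the empty join being $1$. $\mathfrak i(c)$ is the set of independent finite subsets of $\mathcal P(c)$. *)

theory Defs
  imports Complex_Main "HOL-Library.Extended_Nat" "HOL-Algebra.Multiplicative_Group" "HOL-Algebra.Lattice"
begin

section \<open>Congruences on free monoids\<close>

inductive monoid_cong :: "'a set \<Rightarrow> ('a list \<times> 'a list) set \<Rightarrow> 'a list \<Rightarrow> 'a list \<Rightarrow> bool"
  for A :: "'a set" and R :: "('a list \<times> 'a list) set" where
  base: "(xs, ys) \<in> R \<Longrightarrow> xs \<in> lists A \<Longrightarrow> ys \<in> lists A \<Longrightarrow> monoid_cong A R xs ys"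
| refl: "xs \<in> lists A \<Longrightarrow> monoid_cong A R xs xs"
| sym: "monoid_cong A R xs ys \<Longrightarrow> monoid_cong A R ys xs"
| trans: "monoid_cong A R xs ys \<Longrightarrow> monoid_cong A R ys zs \<Longrightarrow> monoid_cong A R xs zs"
| app: "monoid_cong A R xs xs' \<Longrightarrow> monoid_cong A R ys ys' \<Longrightarrow> monoid_cong A R (xs @ ys) (xs' @ ys')"


section \<open>Coxeter systems\<close>

text \<open>
  A group together with its set of generators \<open>S\<close>, the vertex set \<open>\<Gamma>\<^sub>0\<close> of its Coxeter graph,
  and the bijection \<open>\<rho> : \<Gamma>\<^sub>0 \<rightarrow> S\<close>.
\<close>

record ('w, 'v) coxeter_data = "'w monoid" +
  gens :: "'w set"
  verts :: "'v set"
  gen_of :: "'v \<Rightarrow> 'w"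

text \<open>The entry \<open>m(s,s')\<close> of the Coxeter matrix is the order of \<open>s s'\<close>; the library's
  \<^const>\<open>group.ord\<close> is \<open>0\<close> on elements of infinite order.\<close>

definition cox_mat :: "('w, 'v) coxeter_data \<Rightarrow> 'w \<Rightarrow> 'w \<Rightarrow> enat" where
  "cox_mat W s t =
     (let k = group.ord W (s \<otimes>\<^bsub>W\<^esub> t) in if k = 0 then \<infinity> else enat k)"

definition word_val :: "('w, 'v) coxeter_data \<Rightarrow> 'w list \<Rightarrow> 'w" where
  "word_val W ss = foldr (\<lambda>s w. s \<otimes>\<^bsub>W\<^esub> w) ss \<one>\<^bsub>W\<^esub>"

definition cox_relations :: "('w, 'v) coxeter_data \<Rightarrow> ('w list \<times> 'w list) set" where
  "cox_relations W =
     {(concat (replicate k [s, t]), []) | s t k. s \<in> gens W \<and> t \<in> gens W \<and> cox_mat W s t = enat k}"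

text \<open>
  \<open>W\<close> is presented by the generators \<open>S\<close> and the relations \<open>(s s')\<^bsup>m(s,s')\<^esup> = 1\<close>. As the relations
  with \<open>s = s'\<close> read \<open>s s = 1\<close>, presentations as a group and as a monoid coincide, so words
  without inverses suffice.
\<close>

definition coxeter_system :: "('w, 'v) coxeter_data \<Rightarrow> bool" where
  "coxeter_system W \<longleftrightarrow>
     group W \<and> gens W \<subseteq> carrier W \<and> generate W (gens W) = carrier W \<and>
     (\<forall>s\<in>gens W. s \<noteq> \<one>\<^bsub>W\<^esub> \<and> s \<otimes>\<^bsub>W\<^esub> s = \<one>\<^bsub>W\<^esub>) \<and>
     (\<forall>ss\<in>lists (gens W). \<forall>ts\<in>lists (gens W).
        word_val W ss = word_val W ts \<longleftrightarrow> monoid_cong (gens W) (cox_relations W) ss ts) \<and>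
     bij_betw (gen_of W) (verts W) (gens W)"

definition adjacent :: "('w, 'v) coxeter_data \<Rightarrow> 'v \<Rightarrow> 'v \<Rightarrow> bool" where
  "adjacent W x y \<longleftrightarrow>
     x \<in> verts W \<and> y \<in> verts W \<and> x \<noteq> y \<and> 2 < cox_mat W (gen_of W x) (gen_of W y)"

definition irreducible_coxeter :: "('w, 'v) coxeter_data \<Rightarrow> bool" where
  "irreducible_coxeter W \<longleftrightarrow> (\<forall>x\<in>verts W. \<forall>y\<in>verts W. (adjacent W)\<^sup>*\<^sup>* x y)"

definition cox_length :: "('w, 'v) coxeter_data \<Rightarrow> 'w \<Rightarrow> nat" where
  "cox_length W w = (LEAST k. \<exists>ss\<in>lists (gens W). length ss = k \<and> word_val W ss = w)"

text \<open>Below, \<open>ss = [s\<^sub>1, \<dots>, s\<^sub>k]\<close>, whereas the generators occur in products from right to left.\<close>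

definition left_weak_le :: "('w, 'v) coxeter_data \<Rightarrow> 'w \<Rightarrow> 'w \<Rightarrow> bool" where
  "left_weak_le W u v \<longleftrightarrow>
     u \<in> carrier W \<and> v \<in> carrier W \<and>
     (\<exists>ss\<in>lists (gens W).
        v = word_val W (rev ss) \<otimes>\<^bsub>W\<^esub> u \<and>
        (\<forall>i\<le>length ss. cox_length W (word_val W (rev (take i ss)) \<otimes>\<^bsub>W\<^esub> u) = cox_length W u + i))"


section \<open>Roots\<close>

text \<open>Vectors are given by their coordinates in the basis \<open>\<alpha>\<^sub>s\<close>; the coordinates outside \<open>S\<close>
  of all roots vanish.\<close>

definition simple_root :: "'w \<Rightarrow> 'w \<Rightarrow> real" where
  "simple_root s = (\<lambda>t. if t = s then 1 else 0)"

definition cox_bilin :: "('w, 'v) coxeter_data \<Rightarrow> ('w \<Rightarrow> real) \<Rightarrow> ('w \<Rightarrow> real) \<Rightarrow> real" where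
  "cox_bilin W u v =
     (\<Sum>s\<in>gens W. \<Sum>t\<in>gens W.
        u s * v t * (- 2 * cos (case cox_mat W s t of enat k \<Rightarrow> pi / real k | \<infinity> \<Rightarrow> 0)))"

definition reflect :: "('w, 'v) coxeter_data \<Rightarrow> 'w \<Rightarrow> ('w \<Rightarrow> real) \<Rightarrow> ('w \<Rightarrow> real)" where
  "reflect W s v = (\<lambda>t. v t - cox_bilin W (simple_root s) v * simple_root s t)"

text \<open>The action of \<open>w\<close> is the composition of the reflections along any word representing \<open>w\<close>;
  it does not depend on the word because the reflections satisfy the defining relations.\<close>

definition cox_act :: "('w, 'v) coxeter_data \<Rightarrow> 'w \<Rightarrow> ('w \<Rightarrow> real) \<Rightarrow> ('w \<Rightarrow> real)" where
  "cox_act W w =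
     (THE f. \<exists>ss\<in>lists (gens W). word_val W ss = w \<and> f = foldr (reflect W) ss)"

definition roots :: "('w, 'v) coxeter_data \<Rightarrow> ('w \<Rightarrow> real) set" where
  "roots W = {cox_act W w (simple_root s) | w s. w \<in> carrier W \<and> s \<in> gens W}"

definition positive_root :: "('w, 'v) coxeter_data \<Rightarrow> ('w \<Rightarrow> real) \<Rightarrow> bool" where
  "positive_root W a \<longleftrightarrow> a \<in> roots W \<and> (\<forall>s\<in>gens W. a s \<ge> 0)"

definition negative_root :: "('w, 'v) coxeter_data \<Rightarrow> ('w \<Rightarrow> real) \<Rightarrow> bool" where
  "negative_root W a \<longleftrightarrow> a \<in> roots W \<and> (\<forall>s\<in>gens W. a s \<le> 0)"


section \<open>The graph monoid\<close>

text \<open>A word \<open>x\<^sub>l \<cdots> x\<^sub>1\<close> is the list \<open>[x\<^sub>l, \<dots>, x\<^sub>1]\<close>, so the letter \<open>x\<^sub>1\<close> acting first is the last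
  one of the list. Elements of the monoid are classes of words. The functions on classes
  below are constant on representatives.\<close>

definition commutations :: "('w, 'v) coxeter_data \<Rightarrow> ('v list \<times> 'v list) set" where
  "commutations W =
     {([x, y], [y, x]) | x y. x \<in> verts W \<and> y \<in> verts W \<and> x \<noteq> y \<and> \<not> adjacent W x y}"

definition gm_rel :: "('w, 'v) coxeter_data \<Rightarrow> ('v list \<times> 'v list) set" where
  "gm_rel W = {(xs, ys). monoid_cong (verts W) (commutations W) xs ys}"

definition graph_monoid :: "('w, 'v) coxeter_data \<Rightarrow> 'v list set monoid" where
  "graph_monoid W =
     \<lparr> carrier = lists (verts W) // gm_rel W,
       mult = (\<lambda>X Y. \<Union>xs\<in>X. \<Union>ys\<in>Y. gm_rel W `` {xs @ ys}),
       one = gm_rel W `` {[]} \<rparr>"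

definition gm_length :: "'v list set \<Rightarrow> nat" where
  "gm_length X = the_elem (length ` X)"

definition Supp :: "'v list set \<Rightarrow> 'v set" where
  "Supp X = the_elem (set ` X)"

definition mult_free :: "'v list set \<Rightarrow> bool" where
  "mult_free X \<longleftrightarrow> (\<exists>xs\<in>X. distinct xs)"

definition gm_rho :: "('w, 'v) coxeter_data \<Rightarrow> 'v list set \<Rightarrow> 'w" where
  "gm_rho W X = the_elem ((\<lambda>xs. word_val W (map (gen_of W) xs)) ` X)"

definition gm_le :: "('w, 'v) coxeter_data \<Rightarrow> 'v list set \<Rightarrow> 'v list set \<Rightarrow> bool" where
  "gm_le W Y X \<longleftrightarrow> (\<exists>U\<in>carrier (graph_monoid W). X = U \<otimes>\<^bsub>graph_monoid W\<^esub> Y)"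

definition reduced :: "('w, 'v) coxeter_data \<Rightarrow> 'v list set \<Rightarrow> bool" where
  "reduced W X \<longleftrightarrow> gm_length X = cox_length W (gm_rho W X)"

definition Red :: "('w, 'v) coxeter_data \<Rightarrow> 'v list set set \<Rightarrow> 'v list set set" where
  "Red W A = {Z \<in> A. reduced W Z}"


section \<open>Coxeter elements and admissible words\<close>

definition is_coxeter_word :: "('w, 'v) coxeter_data \<Rightarrow> 'w \<Rightarrow> 'w list \<Rightarrow> bool" where
  "is_coxeter_word W c ss \<longleftrightarrow> distinct ss \<and> set ss = gens W \<and> word_val W ss = c"

definition coxeter_element :: "('w, 'v) coxeter_data \<Rightarrow> 'w \<Rightarrow> bool" where
  "coxeter_element W c \<longleftrightarrow> (\<exists>ss. is_coxeter_word W c ss)"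

text \<open>For \<open>ss = [s\<^sub>n, \<dots>, s\<^sub>1]\<close>, arrows go from larger to smaller indices, that is, from left to
  right. The result depends only on \<open>c\<close>, not on the word \<open>ss\<close> chosen to represent it.\<close>

definition c_quiver :: "('w, 'v) coxeter_data \<Rightarrow> 'w \<Rightarrow> ('v \<times> 'v) set" where
  "c_quiver W c =
     (let ss = (SOME ss. is_coxeter_word W c ss) in
       {(x, y). adjacent W x y \<and> (\<exists>us vs ws. ss = us @ [gen_of W x] @ vs @ [gen_of W y] @ ws)})"

definition is_sink :: "('w, 'v) coxeter_data \<Rightarrow> ('v \<times> 'v) set \<Rightarrow> 'v \<Rightarrow> bool" where
  "is_sink W Q x \<longleftrightarrow> x \<in> verts W \<and> (\<nexists>y. (x, y) \<in> Q)"

definition reverse_at :: "'v \<Rightarrow> ('v \<times> 'v) set \<Rightarrow> ('v \<times> 'v) set" where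
  "reverse_at x Q =
     {(a, b). (a, b) \<in> Q \<and> a \<noteq> x \<and> b \<noteq> x} \<union> {(b, a) | a b. (a, b) \<in> Q \<and> (a = x \<or> b = x)}"

fun admissible_seq :: "('w, 'v) coxeter_data \<Rightarrow> ('v \<times> 'v) set \<Rightarrow> 'v list \<Rightarrow> bool" where
  "admissible_seq W Q [] \<longleftrightarrow> True"
| "admissible_seq W Q (x # xs) \<longleftrightarrow> is_sink W Q x \<and> admissible_seq W (reverse_at x Q) xs"

definition admissible_word :: "('w, 'v) coxeter_data \<Rightarrow> 'w \<Rightarrow> 'v list \<Rightarrow> bool" where
  "admissible_word W c xs \<longleftrightarrow> admissible_seq W (c_quiver W c) (rev xs)"

definition Adm :: "('w, 'v) coxeter_data \<Rightarrow> 'w \<Rightarrow> 'v list set set" where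
  "Adm W c = {X \<in> carrier (graph_monoid W). \<exists>xs\<in>X. admissible_word W c xs}"

definition adm_order :: "('w, 'v) coxeter_data \<Rightarrow> 'w \<Rightarrow> 'v list set gorder" where
  "adm_order W c = \<lparr> carrier = Adm W c, eq = (=), le = gm_le W \<rparr>"

definition has_adm_reduced_expr :: "('w, 'v) coxeter_data \<Rightarrow> 'w \<Rightarrow> 'w \<Rightarrow> bool" where
  "has_adm_reduced_expr W c w \<longleftrightarrow> (\<exists>X\<in>Adm W c. reduced W X \<and> w = gm_rho W X)"


section \<open>Preprojective roots\<close>

definition preproj_roots :: "('w, 'v) coxeter_data \<Rightarrow> 'w \<Rightarrow> ('w \<Rightarrow> real) set" where
  "preproj_roots W c =
     {a. positive_root W a \<and> (\<exists>X\<in>Adm W c. negative_root W (cox_act W (gm_rho W X) a))}"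

definition least_neg :: "('w, 'v) coxeter_data \<Rightarrow> 'w \<Rightarrow> ('w \<Rightarrow> real) set \<Rightarrow> 'v list set" where
  "least_neg W c \<Psi> =
     (THE X. least (adm_order W c) X
        {X \<in> Adm W c. \<forall>a\<in>\<Psi>. negative_root W (cox_act W (gm_rho W X) a)})"


section \<open>Principal words\<close>

definition vertex_le :: "('w, 'v) coxeter_data \<Rightarrow> 'w \<Rightarrow> 'v \<Rightarrow> 'v \<Rightarrow> bool" where
  "vertex_le W c x y \<longleftrightarrow> x \<in> verts W \<and> y \<in> verts W \<and> (x, y) \<in> (c_quiver W c)\<^sup>*"

definition is_vertex_filter :: "('w, 'v) coxeter_data \<Rightarrow> 'w \<Rightarrow> 'v set \<Rightarrow> bool" where
  "is_vertex_filter W c F \<longleftrightarrow> F \<subseteq> verts W \<and> (\<forall>x\<in>F. \<forall>y. vertex_le W c x y \<longrightarrow> y \<in> F)"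

definition principal_filter :: "('w, 'v) coxeter_data \<Rightarrow> 'w \<Rightarrow> 'v \<Rightarrow> 'v set" where
  "principal_filter W c x = {y. vertex_le W c x y}"

definition vertex_hull :: "('w, 'v) coxeter_data \<Rightarrow> 'w \<Rightarrow> 'v set \<Rightarrow> 'v set" where
  "vertex_hull W c F =
     \<Inter>{F'. is_vertex_filter W c F' \<and> F \<subseteq> F' \<and> {y \<in> verts W - F. \<exists>x\<in>F. adjacent W x y} \<subseteq> F'}"

text \<open>The list in the product below is \<open>[X\<^sub>r, \<dots>, X\<^sub>1]\<close>.\<close>

definition principal_word :: "('w, 'v) coxeter_data \<Rightarrow> 'w \<Rightarrow> nat \<Rightarrow> 'v \<Rightarrow> 'v list set" where
  "principal_word W c r x =
     (THE Z. \<exists>X :: nat \<Rightarrow> 'v list set.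
        (\<forall>j\<in>{1..r}. X j \<in> Adm W c \<and> mult_free (X j)) \<and>
        Supp (X r) = principal_filter W c x \<and>
        (\<forall>j. 0 < j \<and> j < r \<longrightarrow> vertex_hull W c (Supp (X (j + 1))) = Supp (X j)) \<and>
        Z = foldr (\<lambda>A B. A \<otimes>\<^bsub>graph_monoid W\<^esub> B) (map X (rev [1..<r + 1])) \<one>\<^bsub>graph_monoid W\<^esub>)"

definition Principal :: "('w, 'v) coxeter_data \<Rightarrow> 'w \<Rightarrow> 'v list set set" where
  "Principal W c =
     insert \<one>\<^bsub>graph_monoid W\<^esub> {principal_word W c r x | r x. r > 0 \<and> x \<in> verts W}"


section \<open>Independence\<close>

text \<open>Joins are the least upper bounds in the lattice of admissible elements; in particular the
  join of the empty set is the least element \<open>1\<close>. The list \<open>Ys\<close> may have repetitions.\<close>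

definition independent_principal :: "('w, 'v) coxeter_data \<Rightarrow> 'w \<Rightarrow> 'v list set set \<Rightarrow> bool" where
  "independent_principal W c A \<longleftrightarrow>
     finite A \<and> A \<subseteq> Principal W c \<and>
     (\<forall>Ys\<in>lists (Principal W c).
        \<Squnion>\<^bsub>adm_order W c\<^esub> A = \<Squnion>\<^bsub>adm_order W c\<^esub> (set Ys) \<longrightarrow> card A \<le> length Ys)"

definition independent_roots :: "('w, 'v) coxeter_data \<Rightarrow> 'w \<Rightarrow> ('w \<Rightarrow> real) set set" where
  "independent_roots W c =
     {\<Psi>. finite \<Psi> \<and> \<Psi> \<subseteq> preproj_roots W c \<and>
          independent_principal W c ((\<lambda>a. least_neg W c {a}) ` \<Psi>)}"

end

theory Submission
  imports Defs
begin

text \<open>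
  An admissible element is determined by the multiplicities of its letters, and \<open>\<preceq>\<close> is the pointwise
  order, so that admissible elements form a distributive lattice whose join irreducibles are the
  nontrivial principal elements. Independent sets of principal elements are therefore the
  antichains, and every element is the join of exactly one of them.

  If \<open>Z\<close> is a shortest admissible word inverting a positive root \<open>\<alpha>\<close> and \<open>Y\<close> is any other one, write
  \<open>Z = X' M\<close> and \<open>Y = Y' M\<close> with \<open>M\<close> the meet. Then \<open>X'\<close> and \<open>Y'\<close> have disjoint supports while \<open>\<rho>(M) \<alpha>\<close> is
  a combination of the simple roots in \<open>Supp X'\<close>, so \<open>Y'\<close> can make it negative only if \<open>X' = 1\<close>; hence
  \<open>Z = W\<^sub>\<alpha>\<close> is the least one, and it is principal because only one letter can come last.

  It remains to see that \<open>W\<^sub>\<alpha>\<close> is reduced, even when longer admissible words are not. Firing a sink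
  preserves the Euler form of the quiver, and pairing with the simple root of a sink is a
  coordinate. If \<open>Z\<close> is reduced and a sink \<open>y\<close> prolongs it to a nonreduced word, this forces the
  cancelling letter \<open>x\<close> to be a sink at the start, \<open>Z = Z'x\<close> with \<open>\<rho>(Z')\<alpha>\<^sub>x = \<alpha>\<^sub>y\<close>. Hence \<open>yZ'\<close> is a reduced
  admissible word for the orientation reversed at \<open>x\<close>, and by replacing \<open>Z\<close> by \<open>yZ'\<close> and \<open>\<alpha>\<close> by \<open>s\<^sub>x\<alpha>\<close>
  one sees that no root changes sign beyond a maximal reduced right factor.
\<close>

section \<open>Length and the reflection representation\<close>

text \<open>In a finite group admissible words outgrow the reduced ones, so a root may turn negative
  and later positive again as letters are added. Being inverted is thus not monotone for \<preceq>,
  and the existence of W_\<Psi> is not a formality. What is monotone: a reduced prolongation never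
  undoes an inversion. The Euler form enters because B is symmetric and cannot tell a sink from a
  source, whereas this nonsymmetric half of B can. Joins of reduced admissible elements are reduced:
  when a letter is added to one of them, it commutes past everything that the other contributes to
  the join. Hence W_\<Psi> is the join of the W_\<alpha>, for this join is reduced and so still
  inverts all of \<Psi>. For the weak order, a reduced prolongation of \<rho>(X) need not come from
  an admissible word, so letters cannot be compared; but it still inverts every \<alpha> with
  W_\<alpha> \<preceq> X, which puts these W_\<alpha> below the target, and X is their join when it
  is reduced.\<close>

locale coxeter_group = group W for W :: "('w, 'v) coxeter_data" (structure) +
  assumes coxeter: "coxeter_system W"
    and finite_gens [simp]: "finite (gens W)"
begin

abbreviation "val \<equiv> word_val W"
abbreviation "len \<equiv> cox_length W"
abbreviation "act \<equiv> foldr (reflect W)"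

lemma gens_closed [simp]: "s \<in> gens W \<Longrightarrow> s \<in> carrier W"
  using coxeter unfolding coxeter_system_def by auto

lemma gens_sq [simp]: "s \<in> gens W \<Longrightarrow> s \<otimes> s = \<one>"
  using coxeter unfolding coxeter_system_def by auto

lemma gens_inv [simp]: "s \<in> gens W \<Longrightarrow> inv s = s"
  by (simp add: inv_equality)

lemma val_Nil [simp]: "val [] = \<one>"
  by (simp add: word_val_def)

lemma val_Cons [simp]: "val (s # ss) = s \<otimes> val ss"
  by (simp add: word_val_def)

lemma val_closed [simp]: "set ss \<subseteq> gens W \<Longrightarrow> val ss \<in> carrier W"
  by (induction ss) auto

lemma val_append: "set ss \<subseteq> gens W \<Longrightarrow> set ts \<subseteq> gens W \<Longrightarrow> val (ss @ ts) = val ss \<otimes> val ts"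
  by (induction ss) (auto simp: m_assoc)

lemma val_rev: "set ss \<subseteq> gens W \<Longrightarrow> val (rev ss) = inv (val ss)"
  by (induction ss) (auto simp: val_append inv_mult_group)

lemma val_eq_iff:
  "set ss \<subseteq> gens W \<Longrightarrow> set ts \<subseteq> gens W \<Longrightarrow>
     val ss = val ts \<longleftrightarrow> monoid_cong (gens W) (cox_relations W) ss ts"
  using coxeter unfolding coxeter_system_def by (auto simp: subset_iff lists_eq_set)

lemma ex_word: assumes "w \<in> carrier W" shows "\<exists>ss. set ss \<subseteq> gens W \<and> val ss = w"
proof -
  have "w \<in> generate W (gens W)"
    using assms coxeter unfolding coxeter_system_def by auto
  then show ?thesis
  proof (induction rule: generate.induct)
    case one
    show ?case by (rule exI[of _ "[]"]) auto
  next
    case (incl h)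
    then show ?case by (intro exI[of _ "[h]"]) auto
  next
    case (inv h)
    then show ?case by (intro exI[of _ "[h]"]) auto
  next
    case (eng h1 h2)
    then show ?case by (metis Un_subset_iff set_append val_append)
  qed
qed

lemma len_le: "set ss \<subseteq> gens W \<Longrightarrow> len (val ss) \<le> length ss"
  unfolding cox_length_def by (rule Least_le) auto

lemma ex_reduced_word:
  assumes "w \<in> carrier W" shows "\<exists>ss. set ss \<subseteq> gens W \<and> val ss = w \<and> length ss = len w"
proof -
  have "\<exists>k. \<exists>ss\<in>lists (gens W). length ss = k \<and> val ss = w"
    using ex_word[OF assms] by auto
  from LeastI_ex[OF this] show ?thesis
    unfolding cox_length_def[symmetric] by auto
qed

text \<open>The relators have even length, so the parity of a word depends only on its value. This
  is the sign character; it shows that multiplying by a generator always changes the length.\<close>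

lemma cong_even_length:
  "monoid_cong (gens W) (cox_relations W) ss ts \<Longrightarrow> even (length ss) = even (length ts)"
proof (induction rule: monoid_cong.induct)
  case (base xs ys)
  then obtain s t k where "xs = concat (replicate k [s, t])" "ys = []"
    unfolding cox_relations_def by auto
  moreover have "even (length (concat (replicate k [s, t])))" by (induction k) auto
  ultimately show ?case by auto
qed auto

lemma val_even_length:
  "set ss \<subseteq> gens W \<Longrightarrow> set ts \<subseteq> gens W \<Longrightarrow> val ss = val ts \<Longrightarrow> even (length ss) = even (length ts)"
  using cong_even_length val_eq_iff by blast

lemma len_mult_right_ne:
  assumes "w \<in> carrier W" "s \<in> gens W" shows "len (w \<otimes> s) \<noteq> len w"
proof
  assume eq: "len (w \<otimes> s) = len w"
  obtain ss where ss: "set ss \<subseteq> gens W" "val ss = w" "length ss = len w"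
    using ex_reduced_word assms by blast
  obtain ts where ts: "set ts \<subseteq> gens W" "val ts = w \<otimes> s" "length ts = len (w \<otimes> s)"
    using ex_reduced_word[of "w \<otimes> s"] assms by auto
  have "val (ss @ [s]) = val ts" using ss ts assms by (simp add: val_append)
  then have "even (length (ss @ [s])) = even (length ts)"
    using val_even_length[of "ss @ [s]" ts] ss ts assms by simp
  then show False using ss ts eq by simp
qed

lemma len_inv: assumes "w \<in> carrier W" shows "len (inv w) = len w"
proof -
  have le: "len (inv u) \<le> len u" if u: "u \<in> carrier W" for u
  proof -
    obtain ss where ss: "set ss \<subseteq> gens W" "val ss = u" "length ss = len u"
      using ex_reduced_word u by blast
    have "len (val (rev ss)) \<le> length (rev ss)" using ss by (intro len_le) auto
    then show ?thesis using ss by (simp add: val_rev)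
  qed
  show ?thesis using le[OF assms] le[of "inv w"] assms by simp
qed

lemma len_mult_le: assumes "u \<in> carrier W" "v \<in> carrier W" shows "len (u \<otimes> v) \<le> len u + len v"
proof -
  obtain ss where ss: "set ss \<subseteq> gens W" "val ss = u" "length ss = len u"
    using ex_reduced_word assms by blast
  obtain ts where ts: "set ts \<subseteq> gens W" "val ts = v" "length ts = len v"
    using ex_reduced_word assms by blast
  show ?thesis using len_le[of "ss @ ts"] ss ts by (simp add: val_append)
qed

lemma len_gen_le: assumes "s \<in> gens W" shows "len s \<le> 1"
  using len_le[of "[s]"] assms by simp

section \<open>The bilinear form and the reflections\<close>

definition cox_form :: "'w \<Rightarrow> 'w \<Rightarrow> real" where
  "cox_form s t = - 2 * cos (case cox_mat W s t of enat k \<Rightarrow> pi / real k | \<infinity> \<Rightarrow> 0)"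

definition root_form :: "'w \<Rightarrow> ('w \<Rightarrow> real) \<Rightarrow> real" where
  "root_form s v = (\<Sum>t\<in>gens W. cox_form s t * v t)"

lemma ord_mult_commute:
  assumes "s \<in> gens W" "t \<in> gens W" shows "ord (t \<otimes> s) = ord (s \<otimes> t)"
proof -
  have "inv (s \<otimes> t) = t \<otimes> s" using assms by (simp add: inv_mult_group)
  then show ?thesis using ord_inv[of "s \<otimes> t"] assms by auto
qed

lemma cox_mat_sym: "s \<in> gens W \<Longrightarrow> t \<in> gens W \<Longrightarrow> cox_mat W t s = cox_mat W s t"
  by (simp add: cox_mat_def ord_mult_commute)

lemma cox_form_sym: "s \<in> gens W \<Longrightarrow> t \<in> gens W \<Longrightarrow> cox_form t s = cox_form s t"
  by (simp add: cox_form_def cox_mat_sym)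

lemma cox_form_self [simp]: "s \<in> gens W \<Longrightarrow> cox_form s s = 2"
  by (simp add: cox_form_def cox_mat_def one_enat_def)

lemma bilin_simple: "s \<in> gens W \<Longrightarrow> cox_bilin W (simple_root s) v = root_form s v"
proof -
  assume s: "s \<in> gens W"
  have "cox_bilin W (simple_root s) v
      = (\<Sum>s'\<in>gens W. simple_root s s' * root_form s' v)"
    unfolding cox_bilin_def root_form_def cox_form_def sum_distrib_left
    by (intro sum.cong HOL.refl) (simp_all add: mult_ac)
  also have "\<dots> = (\<Sum>s'\<in>gens W. if s = s' then root_form s' v else 0)"
    by (intro sum.cong) (auto simp: simple_root_def)
  also have "\<dots> = root_form s v" using s by simp
  finally show ?thesis .
qed

lemma reflect_eq: "s \<in> gens W \<Longrightarrow> reflect W s v = (\<lambda>t. v t - root_form s v * simple_root s t)"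
  by (simp add: reflect_def bilin_simple)

lemma root_form_lin: "root_form s (\<lambda>t. a * u t + b * v t) = a * root_form s u + b * root_form s v"
  by (simp add: root_form_def sum.distrib sum_distrib_left algebra_simps)

lemma root_form_simple: "t \<in> gens W \<Longrightarrow> root_form s (simple_root t) = cox_form s t"
  by (simp add: root_form_def simple_root_def if_distrib cong: if_cong)

lemma reflect_lin:
  assumes "s \<in> gens W"
  shows "reflect W s (\<lambda>t. a * u t + b * v t) = (\<lambda>t. a * reflect W s u t + b * reflect W s v t)"
  using assms by (simp add: reflect_eq root_form_lin algebra_simps)

lemma act_lin:
  "set ss \<subseteq> gens W \<Longrightarrow> act ss (\<lambda>t. a * u t + b * v t) = (\<lambda>t. a * act ss u t + b * act ss v t)"
  by (induction ss) (auto simp: reflect_lin)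

lemma act_neg: "set ss \<subseteq> gens W \<Longrightarrow> act ss (\<lambda>t. - v t) = (\<lambda>t. - act ss v t)"
  using act_lin[of ss "-1" v 0 v] by simp

lemma reflect_simple [simp]: "s \<in> gens W \<Longrightarrow> reflect W s (simple_root s) = (\<lambda>t. - simple_root s t)"
  by (simp add: reflect_eq root_form_simple)

lemma reflect_reflect [simp]: assumes "s \<in> gens W" shows "reflect W s (reflect W s v) = v"
proof -
  have "root_form s (reflect W s v) = - root_form s v"
    using root_form_lin[of s 1 v "- root_form s v" "simple_root s"] assms
    by (simp add: reflect_eq root_form_simple)
  then show ?thesis using assms by (simp add: reflect_eq)
qed

section \<open>Alternating words and the dihedral relations\<close>

fun alt :: "nat \<Rightarrow> 'w \<Rightarrow> 'w \<Rightarrow> 'w list" where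
  "alt 0 s t = []"
| "alt (Suc k) s t = (if even k then t else s) # alt k s t"

lemma length_alt [simp]: "length (alt k s t) = k"
  by (induction k) auto

lemma set_alt: "set (alt k s t) \<subseteq> {s, t}"
  by (induction k) auto

lemma set_alt_gens [simp]: "s \<in> gens W \<Longrightarrow> t \<in> gens W \<Longrightarrow> set (alt k s t) \<subseteq> gens W"
  using set_alt[of k s t] by auto

lemma alt_snoc: "alt (Suc k) s t = alt k t s @ [t]"
  by (induction k) auto

lemma alt_add: "\<exists>ys. length ys = j \<and> set ys \<subseteq> {s, t} \<and> alt (j + k) s t = ys @ alt k s t"
proof (induction j)
  case (Suc j)
  then obtain ys where "length ys = j" "set ys \<subseteq> {s, t}" "alt (j + k) s t = ys @ alt k s t" by blast
  then show ?case by (intro exI[of _ "(if even (j + k) then t else s) # ys"]) auto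
qed auto

lemma alt_double: "alt (2 * k) s t = concat (replicate k [s, t])"
  by (induction k) auto

lemma val_alt_double:
  assumes "s \<in> gens W" "t \<in> gens W" shows "val (alt (2 * k) s t) = (s \<otimes> t) [^] k"
proof (induction k)
  case (Suc k)
  have "val (alt (2 * Suc k) s t) = s \<otimes> (t \<otimes> val (alt (2 * k) s t))" by simp
  also have "\<dots> = (s \<otimes> t) \<otimes> (s \<otimes> t) [^] k" using Suc assms by (simp add: m_assoc)
  also have "\<dots> = (s \<otimes> t) [^] Suc k" using assms nat_pow_Suc2 by simp
  finally show ?case .
qed auto

lemma ord_ge_2:
  assumes "s \<in> gens W" "t \<in> gens W" "s \<noteq> t" shows "ord (s \<otimes> t) = 0 \<or> ord (s \<otimes> t) \<ge> 2"
proof -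
  have "s \<otimes> t \<noteq> \<one>"
    using assms by (metis gens_closed gens_inv inv_equality)
  then have "ord (s \<otimes> t) \<noteq> 1" using assms ord_eq_1 by auto
  then show ?thesis by linarith
qed

text \<open>The coefficients of the images of simple roots under alternating words: \<open>U\<^sub>k\<^sub>-\<^sub>1(cos \<theta>)\<close> for the
  Chebyshev polynomials of the second kind, including the limit case \<open>\<theta> = 0\<close>.\<close>

fun cheb :: "real \<Rightarrow> nat \<Rightarrow> real" where
  "cheb c 0 = 0"
| "cheb c (Suc 0) = 1"
| "cheb c (Suc (Suc k)) = c * cheb c (Suc k) - cheb c k"

lemma cheb_sin: assumes "sin \<theta> \<noteq> 0" shows "cheb (2 * cos \<theta>) k = sin (real k * \<theta>) / sin \<theta>"
proof (induction "2 * cos \<theta>" k rule: cheb.induct)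
  case (3 k)
  have "sin (real (Suc (Suc k)) * \<theta>) = sin (real (Suc k) * \<theta>) * cos \<theta> + cos (real (Suc k) * \<theta>) * sin \<theta>"
    using sin_add[of "real (Suc k) * \<theta>" \<theta>] by (simp add: algebra_simps)
  moreover have "sin (real k * \<theta>) = sin (real (Suc k) * \<theta>) * cos \<theta> - cos (real (Suc k) * \<theta>) * sin \<theta>"
    using sin_diff[of "real (Suc k) * \<theta>" \<theta>] by (simp add: algebra_simps)
  ultimately have e: "sin (real (Suc (Suc k)) * \<theta>) = 2 * cos \<theta> * sin (real (Suc k) * \<theta>) - sin (real k * \<theta>)"
    by simp
  show ?case unfolding cheb.simps 3 e by (simp add: diff_divide_distrib)
qed (use assms in auto)

lemma cheb_2: "cheb 2 k = real k"
proof (induction "2 :: real" k rule: cheb.induct)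
  case (3 k)
  then show ?case by simp
qed auto

text \<open>The word ends in \<open>t\<close>, so the reflection in \<open>t\<close> acts first.
  Each further letter changes only one of the two coefficients, and does so by the recursion of
  \<open>cheb\<close>.\<close>

lemma act_alt:
  assumes s: "s \<in> gens W" "t \<in> gens W"
  shows "act (alt k s t) (simple_root s) =
    (if even k then (\<lambda>x. cheb (- cox_form s t) (Suc k) * simple_root s x + cheb (- cox_form s t) k * simple_root t x)
     else (\<lambda>x. cheb (- cox_form s t) k * simple_root s x + cheb (- cox_form s t) (Suc k) * simple_root t x))"
proof (induction k)
  case (Suc k)
  have "reflect W s (simple_root t) = (\<lambda>x. simple_root t x - cox_form s t * simple_root s x)"
    "reflect W t (simple_root s) = (\<lambda>x. simple_root s x - cox_form s t * simple_root t x)"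
    using s cox_form_sym[of t s] by (simp_all add: reflect_eq root_form_simple)
  then show ?case
    using s by (simp add: Suc reflect_lin) (simp add: fun_eq_iff algebra_simps)
qed auto

lemma cox_form_finite:
  assumes "ord (s \<otimes> t) = m" "m \<noteq> 0" shows "cox_form s t = - (2 * cos (pi / real m))"
  using assms by (simp add: cox_form_def cox_mat_def)

lemma cox_form_infinite: "ord (s \<otimes> t) = 0 \<Longrightarrow> cox_form s t = -2"
  by (simp add: cox_form_def cox_mat_def)

lemma sin_pi_div_pos: "m \<ge> 2 \<Longrightarrow> sin (pi / real m) > 0"
proof (rule sin_gt_zero)
  assume m: "m \<ge> 2"
  show "pi / real m < pi" using m pi_gt_zero by (simp add: divide_less_eq)
qed auto

text \<open>The plane of the two simple roots is covered by \<open>act_alt\<close>. Any other vector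
  is corrected by an element of this plane to one orthogonal to both roots, which both reflections
  fix.\<close>

lemma act_dihedral:
  assumes st: "s \<in> gens W" "t \<in> gens W" "s \<noteq> t" and m: "ord (s \<otimes> t) = m" "m \<noteq> 0"
  shows "act (alt (2 * m) s t) v = v"
proof -
  have m2: "m \<ge> 2" using ord_ge_2[OF st] m by auto
  define \<theta> where "\<theta> = pi / real m"
  have sn: "sin \<theta> > 0" using sin_pi_div_pos m2 by (simp add: \<theta>_def)
  have m\<theta>: "real m * \<theta> = pi" using m by (simp add: \<theta>_def)
  define c where "c = 2 * cos \<theta>"
  have b: "cox_form s t = - c" "cox_form t s = - c"
    using cox_form_finite[OF m] cox_form_sym[of s t] st by (auto simp: c_def \<theta>_def)
  have ch: "cheb c k = sin (real k * \<theta>) / sin \<theta>" for k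
    using cheb_sin[of \<theta> k] sn by (simp add: c_def)
  have s2: "sin (2 * real m * \<theta>) = 0" "cos (2 * real m * \<theta>) = 1"
    using m\<theta> by (simp_all add: mult.assoc)
  have c1: "cheb c (2 * m) = 0" using ch s2 by simp
  have c2: "cheb c (Suc (2 * m)) = 1"
    using ch[of "Suc (2 * m)"] sn s2 by (simp add: algebra_simps sin_add)
  have c3: "cheb c (2 * m - 1) = - 1"
    using ch[of "2 * m - 1"] sn s2 m2 by (simp add: of_nat_diff algebra_simps sin_diff)
  have As: "act (alt (2 * m) s t) (simple_root s) = simple_root s"
    using act_alt[OF st(1,2), of "2 * m"] b c1 c2 by simp
  \<comment> \<open>Splitting off the letter that acts first, which negates
    \<open>simple_root t\<close>, makes \<open>act_alt\<close> applicable with the two generators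
    exchanged.\<close>
  have "alt (2 * m) s t = alt (2 * m - 1) t s @ [t]"
    using alt_snoc[of "2 * m - 1" s t] m2 by simp
  then have "act (alt (2 * m) s t) (simple_root t) = act (alt (2 * m - 1) t s) (\<lambda>x. - simple_root t x)"
    using st by simp
  also have "\<dots> = (\<lambda>x. - act (alt (2 * m - 1) t s) (simple_root t) x)"
    using st by (intro act_neg) simp
  also have "\<dots> = simple_root t"
    using act_alt[OF st(2,1), of "2 * m - 1"] b c1 c3 m2 by (simp add: fun_eq_iff)
  finally have At: "act (alt (2 * m) s t) (simple_root t) = simple_root t" .
  \<comment> \<open>The Gram determinant of the two roots, nonzero because their order
    \<open>m\<close> is finite.\<close>
  have det: "4 - c * c \<noteq> 0"
  proof -
    have "4 - c * c = 4 * (sin \<theta>)\<^sup>2"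
      unfolding c_def sin_squared_eq by (simp add: power2_eq_square algebra_simps)
    then show ?thesis using sn by auto
  qed
  define a where "a = root_form s v"
  define d where "d = root_form t v"
  \<comment> \<open>\<open>p\<close> and \<open>q\<close> solve the linear system which says that
    \<open>u\<close> below is orthogonal to both roots.\<close>
  define p where "p = - (2 * a + c * d) / (4 - c * c)"
  define q where "q = - (2 * d + c * a) / (4 - c * c)"
  have pq: "a + 2 * p - c * q = 0" "d + 2 * q - c * p = 0"
    using det by (simp_all add: p_def q_def field_simps)
  define u where "u = (\<lambda>x. 1 * v x + 1 * (p * simple_root s x + q * simple_root t x))"
  have "root_form s u = 0" "root_form t u = 0"
    unfolding u_def root_form_lin using st pq b by (simp_all add: root_form_simple a_def[symmetric] d_def[symmetric] algebra_simps)
  then have "reflect W s u = u" "reflect W t u = u" using st by (simp_all add: reflect_eq)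
  then have U: "act (alt k s t) u = u" for k by (induction k) auto
  have v: "v = (\<lambda>x. 1 * u x + (- 1) * (p * simple_root s x + q * simple_root t x))"
    by (simp add: u_def)
  let ?A = "act (alt (2 * m) s t)"
  have "?A (\<lambda>x. 1 * u x + (- 1) * (p * simple_root s x + q * simple_root t x)) =
      (\<lambda>x. 1 * ?A u x + (- 1) * ?A (\<lambda>x. p * simple_root s x + q * simple_root t x) x)"
    using st by (intro act_lin) simp
  also have "?A (\<lambda>x. p * simple_root s x + q * simple_root t x)
      = (\<lambda>x. p * ?A (simple_root s) x + q * ?A (simple_root t) x)"
    using st by (intro act_lin) simp
  finally show ?thesis unfolding v[symmetric] U As At by simp
qed

lemma act_inverse: "set ss \<subseteq> gens W \<Longrightarrow> act (rev ss) (act ss v) = v"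
  by (induction ss arbitrary: v) auto

lemma act_cong_rel:
  "monoid_cong (gens W) (cox_relations W) ss ts \<Longrightarrow> act ss = act ts"
proof (induction rule: monoid_cong.induct)
  case (base xs ys)
  then obtain s t k where xs: "xs = concat (replicate k [s, t])" "ys = []"
    and st: "s \<in> gens W" "t \<in> gens W" "cox_mat W s t = enat k"
    unfolding cox_relations_def by auto
  have k: "ord (s \<otimes> t) = k" "k \<noteq> 0"
    using st(3) by (auto simp: cox_mat_def Let_def split: if_splits)
  show ?case
  proof (cases "s = t")
    case True
    have "act (concat (replicate n [s, s])) v = v" for n v
      using st by (induction n) auto
    then show ?thesis using xs True by auto
  next
    case False
    then show ?thesis using act_dihedral[OF st(1,2) False k] xs by (auto simp: alt_double)
  qed
qed auto

lemma act_cong: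
  "set ss \<subseteq> gens W \<Longrightarrow> set ts \<subseteq> gens W \<Longrightarrow> val ss = val ts \<Longrightarrow> act ss = act ts"
  using act_cong_rel val_eq_iff by blast

lemma cox_act_val: assumes "set ss \<subseteq> gens W" shows "cox_act W (val ss) = act ss"
  unfolding cox_act_def
proof (rule the_equality)
  show "\<exists>ts\<in>lists (gens W). val ts = val ss \<and> act ss = act ts" using assms by blast
next
  fix f assume "\<exists>ts\<in>lists (gens W). val ts = val ss \<and> f = act ts"
  then show "f = act ss" using assms act_cong by (metis in_lists_conv_set subsetI)
qed

section \<open>Positivity of images of simple roots\<close>

definition nonneg :: "('w \<Rightarrow> real) \<Rightarrow> bool" where
  "nonneg v \<longleftrightarrow> (\<forall>s\<in>gens W. v s \<ge> 0)"

lemma nonneg_simple [simp]: "nonneg (simple_root s)"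
  by (simp add: nonneg_def simple_root_def)

text \<open>For finite order \<open>m\<close> the coefficient is a quotient of sines whose angle k *
  pi / m stays between 0 and pi; for infinite order it is \<open>k\<close>.\<close>

lemma alt_coeff_nonneg:
  assumes st: "s \<in> gens W" "t \<in> gens W" "s \<noteq> t"
    and k: "ord (s \<otimes> t) = 0 \<or> k \<le> ord (s \<otimes> t)"
  shows "cheb (- cox_form s t) k \<ge> 0"
proof (cases "ord (s \<otimes> t) = 0")
  case True
  then show ?thesis by (simp add: cox_form_infinite cheb_2)
next
  case False
  define m where "m = ord (s \<otimes> t)"
  have m: "m \<ge> 2" using ord_ge_2[OF st] False by (simp add: m_def)
  have sn: "sin (pi / real m) > 0" using sin_pi_div_pos m by blast
  have "sin (real k * (pi / real m)) \<ge> 0"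
    using k False m by (intro sin_ge_zero) (auto simp: m_def field_simps)
  then show ?thesis using cheb_sin[of "pi / real m" k] sn cox_form_finite[of s t m] False
    by (simp add: m_def)
qed

text \<open>The proof splits off a maximal alternating tail of the element.\<close>

lemma simple_image_nonneg:
  assumes "set ss \<subseteq> gens W" "s \<in> gens W" "len (val ss \<otimes> s) > len (val ss)"
  shows "nonneg (act ss (simple_root s))"
  using assms
proof (induction "len (val ss)" arbitrary: ss s rule: less_induct)
  case less
  define w where "w = val ss"
  have w: "w \<in> carrier W" using less by (simp add: w_def)
  obtain rs where rs: "set rs \<subseteq> gens W" "val rs = w" "length rs = len w"
    using ex_reduced_word[OF w] by blast
  have act_rs: "act ss = act rs" using rs less by (intro act_cong) (auto simp: w_def)
  show ?case
  proof (cases rs rule: rev_cases)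
    case Nil
    then show ?thesis using act_rs by simp
  next
    case (snoc us t)
    have t: "t \<in> gens W" and us: "set us \<subseteq> gens W" using rs snoc by auto
    have st: "s \<noteq> t"
    proof
      assume "s = t"
      then have "w \<otimes> s = val us"
        using rs snoc t us by (auto simp: val_append m_assoc)
      then show False using len_le[OF us] less(4) rs snoc by (simp add: w_def)
    qed
    \<comment> \<open>\<open>P k\<close> says that \<open>w\<close> has a reduced expression ending
      in the alternating word of length \<open>k\<close>.\<close>
    define P where "P = (\<lambda>k. \<exists>vs. set vs \<subseteq> gens W \<and> w = val (vs @ alt k s t) \<and> length vs + k = len w)"
    have P1: "P 1" unfolding P_def using us rs snoc by (intro exI[of _ us]) auto
    have bound: "\<forall>k. P k \<longrightarrow> k \<le> len w" by (auto simp: P_def)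
    define K where "K = (GREATEST k. P k)"
    have PK: "P K" unfolding K_def using GreatestI_nat[of P 1 "len w"] P1 bound by blast
    have K1: "K \<ge> 1" unfolding K_def using Greatest_le_nat[of P 1 "len w"] P1 bound by blast
    have notP: "\<not> P (Suc K)"
      using Greatest_le_nat[of P "Suc K" "len w"] bound unfolding K_def[symmetric] by auto
    obtain vs where vs: "set vs \<subseteq> gens W" "w = val (vs @ alt K s t)" "length vs + K = len w"
      using PK by (auto simp: P_def)
    have sg: "s \<in> gens W" using less by simp
    have wv: "w = val vs \<otimes> val (alt K s t)" using vs sg t by (simp add: val_append)
    have len_vs: "len (val vs) = length vs"
    proof -
      have "len w \<le> len (val vs) + len (val (alt K s t))"
        unfolding wv using vs sg t by (intro len_mult_le) auto
      moreover have "len (val (alt K s t)) \<le> K" using len_le[of "alt K s t"] sg t by simp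
      moreover have "len (val vs) \<le> length vs" using len_le vs by blast
      ultimately show ?thesis using vs by linarith
    qed
    obtain k' where k': "K = Suc k'" using K1 by (cases K) auto
    define p where "p = (if even k' then t else s)"
    define p' where "p' = (if even k' then s else t)"
    have pp: "p \<in> gens W" "p' \<in> gens W" "{p, p'} = {s, t}" using sg t by (auto simp: p_def p'_def)
    have altK: "alt K s t = p # alt k' s t" by (simp add: k' p_def)
    have altSK: "alt (Suc K) s t = p' # alt K s t" by (simp add: k' p'_def)
    \<comment> \<open>\<open>p\<close> is the leftmost letter of the tail, and \<open>p'\<close> the
      one that would precede it. If \<open>p\<close> shortened \<open>vs\<close>, then
      \<open>w\<close> would have a word shorter than its length; if \<open>p'\<close> did, the tail
      could be prolonged.\<close>
    have up_p: "len (val vs \<otimes> p) > len (val vs)"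
    proof (rule ccontr)
      assume "\<not> ?thesis"
      then have lt: "len (val vs \<otimes> p) < len (val vs)"
        using len_mult_right_ne[of "val vs" p] vs pp by simp
      have "w = (val vs \<otimes> p) \<otimes> val (alt k' s t)"
        using wv altK vs pp sg t by (simp add: m_assoc)
      then have "len w \<le> len (val vs \<otimes> p) + len (val (alt k' s t))"
        using vs pp sg t by (simp add: len_mult_le)
      moreover have "len (val (alt k' s t)) \<le> k'" using len_le[of "alt k' s t"] sg t by simp
      ultimately show False using lt len_vs vs k' by linarith
    qed
    have up_p': "len (val vs \<otimes> p') > len (val vs)"
    proof (rule ccontr)
      assume "\<not> ?thesis"
      then have lt: "len (val vs \<otimes> p') < len (val vs)"
        using len_mult_right_ne[of "val vs" p'] vs pp by simp
      obtain vs' where vs': "set vs' \<subseteq> gens W" "val vs' = val vs \<otimes> p'" "length vs' = len (val vs \<otimes> p')"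
        using ex_reduced_word[of "val vs \<otimes> p'"] vs pp by auto
      have "val vs' \<otimes> (p' \<otimes> val (alt K s t)) = val vs \<otimes> (p' \<otimes> p') \<otimes> val (alt K s t)"
        using vs vs' pp(1,2) sg t by (simp add: m_assoc del: gens_sq)
      then have "val vs' \<otimes> (p' \<otimes> val (alt K s t)) = w"
        using wv vs pp by simp
      then have wv': "w = val (vs' @ alt (Suc K) s t)"
        using val_append[OF vs'(1) set_alt_gens[OF sg t, of "Suc K"]] unfolding altSK val_Cons by simp
      have "len w \<le> length vs' + Suc K"
        unfolding wv' using len_le[of "vs' @ alt (Suc K) s t"] vs' set_alt_gens[OF sg t, of "Suc K"]
        by (simp del: alt.simps)
      then have "length vs' + Suc K = len w" using vs'(3) lt len_vs vs(3) by linarith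
      then have "P (Suc K)" unfolding P_def using vs' wv' by blast
      then show False using notP by blast
    qed
    have lt_w: "len (val vs) < len w" using len_vs vs K1 by linarith
    have "nonneg (act vs (simple_root p))" "nonneg (act vs (simple_root p'))"
      using less(1)[of vs p] less(1)[of vs p'] lt_w vs pp up_p up_p' by (auto simp: w_def)
    then have nn: "nonneg (act vs (simple_root s))" "nonneg (act vs (simple_root t))"
      using pp(3) by (auto simp: doubleton_eq_iff)
    \<comment> \<open>A longer tail would contain \<open>alt m s t\<close>, and the dihedral
      relation rewrites this word followed by \<open>s\<close> as one of length
      \<open>m - 1\<close>. Then \<open>w \<otimes> s\<close> would be shorter than
      \<open>w\<close>.\<close>
    have Km: "ord (s \<otimes> t) = 0 \<or> K < ord (s \<otimes> t)"
    proof (rule ccontr)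
      assume "\<not> ?thesis"
      then have m0: "ord (s \<otimes> t) \<noteq> 0" and Kge: "K \<ge> ord (s \<otimes> t)" by auto
      define m where "m = ord (s \<otimes> t)"
      have m2: "m \<ge> 2" using ord_ge_2[OF sg t st] m0 by (simp add: m_def)
      obtain ys where ys: "length ys = K - m" "set ys \<subseteq> {s, t}" "alt K s t = ys @ alt m s t"
        using alt_add[of "K - m" s t m] Kge by (auto simp: m_def)
      obtain zs where zs: "length zs = m - 1" "set zs \<subseteq> {t, s}" "alt (2 * m) t s = zs @ alt (Suc m) t s"
        using alt_add[of "m - 1" t s "Suc m"] m2 by (auto simp: mult_2)
      have ysg: "set ys \<subseteq> gens W" and zsg: "set zs \<subseteq> gens W" using ys zs sg t by auto
      have "(t \<otimes> s) [^] m = \<one>"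
        using pow_eq_id[of "t \<otimes> s" m] ord_mult_commute[OF sg t] sg t by (simp add: m_def)
      then have "val (alt (2 * m) t s) = \<one>" using val_alt_double[OF t sg] by simp
      then have "val zs \<otimes> (val (alt m s t) \<otimes> s) = \<one>"
        unfolding zs(3) alt_snoc using zsg sg t by (simp add: val_append)
      then have e: "val (alt m s t) \<otimes> s = val (rev zs)"
        using val_rev[OF zsg] zsg sg t
        by (metis (no_types) gens_closed inv_equality inv_inv m_closed set_alt_gens val_closed)
      have "w \<otimes> s = val vs \<otimes> (val ys \<otimes> (val (alt m s t) \<otimes> s))"
        unfolding wv ys(3) using ysg vs sg t by (simp add: val_append m_assoc)
      also have "\<dots> = val (vs @ ys @ rev zs)"
        unfolding e using vs ysg zsg by (simp add: val_append)
      finally have "len (w \<otimes> s) \<le> length (vs @ ys @ rev zs)"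
        using len_le[of "vs @ ys @ rev zs"] vs ysg zsg by simp
      then have "len (w \<otimes> s) < len w"
        using ys zs vs(3) Kge m2 by (simp add: m_def)
      then show False using less(4) by (simp add: w_def)
    qed
    have co: "cheb (- cox_form s t) K \<ge> 0" "cheb (- cox_form s t) (Suc K) \<ge> 0"
      using alt_coeff_nonneg[OF sg t st, of K] alt_coeff_nonneg[OF sg t st, of "Suc K"] Km by auto
    obtain a b where ab: "a \<ge> 0" "b \<ge> 0"
      "act (alt K s t) (simple_root s) = (\<lambda>x. a * simple_root s x + b * simple_root t x)"
      using act_alt[OF sg t, of K] co by (cases "even K") auto
    have "act ss = act (vs @ alt K s t)"
      using act_cong[of ss "vs @ alt K s t"] vs less sg t by (simp add: w_def)
    then have "act ss (simple_root s) = act vs (\<lambda>x. a * simple_root s x + b * simple_root t x)"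
      using ab(3) by simp
    also have "\<dots> = (\<lambda>x. a * act vs (simple_root s) x + b * act vs (simple_root t) x)"
      using act_lin vs by blast
    finally show ?thesis using nn ab by (auto simp: nonneg_def)
  qed
qed

end

section \<open>Positive and negative roots\<close>

context coxeter_group
begin

abbreviation "V \<equiv> verts W"
abbreviation "gen \<equiv> gen_of W"
abbreviation "adj \<equiv> adjacent W"
abbreviation "sroot x \<equiv> simple_root (gen x)"
abbreviation "vreflect x \<equiv> reflect W (gen x)"
abbreviation "rho xs \<equiv> val (map gen xs)"
abbreviation "pos \<equiv> positive_root W"
abbreviation "neg \<equiv> negative_root W"

definition word_act :: "'v list \<Rightarrow> ('w \<Rightarrow> real) \<Rightarrow> ('w \<Rightarrow> real)" where
  "word_act xs = act (map gen xs)"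

definition reduced_word :: "'v list \<Rightarrow> bool" where
  "reduced_word xs \<longleftrightarrow> len (rho xs) = length xs"

lemma gen_bij: "bij_betw gen V (gens W)"
  using coxeter unfolding coxeter_system_def by auto

lemma gen_gens [simp]: "x \<in> V \<Longrightarrow> gen x \<in> gens W"
  using gen_bij bij_betwE by blast

lemma gen_eq_iff [simp]: "x \<in> V \<Longrightarrow> y \<in> V \<Longrightarrow> gen x = gen y \<longleftrightarrow> x = y"
  using gen_bij unfolding bij_betw_def inj_on_def by blast

lemma gens_gen: "s \<in> gens W \<Longrightarrow> \<exists>x\<in>V. s = gen x"
  using gen_bij unfolding bij_betw_def by auto

lemma finite_verts [simp]: "finite V"
  using gen_bij bij_betw_finite by fastforce

lemma map_gen_gens [simp]: "set xs \<subseteq> V \<Longrightarrow> gen ` set xs \<subseteq> gens W"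
  by auto

lemma word_lift: "set ss \<subseteq> gens W \<Longrightarrow> \<exists>xs. set xs \<subseteq> V \<and> map gen xs = ss"
proof (induction ss)
  case (Cons s ss)
  then obtain xs where "set xs \<subseteq> V" "map gen xs = ss" by auto
  moreover obtain x where "x \<in> V" "s = gen x" using gens_gen[of s] Cons.prems by auto
  ultimately show ?case by (intro exI[of _ "x # xs"]) auto
qed auto

lemma word_act_Nil [simp]: "word_act [] v = v" by (simp add: word_act_def)
lemma word_act_Cons [simp]: "word_act (x # xs) v = vreflect x (word_act xs v)" by (simp add: word_act_def)
lemma word_act_append [simp]: "word_act (xs @ ys) v = word_act xs (word_act ys v)" by (simp add: word_act_def)

lemma word_act_lin:
  "set xs \<subseteq> V \<Longrightarrow> word_act xs (\<lambda>t. a * u t + b * v t) = (\<lambda>t. a * word_act xs u t + b * word_act xs v t)"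
  by (simp add: word_act_def act_lin)

lemma word_act_neg: "set xs \<subseteq> V \<Longrightarrow> word_act xs (\<lambda>t. - v t) = (\<lambda>t. - word_act xs v t)"
  by (simp add: word_act_def act_neg)

lemma word_act_rev [simp]: "set xs \<subseteq> V \<Longrightarrow> word_act (rev xs) (word_act xs v) = v"
  by (simp add: word_act_def act_inverse flip: rev_map)

lemma word_act_rev_right [simp]: "set xs \<subseteq> V \<Longrightarrow> word_act xs (word_act (rev xs) v) = v"
  using word_act_rev[of "rev xs"] by simp

lemma word_act_inject: "set xs \<subseteq> V \<Longrightarrow> word_act xs u = word_act xs v \<longleftrightarrow> u = v"
  by (metis word_act_rev)

lemma cox_act_rho: "set xs \<subseteq> V \<Longrightarrow> cox_act W (rho xs) = word_act xs"
  by (simp add: word_act_def cox_act_val)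

lemma roots_iff: "a \<in> roots W \<longleftrightarrow> (\<exists>xs x. set xs \<subseteq> V \<and> x \<in> V \<and> a = word_act xs (sroot x))"
proof
  assume "a \<in> roots W"
  then obtain w s where a: "a = cox_act W w (simple_root s)" "w \<in> carrier W" "s \<in> gens W"
    unfolding roots_def by auto
  obtain ss where "set ss \<subseteq> gens W" "val ss = w" using ex_word a by blast
  then obtain xs where "set xs \<subseteq> V" "rho xs = w" using word_lift by blast
  then show "\<exists>xs x. set xs \<subseteq> V \<and> x \<in> V \<and> a = word_act xs (sroot x)"
    using gens_gen[OF a(3)] a cox_act_rho by metis
next
  assume "\<exists>xs x. set xs \<subseteq> V \<and> x \<in> V \<and> a = word_act xs (sroot x)"
  then obtain xs x where "set xs \<subseteq> V" "x \<in> V" "a = cox_act W (rho xs) (sroot x)"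
    using cox_act_rho by metis
  then show "a \<in> roots W" unfolding roots_def by force
qed

lemma word_act_roots [simp]: "set xs \<subseteq> V \<Longrightarrow> word_act xs a \<in> roots W \<longleftrightarrow> a \<in> roots W"
proof -
  assume xs: "set xs \<subseteq> V"
  have imp: "word_act ys b \<in> roots W" if "set ys \<subseteq> V" "b \<in> roots W" for ys b
    using that unfolding roots_iff by (metis word_act_append Un_subset_iff set_append)
  show ?thesis using imp[OF xs] imp[of "rev xs" "word_act xs a"] xs by auto
qed

lemma sroot_roots [simp]: "x \<in> V \<Longrightarrow> sroot x \<in> roots W"
  unfolding roots_iff by (intro exI[of _ "[]"] exI[of _ x]) auto

lemma refl_roots [simp]: "x \<in> V \<Longrightarrow> vreflect x a \<in> roots W \<longleftrightarrow> a \<in> roots W"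
  using word_act_roots[of "[x]"] by simp

lemma neg_roots: "a \<in> roots W \<Longrightarrow> (\<lambda>t. - a t) \<in> roots W"
proof -
  assume "a \<in> roots W"
  then obtain xs x where "set xs \<subseteq> V" "x \<in> V" "a = word_act xs (sroot x)" by (auto simp: roots_iff)
  then have "(\<lambda>t. - a t) = word_act (xs @ [x]) (sroot x)" by (simp add: word_act_neg)
  then show ?thesis using \<open>set xs \<subseteq> V\<close> \<open>x \<in> V\<close> by (simp only:) (simp del: word_act_append)
qed

text \<open>If \<open>x\<close> does not lengthen \<open>xs\<close> on the right, it lengthens
  \<open>xs @ [x]\<close>, which sends the simple root to the opposite vector.\<close>

lemma root_sign: assumes "a \<in> roots W" shows "nonneg a \<or> nonneg (\<lambda>t. - a t)"
proof -
  obtain xs x where a: "set xs \<subseteq> V" "x \<in> V" "a = word_act xs (sroot x)" using assms by (auto simp: roots_iff)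
  show ?thesis
  proof (cases "len (rho xs \<otimes> gen x) > len (rho xs)")
    case True
    then have "nonneg (act (map gen xs) (sroot x))" using a by (intro simple_image_nonneg) auto
    then show ?thesis by (simp add: a word_act_def)
  next
    case False
    have r: "rho (xs @ [x]) = rho xs \<otimes> gen x" using a by (simp add: val_append)
    have "len (rho xs \<otimes> gen x) < len (rho xs)"
      using False len_mult_right_ne[of "rho xs" "gen x"] a by simp
    then have "len (rho (xs @ [x]) \<otimes> gen x) > len (rho (xs @ [x]))"
      using a unfolding r by (simp add: m_assoc)
    then have "nonneg (act (map gen (xs @ [x])) (sroot x))" using a by (intro simple_image_nonneg) auto
    then have "nonneg (word_act xs (\<lambda>t. - sroot x t))" using a by (simp add: word_act_def)
    then show ?thesis by (simp add: a word_act_neg)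
  qed
qed

lemma reflect_outside: "t \<notin> gens W \<Longrightarrow> s \<in> gens W \<Longrightarrow> reflect W s v t = v t"
  by (auto simp: reflect_eq simple_root_def)

lemma root_outside: assumes "a \<in> roots W" "t \<notin> gens W" shows "a t = 0"
proof -
  obtain xs x where a: "set xs \<subseteq> V" "x \<in> V" "a = word_act xs (sroot x)" using assms by (auto simp: roots_iff)
  have "word_act xs v t = v t" for v using a(1) assms(2) by (induction xs) (auto simp: reflect_outside)
  then show ?thesis using a assms(2) by (auto simp: simple_root_def)
qed

section \<open>The invariant form and sign changes\<close>

definition form :: "('w \<Rightarrow> real) \<Rightarrow> ('w \<Rightarrow> real) \<Rightarrow> real" where
  "form u v = (\<Sum>s\<in>gens W. u s * root_form s v)"

lemma form_lin_left: "form (\<lambda>t. a * u t + b * u' t) v = a * form u v + b * form u' v"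
  by (simp add: form_def sum.distrib sum_distrib_left algebra_simps)

lemma form_sym: "form u v = form v u"
proof -
  have "form u v = (\<Sum>s\<in>gens W. \<Sum>t\<in>gens W. u s * cox_form s t * v t)"
    by (simp add: form_def root_form_def sum_distrib_left mult.assoc)
  also have "\<dots> = (\<Sum>t\<in>gens W. \<Sum>s\<in>gens W. u s * cox_form s t * v t)"
    by (rule sum.swap)
  also have "\<dots> = form v u"
    unfolding form_def root_form_def sum_distrib_left
    by (intro sum.cong HOL.refl) (simp_all add: cox_form_sym mult_ac)
  finally show ?thesis .
qed

lemma form_simple: "s \<in> gens W \<Longrightarrow> form (simple_root s) v = root_form s v"
  using bilin_simple[of s v] by (simp add: form_def simple_root_def if_distrib[of "\<lambda>x. x * _"] cong: if_cong)

lemma form_reflect: assumes "s \<in> gens W" shows "form (reflect W s u) (reflect W s v) = form u v"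
proof -
  have l: "form (reflect W s u) w = form u w - root_form s u * root_form s w" for u w
    using form_lin_left[of 1 u "- root_form s u" "simple_root s" w] assms by (simp add: reflect_eq form_simple)
  have "root_form s (reflect W s v) = - root_form s v"
    using root_form_lin[of s 1 v "- root_form s v" "simple_root s"] assms by (simp add: reflect_eq root_form_simple)
  then have "form (reflect W s u) (reflect W s v) = form (reflect W s v) u + root_form s u * root_form s v"
    using l[of u "reflect W s v"] form_sym by simp
  then show ?thesis using l[of v u] form_sym by simp
qed

lemma form_word_act: "set xs \<subseteq> V \<Longrightarrow> form (word_act xs u) (word_act xs v) = form u v"
  by (induction xs) (auto simp: form_reflect)

lemma form_root: "a \<in> roots W \<Longrightarrow> form a a = 2"
  by (auto simp: roots_iff form_word_act form_simple root_form_simple)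

lemma pos_iff: "pos a \<longleftrightarrow> a \<in> roots W \<and> nonneg a"
  by (simp add: positive_root_def nonneg_def)

lemma neg_iff: "neg a \<longleftrightarrow> a \<in> roots W \<and> nonneg (\<lambda>t. - a t)"
  by (simp add: negative_root_def nonneg_def)

lemma root_nonzero: assumes "a \<in> roots W" shows "\<exists>s\<in>gens W. a s \<noteq> 0"
proof (rule ccontr)
  assume "\<not> ?thesis"
  then have "form a a = 0" by (simp add: form_def)
  then show False using form_root assms by simp
qed

lemma pos_not_neg: "pos a \<Longrightarrow> \<not> neg a"
  using root_nonzero unfolding positive_root_def negative_root_def by fastforce

lemma root_pos_or_neg: "a \<in> roots W \<Longrightarrow> neg a \<longleftrightarrow> \<not> pos a"
  using root_sign pos_not_neg pos_iff neg_iff by blast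

lemma pos_uminus: "a \<in> roots W \<Longrightarrow> pos (\<lambda>t. - a t) \<longleftrightarrow> \<not> pos a"
  using neg_roots root_pos_or_neg by (auto simp: pos_iff neg_iff)

lemma pos_roots: "pos a \<Longrightarrow> a \<in> roots W" by (simp add: pos_iff)

lemma sroot_pos [simp]: "x \<in> V \<Longrightarrow> pos (sroot x)" by (simp add: pos_iff)

lemma refl_coord: "x \<in> V \<Longrightarrow> y \<in> V \<Longrightarrow> y \<noteq> x \<Longrightarrow> vreflect x v (gen y) = v (gen y)"
  by (simp add: reflect_eq simple_root_def)

lemma word_act_coord: "set xs \<subseteq> V \<Longrightarrow> y \<in> V \<Longrightarrow> y \<notin> set xs \<Longrightarrow> word_act xs v (gen y) = v (gen y)"
  by (induction xs) (auto simp: refl_coord)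

lemma root_no_mixed_signs:
  assumes "a \<in> roots W" "s \<in> gens W" "t \<in> gens W" "a s < 0" "a t > 0" shows False
  using root_sign[OF assms(1)] assms unfolding nonneg_def by force

text \<open>The reflection changes only the coordinate at \<open>x\<close>, so a change of sign
  forces all other coordinates to vanish. As the form is 2 on roots, the remaining coordinate is
  1.\<close>

lemma pos_refl_neg:
  assumes x: "x \<in> V" and a: "pos a" and n: "\<not> pos (vreflect x a)" shows "a = sroot x"
proof -
  have r: "a \<in> roots W" using a by (rule pos_roots)
  have n': "neg (vreflect x a)" using root_pos_or_neg[of "vreflect x a"] r x n by simp
  have z: "a s = 0" if "s \<noteq> gen x" for s
  proof (cases "s \<in> gens W")
    case True
    then obtain y where y: "y \<in> V" "s = gen y" using gens_gen by blast
    then have "vreflect x a s = a s" using refl_coord x that by auto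
    then show ?thesis using n' a True unfolding positive_root_def negative_root_def by force
  qed (use r root_outside in auto)
  define k where "k = a (gen x)"
  have ak: "a = (\<lambda>t. k * sroot x t + 0 * sroot x t)" using z by (auto simp: simple_root_def k_def)
  have "form a a = k * root_form (gen x) a"
    by (subst (1) ak, subst form_lin_left) (use x in \<open>simp add: form_simple\<close>)
  also have "root_form (gen x) a = 2 * k"
    by (subst ak, subst root_form_lin) (use x in \<open>simp add: root_form_simple\<close>)
  finally have "k * k = 1" using form_root[OF r] by simp
  moreover have "k \<ge> 0" using a x unfolding k_def positive_root_def by auto
  ultimately have "k = 1" by (simp add: square_eq_1_iff)
  then show ?thesis using ak by simp
qed

lemma sign_change:
  assumes "set ws \<subseteq> V" "pos a" "\<not> pos (word_act ws a)"
  shows "\<exists>us x vs. ws = us @ x # vs \<and> word_act vs a = sroot x"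
  using assms
proof (induction ws)
  case (Cons x ws)
  show ?case
  proof (cases "pos (word_act ws a)")
    case True
    then have "word_act ws a = sroot x" using Cons.prems pos_refl_neg[of x "word_act ws a"] by simp
    then show ?thesis by blast
  next
    case False
    then obtain us y vs where "ws = us @ y # vs" "word_act vs a = sroot y" using Cons by auto
    then show ?thesis by (metis append_Cons)
  qed
qed auto

section \<open>Reduced words\<close>

lemma rho_closed [simp]: "set xs \<subseteq> V \<Longrightarrow> rho xs \<in> carrier W" by simp

lemma rho_append: "set xs \<subseteq> V \<Longrightarrow> set ys \<subseteq> V \<Longrightarrow> rho (xs @ ys) = rho xs \<otimes> rho ys"
  by (simp add: val_append)

lemma len_rho_le: "set xs \<subseteq> V \<Longrightarrow> len (rho xs) \<le> length xs"
  using len_le[of "map gen xs"] by simp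

lemma reduced_word_append: assumes "reduced_word (xs @ ys)" "set (xs @ ys) \<subseteq> V" shows "reduced_word xs" "reduced_word ys"
proof -
  have "len (rho (xs @ ys)) \<le> len (rho xs) + len (rho ys)"
    using rho_append[of xs ys] len_mult_le[of "rho xs" "rho ys"] assms(2) by simp
  then show "reduced_word xs" "reduced_word ys"
    using len_rho_le[of xs] len_rho_le[of ys] assms unfolding reduced_word_def by auto
qed

lemma reduced_word_Nil [simp]: "reduced_word []"
  using len_le[of "[]"] by (simp add: reduced_word_def)

text \<open>One direction is \<open>simple_image_nonneg\<close> for the inverse element. The other
  is the same direction for \<open>x # xs\<close>, whose inverse sends the simple root to the
  opposite vector.\<close>

lemma len_gen_mult_less_iff:
  assumes "x \<in> V" "set xs \<subseteq> V"
  shows "len (rho xs) < len (gen x \<otimes> rho xs) \<longleftrightarrow> pos (word_act (rev xs) (sroot x))"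
proof -
  have up: "pos (word_act (rev ys) (sroot x))" if ys: "set ys \<subseteq> V" "len (rho ys) < len (gen x \<otimes> rho ys)" for ys
  proof -
    have "rho (rev ys) = inv (rho ys)" using ys val_rev[of "map gen ys"] by (simp add: rev_map)
    moreover have "inv (gen x \<otimes> rho ys) = inv (rho ys) \<otimes> gen x"
      using assms ys by (simp add: inv_mult_group)
    ultimately have "len (rho (rev ys)) < len (rho (rev ys) \<otimes> gen x)"
      using ys assms len_inv[of "rho ys"] len_inv[of "gen x \<otimes> rho ys"] by simp
    then have "nonneg (word_act (rev ys) (sroot x))"
      unfolding word_act_def using ys assms by (intro simple_image_nonneg) auto
    then show ?thesis using ys assms by (simp add: pos_iff)
  qed
  have ne: "len (gen x \<otimes> rho xs) \<noteq> len (rho xs)"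
    using len_mult_right_ne[of "inv (rho xs)" "gen x"] assms len_inv[of "rho xs"]
      len_inv[of "gen x \<otimes> rho xs"] by (simp add: inv_mult_group)
  show ?thesis
  proof
    assume "pos (word_act (rev xs) (sroot x))"
    show "len (rho xs) < len (gen x \<otimes> rho xs)"
    proof (rule ccontr)
      assume "\<not> ?thesis"
      then have lt: "len (gen x \<otimes> rho xs) < len (rho xs)" using ne by simp
      have "gen x \<otimes> rho (x # xs) = gen x \<otimes> gen x \<otimes> rho xs"
        using assms by (simp add: m_assoc del: gens_sq)
      then have "gen x \<otimes> rho (x # xs) = rho xs" using assms by simp
      then have "pos (word_act (rev (x # xs)) (sroot x))" using up[of "x # xs"] lt assms by simp
      then have "pos (\<lambda>t. - word_act (rev xs) (sroot x) t)" using assms by (simp add: word_act_neg)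
      then show False using \<open>pos (word_act (rev xs) (sroot x))\<close> pos_uminus assms by simp
    qed
  next
    assume "len (rho xs) < len (gen x \<otimes> rho xs)"
    then show "pos (word_act (rev xs) (sroot x))" using up assms by blast
  qed
qed

lemma reduced_word_Cons:
  assumes "x \<in> V" "set xs \<subseteq> V"
  shows "reduced_word (x # xs) \<longleftrightarrow> reduced_word xs \<and> pos (word_act (rev xs) (sroot x))"
proof -
  have "reduced_word xs" if "reduced_word (x # xs)" using reduced_word_append(2)[of "[x]" xs] that assms by simp
  moreover have "len (gen x \<otimes> rho xs) \<le> 1 + len (rho xs)"
    using len_mult_le[of "gen x" "rho xs"] len_gen_le[of "gen x"] assms by simp
  ultimately show ?thesis
    using len_gen_mult_less_iff[OF assms] unfolding reduced_word_def by auto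
qed

text \<open>The first letter \<open>u\<close> to make the image negative would satisfy
  \<open>word_act us (sroot t) = sroot u\<close>, so that \<open>u\<close> and \<open>t\<close>
  cancel in the word.\<close>

lemma reduced_word_pos_image:
  assumes "reduced_word (us @ t # vs)" "set (us @ t # vs) \<subseteq> V" shows "pos (word_act us (sroot t))"
  using assms
proof (induction us)
  case (Cons u us)
  have IH: "pos (word_act us (sroot t))" using Cons.IH Cons.prems reduced_word_append(2)[of "[u]" "us @ t # vs"] by simp
  show ?case
  proof (rule ccontr)
    assume "\<not> ?thesis"
    then have e: "word_act us (sroot t) = sroot u" using pos_refl_neg[of u "word_act us (sroot t)"] IH Cons.prems by simp
    have "pos (word_act (rev (us @ t # vs)) (sroot u))" using Cons reduced_word_Cons[of u "us @ t # vs"] by simp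
    moreover have "word_act (rev us) (sroot u) = sroot t"
      using word_act_rev[of us "sroot t"] Cons.prems(2) unfolding e by simp
    ultimately have p: "pos (\<lambda>r. - word_act (rev vs) (sroot t) r)" using Cons.prems(2) by (simp add: word_act_neg)
    have "reduced_word (t # vs)" using reduced_word_append(2)[of "u # us" "t # vs"] Cons by simp
    then have "pos (word_act (rev vs) (sroot t))" using Cons.prems by (simp add: reduced_word_Cons)
    then show False using p pos_uminus[of "word_act (rev vs) (sroot t)"] Cons.prems by simp
  qed
qed simp

text \<open>An isometry conjugates the reflection in a root into the reflection in its
  image.\<close>

lemma word_act_conj:
  assumes "set zs \<subseteq> V" "x \<in> V" "y \<in> V" "word_act zs (sroot x) = sroot y"
  shows "word_act zs (vreflect x v) = vreflect y (word_act zs v)"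
proof -
  have "root_form (gen y) (word_act zs v) = root_form (gen x) v"
    using form_word_act[OF assms(1), of "sroot x" v] assms by (simp add: form_simple)
  then show ?thesis
    using word_act_lin[OF assms(1), of 1 v "- root_form (gen x) v" "sroot x"] assms by (simp add: reflect_eq)
qed

section \<open>Adjacency and commuting generators\<close>

lemma adj_sym: "adj x y \<longleftrightarrow> adj y x"
  by (auto simp: adjacent_def cox_mat_sym)

lemma adj_verts: "adj x y \<Longrightarrow> x \<in> V" "adj x y \<Longrightarrow> y \<in> V" "adj x y \<Longrightarrow> x \<noteq> y"
  by (auto simp: adjacent_def)

lemma nonadj_ord:
  assumes "x \<in> V" "y \<in> V" "x \<noteq> y" "\<not> adj x y" shows "ord (gen x \<otimes> gen y) = 2"
proof -
  let ?m = "ord (gen x \<otimes> gen y)"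
  have "\<not> 2 < cox_mat W (gen x) (gen y)" using assms by (simp add: adjacent_def)
  then have "?m \<noteq> 0" "?m \<le> 2"
    by (auto simp: cox_mat_def numeral_eq_enat Let_def split: if_splits)
  then show ?thesis using ord_ge_2[of "gen x" "gen y"] assms by auto
qed

lemma nonadj_cox_form: "x \<in> V \<Longrightarrow> y \<in> V \<Longrightarrow> x \<noteq> y \<Longrightarrow> \<not> adj x y \<Longrightarrow> cox_form (gen x) (gen y) = 0"
  using nonadj_ord cox_form_finite[of "gen x" "gen y" 2] by simp

lemma nonadj_commute:
  assumes "x \<in> V" "y \<in> V" "x \<noteq> y" "\<not> adj x y" shows "gen x \<otimes> gen y = gen y \<otimes> gen x"
proof -
  have "(gen x \<otimes> gen y) [^] (2::nat) = \<one>"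
    using pow_eq_id[of "gen x \<otimes> gen y" 2] nonadj_ord[OF assms] assms by simp
  then have "inv (gen x \<otimes> gen y) = gen x \<otimes> gen y"
    using assms by (intro inv_equality) (auto simp: numeral_2_eq_2 m_assoc)
  then show ?thesis using assms by (simp add: inv_mult_group)
qed

lemma adj_cox_form: assumes "adj x y" shows "cox_form (gen x) (gen y) < 0"
proof (cases "ord (gen x \<otimes> gen y) = 0")
  case True
  then show ?thesis by (simp add: cox_form_infinite)
next
  case False
  define m where "m = ord (gen x \<otimes> gen y)"
  have "m > 2" using assms False unfolding adjacent_def m_def
    by (auto simp: cox_mat_def numeral_eq_enat Let_def)
  then have "cos (pi / real m) > 0"
    by (intro cos_gt_zero) (auto simp: field_simps)
  then show ?thesis using cox_form_finite[of "gen x" "gen y" m] False by (simp add: m_def)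
qed

lemma refl_sroot: "x \<in> V \<Longrightarrow> y \<in> V \<Longrightarrow> vreflect x (sroot y) = (\<lambda>t. 1 * sroot y t + (- cox_form (gen x) (gen y)) * sroot x t)"
  by (simp add: reflect_eq root_form_simple)

lemma refl_sroot_nonadj: "x \<in> V \<Longrightarrow> y \<in> V \<Longrightarrow> x \<noteq> y \<Longrightarrow> \<not> adj x y \<Longrightarrow> vreflect x (sroot y) = sroot y"
  by (simp add: refl_sroot nonadj_cox_form)

lemma word_act_sroot_nonadj:
  "set us \<subseteq> V \<Longrightarrow> x \<in> V \<Longrightarrow> \<forall>t\<in>set us. t \<noteq> x \<and> \<not> adj x t \<Longrightarrow> word_act us (sroot x) = sroot x"
  by (induction us) (auto simp: refl_sroot_nonadj adj_sym)

end

section \<open>Firing sinks and the Euler form\<close>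

context coxeter_group
begin

definition orient :: "('v \<times> 'v) set \<Rightarrow> bool" where
  "orient Q \<longleftrightarrow> (\<forall>x y. adj x y \<longleftrightarrow> (x, y) \<in> Q \<or> (y, x) \<in> Q) \<and> (\<forall>x y. (x, y) \<in> Q \<longrightarrow> (y, x) \<notin> Q)"

definition state :: "'v list \<Rightarrow> ('v \<times> 'v) set \<Rightarrow> ('v \<times> 'v) set" where
  "state xs Q = foldr reverse_at xs Q"

definition adm :: "('v \<times> 'v) set \<Rightarrow> 'v list \<Rightarrow> bool" where
  "adm Q xs \<longleftrightarrow> admissible_seq W Q (rev xs)"

abbreviation "sink \<equiv> is_sink W"
abbreviation "trace_cong \<equiv> monoid_cong V (commutations W)"

lemma orient_adj: "orient Q \<Longrightarrow> (x, y) \<in> Q \<Longrightarrow> adj x y"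
  by (auto simp: orient_def)

lemma orient_verts: "orient Q \<Longrightarrow> (x, y) \<in> Q \<Longrightarrow> x \<in> V \<and> y \<in> V \<and> x \<noteq> y"
  using orient_adj adj_verts by blast

lemma reverse_at_iff:
  "(a, b) \<in> reverse_at x Q \<longleftrightarrow> (if a = x \<or> b = x then (b, a) \<in> Q else (a, b) \<in> Q)"
  by (auto simp: reverse_at_def)

lemma orient_reverse: "orient Q \<Longrightarrow> orient (reverse_at x Q)"
  unfolding orient_def by (auto simp: reverse_at_iff)

lemma reverse_at_commute:
  "orient Q \<Longrightarrow> \<not> adj x y \<Longrightarrow> reverse_at x (reverse_at y Q) = reverse_at y (reverse_at x Q)"
  unfolding orient_def by (auto simp: reverse_at_iff split: if_splits)

lemma state_Nil [simp]: "state [] Q = Q" by (simp add: state_def)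
lemma state_Cons [simp]: "state (x # xs) Q = reverse_at x (state xs Q)" by (simp add: state_def)
lemma state_append [simp]: "state (xs @ ys) Q = state xs (state ys Q)" by (simp add: state_def)

lemma orient_state [simp]: "orient Q \<Longrightarrow> orient (state xs Q)"
  by (induction xs) (auto simp: orient_reverse)

lemma admissible_seq_append:
  "admissible_seq W Q (xs @ ys) \<longleftrightarrow> admissible_seq W Q xs \<and> admissible_seq W (state (rev xs) Q) ys"
  by (induction xs arbitrary: Q) auto

lemma adm_Nil [simp]: "adm Q []" by (simp add: adm_def)

lemma adm_append [simp]: "adm Q (xs @ ys) \<longleftrightarrow> adm Q ys \<and> adm (state ys Q) xs"
  by (simp add: adm_def admissible_seq_append)

lemma adm_Cons [simp]: "adm Q (x # xs) \<longleftrightarrow> adm Q xs \<and> sink (state xs Q) x"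
  by (simp add: adm_def admissible_seq_append)

lemma sink_verts: "sink Q x \<Longrightarrow> x \<in> V" by (simp add: is_sink_def)

lemma adm_verts: "adm Q xs \<Longrightarrow> set xs \<subseteq> V"
  by (induction xs) (auto dest: sink_verts)

lemma sink_reverse_nonadj:
  "orient Q \<Longrightarrow> x \<noteq> y \<Longrightarrow> \<not> adj x y \<Longrightarrow> sink (reverse_at y Q) x \<longleftrightarrow> sink Q x"
  unfolding is_sink_def orient_def by (auto simp: reverse_at_iff split: if_splits)

section \<open>Invariants of words under commutations\<close>

lemma trace_cong_verts: "trace_cong xs ys \<Longrightarrow> set xs \<subseteq> V" "trace_cong xs ys \<Longrightarrow> set ys \<subseteq> V"
  by (induction rule: monoid_cong.induct) auto

lemma trace_cong_refl: "set xs \<subseteq> V \<Longrightarrow> trace_cong xs xs"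
  by (rule monoid_cong.refl) auto

lemma trace_cong_count: "trace_cong xs ys \<Longrightarrow> count_list xs v = count_list ys v"
  by (induction rule: monoid_cong.induct) (auto simp: commutations_def)

lemma trace_cong_length: "trace_cong xs ys \<Longrightarrow> length xs = length ys"
  by (induction rule: monoid_cong.induct) (auto simp: commutations_def)

lemma trace_cong_set: "trace_cong xs ys \<Longrightarrow> set xs = set ys"
  by (induction rule: monoid_cong.induct) (auto simp: commutations_def)

lemma trace_cong_rho: "trace_cong xs ys \<Longrightarrow> rho xs = rho ys"
proof (induction rule: monoid_cong.induct)
  case (base xs ys)
  then obtain x y where "xs = [x, y]" "ys = [y, x]" "x \<in> V" "y \<in> V" "x \<noteq> y" "\<not> adj x y"
    by (auto simp: commutations_def)
  then show ?case using nonadj_commute[of x y] by (simp flip: m_assoc)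
next
  case (app xs xs' ys ys')
  then show ?case using trace_cong_verts[OF app(1)] trace_cong_verts[OF app(2)] by (simp add: val_append)
qed auto

lemma trace_cong_word_act: assumes "trace_cong xs ys" shows "word_act xs = word_act ys"
  unfolding word_act_def using trace_cong_verts[OF assms] trace_cong_rho[OF assms] by (intro act_cong) auto

lemma trace_cong_reduced_word: "trace_cong xs ys \<Longrightarrow> reduced_word xs \<longleftrightarrow> reduced_word ys"
  using trace_cong_rho trace_cong_length unfolding reduced_word_def by metis

lemma trace_cong_adm_state:
  "trace_cong xs ys \<Longrightarrow> orient Q \<Longrightarrow> (adm Q xs \<longleftrightarrow> adm Q ys) \<and> state xs Q = state ys Q"
proof (induction arbitrary: Q rule: monoid_cong.induct)
  case (base xs ys)
  then obtain x y where e: "xs = [x, y]" "ys = [y, x]" and xy: "x \<noteq> y" "\<not> adj x y" "\<not> adj y x"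
    by (auto simp: commutations_def adj_sym)
  show ?case
    using sink_reverse_nonadj[OF base(4), of x y] sink_reverse_nonadj[OF base(4), of y x]
      reverse_at_commute[OF base(4), of x y] xy by (auto simp: e)
next
  case (app xs xs' ys ys')
  then show ?case by simp
qed auto

lemmas trace_cong_adm = trace_cong_adm_state[THEN conjunct1]
lemmas trace_cong_state = trace_cong_adm_state[THEN conjunct2]

lemma trace_cong_move:
  assumes "x \<in> V" "set us \<subseteq> V" "\<forall>t\<in>set us. t \<noteq> x \<and> \<not> adj x t"
  shows "trace_cong (x # us) (us @ [x])"
  using assms(2,3)
proof (induction us)
  case Nil
  then show ?case using assms by (auto intro: trace_cong_refl)
next
  case (Cons u us)
  have "trace_cong [x, u] [u, x]"
    using Cons assms by (intro monoid_cong.base) (auto simp: commutations_def)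
  from monoid_cong.app[OF this trace_cong_refl[of us]] have "trace_cong (x # u # us) (u # x # us)" using Cons by simp
  moreover have "trace_cong (u # x # us) (u # us @ [x])"
    using monoid_cong.app[OF trace_cong_refl[of "[u]"] Cons.IH] Cons.prems by simp
  ultimately show ?case by (auto intro: monoid_cong.trans)
qed

text \<open>Adjacent vertices are never sinks together, and a sink remains one until it or a
  neighbour is fired. Hence no neighbour of \<open>x\<close> can be fired as long as
  \<open>x\<close> is not.\<close>

lemma sink_no_neighbours:
  assumes "orient Q" "sink Q x" "adm Q us" "x \<notin> set us"
  shows "(\<forall>t\<in>set us. t \<noteq> x \<and> \<not> adj x t) \<and> sink (state us Q) x"
  using assms(3,4)
proof (induction us)
  case (Cons u us)
  then have IH: "\<forall>t\<in>set us. t \<noteq> x \<and> \<not> adj x t" "sink (state us Q) x" by auto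
  have "sink (state us Q) u" using Cons.prems by simp
  then have "(u, x) \<notin> state us Q" "(x, u) \<notin> state us Q" using IH(2) by (auto simp: is_sink_def)
  then have "\<not> adj x u" using orient_state[OF assms(1), of us] unfolding orient_def by blast
  then show ?case using IH Cons.prems sink_reverse_nonadj[OF orient_state[OF assms(1)]] by auto
qed (use assms in auto)

lemma sink_before:
  assumes "orient Q" "\<forall>t\<in>set us. t \<noteq> x \<and> \<not> adj x t" "sink (state us Q) x"
  shows "sink Q x"
  using assms(2,3)
proof (induction us)
  case (Cons u us)
  then show ?case using sink_reverse_nonadj[OF orient_state[OF assms(1)], of x u us] by auto
qed auto

text \<open>The Euler form of the quiver. When \<open>orient Q\<close> holds, its symmetrization is
  \<open>form\<close>; the orientation only decides which argument is taken at which end of an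
  edge.\<close>

definition euler :: "('v \<times> 'v) set \<Rightarrow> ('w \<Rightarrow> real) \<Rightarrow> ('w \<Rightarrow> real) \<Rightarrow> real" where
  "euler Q a b = (\<Sum>x\<in>V. a (gen x) * b (gen x))
     + (\<Sum>x\<in>V. \<Sum>y\<in>V. if (y, x) \<in> Q then cox_form (gen y) (gen x) * a (gen y) * b (gen x) else 0)"

definition nbr :: "'v \<Rightarrow> ('w \<Rightarrow> real) \<Rightarrow> real" where
  "nbr x v = (\<Sum>y\<in>V - {x}. cox_form (gen x) (gen y) * v (gen y))"

text \<open>In the first sum the bound \<open>x\<close> hides the parameter in the summand only; the
  vertex removed from \<open>V\<close> is the parameter.\<close>

definition euler_rest :: "'v \<Rightarrow> ('v \<times> 'v) set \<Rightarrow> ('w \<Rightarrow> real) \<Rightarrow> ('w \<Rightarrow> real) \<Rightarrow> real" where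
  "euler_rest x Q a b = (\<Sum>x\<in>V - {x}. a (gen x) * b (gen x))
     + (\<Sum>z\<in>V - {x}. \<Sum>y\<in>V - {x}. if (y, z) \<in> Q then cox_form (gen y) (gen z) * a (gen y) * b (gen z) else 0)"

lemma root_form_nbr: assumes "x \<in> V" shows "root_form (gen x) v = 2 * v (gen x) + nbr x v"
proof -
  have "root_form (gen x) v = (\<Sum>y\<in>V. cox_form (gen x) (gen y) * v (gen y))"
    unfolding root_form_def by (rule sum.reindex_bij_betw[OF gen_bij, symmetric])
  also have "\<dots> = 2 * v (gen x) + nbr x v"
    unfolding nbr_def using assms by (subst sum.remove[of _ x]) auto
  finally show ?thesis .
qed

lemma refl_self_coord: "x \<in> V \<Longrightarrow> vreflect x v (gen x) = - v (gen x) - nbr x v"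
  by (simp add: reflect_eq root_form_nbr simple_root_def)

lemma nbr_refl: "x \<in> V \<Longrightarrow> nbr x (vreflect x v) = nbr x v"
  unfolding nbr_def by (intro sum.cong) (auto simp: refl_coord)

lemma euler_rest_refl: "x \<in> V \<Longrightarrow> euler_rest x (reverse_at x Q) (vreflect x a) (vreflect x b) = euler_rest x Q a b"
  unfolding euler_rest_def by (intro arg_cong2[of _ _ _ _ "(+)"] sum.cong) (auto simp: refl_coord reverse_at_iff)

lemma euler_split:
  assumes "x \<in> V" "(x, x) \<notin> Q"
  shows "euler Q a b = euler_rest x Q a b + a (gen x) * b (gen x)
    + (\<Sum>y\<in>V - {x}. if (y, x) \<in> Q then cox_form (gen y) (gen x) * a (gen y) * b (gen x) else 0)
    + (\<Sum>z\<in>V - {x}. if (x, z) \<in> Q then cox_form (gen x) (gen z) * a (gen x) * b (gen z) else 0)"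
proof -
  let ?f = "\<lambda>z y. if (y, z) \<in> Q then cox_form (gen y) (gen z) * a (gen y) * b (gen z) else 0"
  have "(\<Sum>z\<in>V. \<Sum>y\<in>V. ?f z y) = (\<Sum>y\<in>V. ?f x y) + (\<Sum>z\<in>V - {x}. \<Sum>y\<in>V. ?f z y)"
    using assms by (subst sum.remove[of _ x]) auto
  also have "(\<Sum>y\<in>V. ?f x y) = (\<Sum>y\<in>V - {x}. ?f x y)"
    using assms by (subst sum.remove[of _ x]) auto
  also have "(\<Sum>z\<in>V - {x}. \<Sum>y\<in>V. ?f z y) = (\<Sum>z\<in>V - {x}. ?f z x + (\<Sum>y\<in>V - {x}. ?f z y))"
    using assms by (intro sum.cong HOL.refl sum.remove) auto
  also have "(\<Sum>x\<in>V. a (gen x) * b (gen x)) = a (gen x) * b (gen x) + (\<Sum>x\<in>V - {x}. a (gen x) * b (gen x))"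
    using assms by (intro sum.remove) auto
  ultimately show ?thesis unfolding euler_def euler_rest_def
    by (simp add: sum.distrib sum.remove[of V x] assms)
qed

lemma euler_sink:
  assumes Q: "orient Q" and x: "sink Q x"
  shows "euler Q a b = euler_rest x Q a b + b (gen x) * (a (gen x) + nbr x a)"
proof -
  have xV: "x \<in> V" and n: "(x, y) \<notin> Q" for y using x by (auto simp: is_sink_def)
  have "(\<Sum>y\<in>V - {x}. if (y, x) \<in> Q then cox_form (gen y) (gen x) * a (gen y) * b (gen x) else 0)
      = b (gen x) * nbr x a"
    unfolding nbr_def sum_distrib_left
  proof (intro sum.cong HOL.refl)
    fix y assume y: "y \<in> V - {x}"
    show "(if (y, x) \<in> Q then cox_form (gen y) (gen x) * a (gen y) * b (gen x) else 0)
        = b (gen x) * (cox_form (gen x) (gen y) * a (gen y))"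
    proof (cases "(y, x) \<in> Q")
      case True
      then show ?thesis using y xV cox_form_sym by simp
    next
      case False
      then have "\<not> adj x y" using Q n unfolding orient_def by blast
      then show ?thesis using False nonadj_cox_form y xV by auto
    qed
  qed
  then show ?thesis using euler_split[OF xV n] n by (simp add: algebra_simps)
qed

lemma euler_source:
  assumes Q: "orient Q" and x: "x \<in> V" "\<And>y. (y, x) \<notin> Q"
  shows "euler Q a b = euler_rest x Q a b + a (gen x) * (b (gen x) + nbr x b)"
proof -
  have "(\<Sum>y\<in>V - {x}. if (x, y) \<in> Q then cox_form (gen x) (gen y) * a (gen x) * b (gen y) else 0)
      = a (gen x) * nbr x b"
    unfolding nbr_def sum_distrib_left
  proof (intro sum.cong HOL.refl)
    fix y assume y: "y \<in> V - {x}"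
    show "(if (x, y) \<in> Q then cox_form (gen x) (gen y) * a (gen x) * b (gen y) else 0)
        = a (gen x) * (cox_form (gen x) (gen y) * b (gen y))"
    proof (cases "(x, y) \<in> Q")
      case False
      then have "\<not> adj x y" using Q x unfolding orient_def by blast
      then show ?thesis using False nonadj_cox_form y x by auto
    qed simp
  qed
  then show ?thesis using euler_split[OF x(1) x(2)] x(2) by (simp add: algebra_simps)
qed

text \<open>The terms at \<open>x\<close> sum to \<open>b (gen x) * (a (gen x) + nbr x a)\<close> at
  a sink, and to the same with \<open>a\<close> and \<open>b\<close> exchanged at a source. The
  reflection keeps \<open>nbr x v\<close> and replaces \<open>v (gen x)\<close> by
  \<open>- v (gen x) - nbr x v\<close>, which turns one expression into the other.\<close>

lemma euler_refl:
  assumes "orient Q" "sink Q x" shows "euler (reverse_at x Q) (vreflect x a) (vreflect x b) = euler Q a b"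
proof -
  have x: "x \<in> V" using assms sink_verts by blast
  have s: "(y, x) \<notin> reverse_at x Q" for y using assms(2) by (auto simp: reverse_at_iff is_sink_def)
  show ?thesis
    unfolding euler_source[OF orient_reverse[OF assms(1)] x s] euler_sink[OF assms]
    using x by (simp add: euler_rest_refl nbr_refl refl_self_coord algebra_simps)
qed

lemma euler_adm: "orient Q \<Longrightarrow> adm Q xs \<Longrightarrow> euler (state xs Q) (word_act xs a) (word_act xs b) = euler Q a b"
  by (induction xs) (auto simp: euler_refl)

lemma euler_sink_simple:
  assumes Q: "orient Q" "sink Q x" shows "euler Q (sroot x) b = b (gen x)"
proof -
  have x: "x \<in> V" using Q sink_verts by blast
  have z: "sroot x (gen y) = 0" if "y \<in> V - {x}" for y using that x by (auto simp: simple_root_def)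
  have n: "(x, z) \<notin> Q" for z using Q by (auto simp: is_sink_def)
  have "nbr x (sroot x) = 0" unfolding nbr_def using z by simp
  moreover have "euler_rest x Q (sroot x) b = 0" unfolding euler_rest_def using z by (simp add: sum.neutral)
  ultimately show ?thesis using euler_sink[OF Q, of "sroot x" b] by (simp add: simple_root_def)
qed

lemma euler_uminus_left: "euler Q (\<lambda>t. - a t) b = - euler Q a b"
  unfolding euler_def by (simp add: sum_negf if_distrib[of uminus] flip: sum_negf cong: if_cong)

text \<open>Invariance of the Euler form along \<open>zs\<close>, read at both ends, where its left
  argument is up to sign the simple root of a sink.\<close>

lemma coord_transport:
  assumes Q: "orient Q" "sink Q x" "adm Q zs" "sink (state zs Q) y" "word_act zs (sroot x) = (\<lambda>t. - sroot y t)"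
  shows "word_act zs b (gen y) = - b (gen x)"
proof -
  have "b (gen x) = euler (state zs Q) (word_act zs (sroot x)) (word_act zs b)"
    using euler_adm[OF Q(1,3), of "sroot x" b] euler_sink_simple[OF Q(1,2)] by simp
  also have "\<dots> = - word_act zs b (gen y)"
    using Q by (simp add: euler_uminus_left euler_sink_simple)
  finally show ?thesis by simp
qed

end

section \<open>Cancellation in admissible words\<close>

context coxeter_group
begin

lemma pos_coord: "pos a \<Longrightarrow> y \<in> V \<Longrightarrow> a (gen y) \<ge> 0"
  by (simp add: positive_root_def)

lemma pos_other_coord:
  assumes "pos a" "a s = 0" shows "\<exists>t\<in>gens W. t \<noteq> s \<and> a t > 0"
proof -
  obtain t where "t \<in> gens W" "a t \<noteq> 0" using root_nonzero[OF pos_roots[OF assms(1)]] by blast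
  then show ?thesis using assms unfolding positive_root_def by (intro bexI[of _ t]) force+
qed

lemma root_no_defect:
  assumes "pos a" "a (gen y) = 0" "m > 0" "y \<in> V" "(\<lambda>t. - sroot y t + m * a t) \<in> roots W" shows False
proof -
  obtain t where t: "t \<in> gens W" "t \<noteq> gen y" "a t > 0" using pos_other_coord[OF assms(1,2)] by blast
  show False
    by (rule root_no_mixed_signs[OF assms(5), of "gen y" t])
      (use t assms in \<open>auto simp: simple_root_def\<close>)
qed

text \<open>If a letter fired before the cancelling letter \<open>x\<close> did not commute with it, the last such
  letter \<open>t\<close> would produce a root \<open>- \<alpha>\<^sub>y + m \<kappa>\<close>, where \<open>\<kappa>\<close> is a positive root whose coordinate at \<open>y\<close>
  vanishes by the Euler form; such a root would have coordinates of both signs.\<close>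

lemma cancelling_sink:
  assumes Q: "orient Q" and zs: "adm Q zs" "reduced_word zs" and y: "sink (state zs Q) y" "\<not> reduced_word (y # zs)"
  obtains x zs' where "sink Q x" "trace_cong zs (zs' @ [x])" "word_act zs' (sroot x) = sroot y"
proof -
  have zV: "set zs \<subseteq> V" using zs adm_verts by blast
  have yV: "y \<in> V" using y sink_verts by blast
  have "\<not> pos (word_act (rev zs) (sroot y))" using y(2) zs(2) reduced_word_Cons[OF yV zV] by simp
  then obtain us x vs where "rev zs = us @ x # vs" "word_act vs (sroot y) = sroot x"
    using sign_change[of "rev zs" "sroot y"] zV yV by auto
  then obtain zs2 zs0 where z: "zs = zs2 @ x # zs0" and e': "word_act (rev zs2) (sroot y) = sroot x"
    by (metis append.assoc append_Cons append_Nil rev.simps(2) rev_append rev_rev_ident)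
  have V2: "set zs2 \<subseteq> V" "x \<in> V" "set zs0 \<subseteq> V" using zV z by auto
  have e: "word_act zs2 (sroot x) = sroot y" using e' V2 by (metis word_act_rev_right)
  have Q0: "orient (state zs0 Q)" "sink (state zs0 Q) x" "adm (state zs0 Q) (zs2 @ [x])"
    using Q zs z by auto
  \<comment> \<open>\<open>zs2 @ [x]\<close> leads from an orientation with sink \<open>x\<close> to
    one with sink \<open>y\<close> and sends \<open>sroot x\<close> to the negative of
    \<open>sroot y\<close>.\<close>
  have ct: "word_act zs2 (vreflect x b) (gen y) = - b (gen x)" for b
    using coord_transport[OF Q0, of y b] y V2 e by (simp add: z word_act_neg)
  have free: "\<forall>t\<in>set zs0. t \<noteq> x \<and> \<not> adj x t"
  proof (rule ccontr)
    assume "\<not> ?thesis"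
    then have "\<exists>t\<in>set zs0. t = x \<or> adj x t" by blast
    from split_list_first_prop[OF this]
    obtain us t vs where zs0: "zs0 = us @ t # vs" and t: "t = x \<or> adj x t"
      and us: "\<forall>u\<in>set us. \<not> (u = x \<or> adj x u)" by blast
    have V3: "set us \<subseteq> V" "t \<in> V" "set vs \<subseteq> V" using V2 zs0 by auto
    have us': "word_act us (sroot x) = sroot x" using word_act_sroot_nonadj[of us x] us V3 V2 by simp
    show False
    proof (cases "t = x")
      \<comment> \<open>All letters between the two occurrences of \<open>x\<close> commute with
        \<open>x\<close>, so the word would not be reduced.\<close>
      case True
      have "reduced_word ((x # us) @ x # vs)"
        using reduced_word_append(2)[of zs2 "x # us @ x # vs"] zs zV z zs0 True by simp
      then have "pos (word_act (x # us) (sroot x))" using reduced_word_pos_image[of "x # us" x vs] V3 V2 by auto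
      then show False using us' V2 pos_uminus[of "sroot x"] by simp
    next
      case False
      then have t: "adj x t" "t \<noteq> x" using t by auto
      \<comment> \<open>This is \<kappa>. By \<open>ct\<close>, its coordinate at \<open>y\<close>
        is up to sign the coordinate of \<open>word_act us (sroot t)\<close> at \<open>x\<close>,
        and neither \<open>us\<close> nor \<open>t\<close> involves \<open>x\<close>.\<close>
      define k where "k = word_act (zs2 @ x # us) (sroot t)"
      have kp: "pos k" unfolding k_def
        using reduced_word_pos_image[of "zs2 @ x # us" t vs] zs zV by (simp add: z zs0)
      have "k (gen y) = - word_act us (sroot t) (gen x)" unfolding k_def by (simp add: ct)
      also have "\<dots> = 0" using word_act_coord[of us x "sroot t"] V3 V2 us t by (auto simp: simple_root_def)
      finally have k0: "k (gen y) = 0" .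
      define m where "m = - cox_form (gen t) (gen x)"
      have m: "m > 0" using adj_cox_form[of t x] t adj_sym by (auto simp: m_def)
      have "word_act (zs2 @ x # us) (vreflect t (sroot x)) = (\<lambda>r. 1 * word_act (zs2 @ x # us) (sroot x) r + m * k r)"
        unfolding k_def refl_sroot[OF V3(2) V2(2)] m_def using V2 V3 by (intro word_act_lin) auto
      also have "word_act (zs2 @ x # us) (sroot x) = (\<lambda>r. - sroot y r)" using us' V2 e by (simp add: word_act_neg)
      finally have "(\<lambda>r. - sroot y r + m * k r) = word_act (zs2 @ x # us) (vreflect t (sroot x))" by simp
      also have "\<dots> \<in> roots W" using V2 V3 by simp
      finally show False using root_no_defect[OF kp k0 m yV] by blast
    qed
  qed
  have "sink Q x" using sink_before[OF Q free Q0(2)] .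
  moreover have "trace_cong zs ((zs2 @ zs0) @ [x])"
    unfolding z using monoid_cong.app[OF trace_cong_refl[OF V2(1)] trace_cong_move[OF V2(2,3) free]] by simp
  moreover have "word_act (zs2 @ zs0) (sroot x) = sroot y" using word_act_sroot_nonadj[OF V2(3,2) free] e by simp
  ultimately show thesis by (rule that)
qed

text \<open>Let \<open>b\<close> be the root that \<open>y # zs\<close> sends to
  \<open>sroot t\<close>. Since \<open>zs @ [x]\<close> acts as \<open>y # zs\<close>,
  \<open>coord_transport\<close> makes the coordinate of \<open>b\<close> at \<open>x\<close>
  vanish. Pulling back the reflection of \<open>sroot y\<close> in \<open>t\<close> then yields a
  root with coordinates of both signs.\<close>

lemma no_adjacent_continuation:
  assumes Q: "orient Q" "sink Q x" "adm Q (zs @ [x])" "sink (state (zs @ [x]) Q) y"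
    and e: "word_act zs (sroot x) = sroot y" and t: "adj y t" and red: "reduced_word (t # y # zs)"
  shows False
proof -
  have V': "x \<in> V" "y \<in> V" "t \<in> V" "set zs \<subseteq> V"
    using Q sink_verts adm_verts[OF Q(3)] adj_verts[OF t] by auto
  define b where "b = word_act (rev (y # zs)) (sroot t)"
  have bp: "pos b" using red V' reduced_word_Cons[of t "y # zs"] by (simp add: b_def)
  have "word_act (zs @ [x]) b = word_act (y # zs) b" using word_act_conj[OF V'(4,1,2) e] by simp
  also have "\<dots> = sroot t" unfolding b_def using V' by (intro word_act_rev_right) auto
  finally have b2: "word_act (zs @ [x]) b = sroot t" .
  have "word_act (zs @ [x]) b (gen y) = - b (gen x)"
    using coord_transport[OF Q, of b] V' e by (simp add: word_act_neg)
  moreover have "sroot t (gen y) = 0" using V' adj_verts(3)[OF t] by (auto simp: simple_root_def)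
  ultimately have b0: "b (gen x) = 0" using b2 by simp
  define m where "m = - cox_form (gen t) (gen y)"
  have m: "m > 0" using adj_cox_form[of t y] t adj_sym by (auto simp: m_def)
  have ex: "word_act (rev zs) (sroot y) = sroot x" using e V' by (metis word_act_rev)
  have "word_act (rev (y # zs)) (vreflect t (sroot y)) = (\<lambda>r. 1 * word_act (rev (y # zs)) (sroot y) r + m * b r)"
    unfolding b_def refl_sroot[OF V'(3,2)] m_def using V' by (intro word_act_lin) auto
  also have "word_act (rev (y # zs)) (sroot y) = (\<lambda>r. - sroot x r)" using V' ex by (simp add: word_act_neg)
  finally have "(\<lambda>r. - sroot x r + m * b r) = word_act (rev (y # zs)) (vreflect t (sroot y))" by simp
  also have "\<dots> \<in> roots W" using V' by simp
  finally show False using root_no_defect[OF bp b0 m V'(1)] by blast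
qed

text \<open>When firing \<open>y\<close> cancels the first letter \<open>x\<close> of the reduced part, that letter is moved into \<open>Q\<close>
  and \<open>a\<close>, and \<open>y\<close> takes its place in the reduced part; the previous lemma preserves maximality.\<close>

lemma pos_beyond_maximal_reduced:
  assumes "orient Q" "adm Q (ys @ zs)" "reduced_word zs" "pos a" "pos (word_act zs a)"
    and "\<And>t. t \<in> set ys \<Longrightarrow> sink (state zs Q) t \<Longrightarrow> \<not> reduced_word (t # zs)"
  shows "pos (word_act (ys @ zs) a)"
  using assms
proof (induction ys arbitrary: Q zs a rule: rev_induct)
  case (snoc y ys)
  note Q = snoc.prems(1) and red = snoc.prems(3) and a = snoc.prems(4) and za = snoc.prems(5)
    and max = snoc.prems(6)
  have adm: "adm Q zs" "sink (state zs Q) y" "adm (state zs Q) (ys @ [y])" using snoc.prems(2) by auto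
  have zV: "set zs \<subseteq> V" using adm adm_verts by blast
  have "\<not> reduced_word (y # zs)" using max[of y] adm by simp
  from cancelling_sink[OF Q adm(1) red adm(2) this]
  obtain x zs' where x: "sink Q x" and zc: "trace_cong zs (zs' @ [x])" and e: "word_act zs' (sroot x) = sroot y" .
  have V': "x \<in> V" "y \<in> V" "set zs' \<subseteq> V" "set ys \<subseteq> V"
    using x adm sink_verts trace_cong_verts[OF zc] adm_verts[OF adm(3)] by auto
  define Q' where "Q' = reverse_at x Q"
  have Q': "orient Q'" using Q by (simp add: Q'_def orient_reverse)
  have admz: "adm Q (zs' @ [x])" using adm(1) trace_cong_adm[OF zc Q] by blast
  have st: "state zs Q = state zs' Q'" using trace_cong_state[OF zc Q] by (simp add: Q'_def)
  have word_act_z: "word_act zs = word_act (zs' @ [x])" using zc by (rule trace_cong_word_act)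
  have word_act_zx: "word_act (zs' @ [x]) v = word_act (y # zs') v" for v using word_act_conj[OF V'(3,1,2) e] by simp
  have redz: "reduced_word (zs' @ [x])" using red trace_cong_reduced_word[OF zc] by blast
  then have red': "reduced_word (y # zs')"
    using reduced_word_append(1)[of zs' "[x]"] V' reduced_word_Cons[of y zs'] e word_act_rev[of zs' "sroot x"] by simp
  have adm': "adm Q' (ys @ (y # zs'))" using adm(2,3) admz by (simp add: st Q'_def)
  \<comment> \<open>The exchange must not change a sign itself. The only dangerous values are
    \<open>a = sroot x\<close> and \<open>word_act zs a = sroot y\<close>; both conflict with the
    positivity of \<open>a\<close> and its image, because \<open>zs\<close> sends
    \<open>sroot x\<close> to the negative of \<open>sroot y\<close>.\<close>
  have "a \<noteq> sroot x"
  proof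
    assume "a = sroot x"
    then have "word_act zs a = (\<lambda>t. - sroot y t)" using V' e by (simp add: word_act_z word_act_neg)
    then show False using za pos_uminus[of "sroot y"] V' by simp
  qed
  then have a': "pos (vreflect x a)" using pos_refl_neg[of x a] V' a by blast
  have "word_act zs a \<noteq> sroot y"
  proof
    assume "word_act zs a = sroot y"
    moreover have "word_act zs (sroot x) = (\<lambda>t. - sroot y t)" using V' e by (simp add: word_act_z word_act_neg)
    ultimately have "word_act zs a = word_act zs (\<lambda>t. - sroot x t)" using zV by (simp add: word_act_neg)
    then have "a = (\<lambda>t. - sroot x t)" using zV by (simp add: word_act_inject)
    then show False using a pos_uminus[of "sroot x"] V' by simp
  qed
  then have za': "pos (word_act (y # zs') (vreflect x a))" using pos_refl_neg[of y "word_act zs a"] V' za by (auto simp: word_act_z)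
  \<comment> \<open>A sink \<open>t\<close> not adjacent to \<open>y\<close> was a sink before
    \<open>y\<close> was fired. As \<open>zs\<close> and \<open>y # zs'\<close> act alike,
    prolonging either by \<open>t\<close> obeys the same positivity condition.\<close>
  have max': "\<not> reduced_word (t # y # zs')" if t: "t \<in> set ys" "sink (state (y # zs') Q') t" for t
  proof
    assume r: "reduced_word (t # y # zs')"
    have tV: "t \<in> V" using t V' by auto
    have "\<not> adj y t"
      using no_adjacent_continuation[OF Q x admz _ e _ r] adm(2) trace_cong_state[OF zc Q] by auto
    moreover have "t \<noteq> y"
    proof
      assume "t = y"
      then have "reduced_word ([y] @ y # zs')" using r by simp
      then have "pos (word_act [y] (sroot y))" by (rule reduced_word_pos_image) (use V' in auto)
      then show False using V' pos_uminus[of "sroot y"] by simp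
    qed
    ultimately have "sink (state zs Q) t"
      using t(2) sink_reverse_nonadj[OF orient_state[OF Q'], of t y zs'] adj_sym by (auto simp: st)
    then have n: "\<not> reduced_word (t # zs)" using max[of t] t by simp
    have "word_act zs (word_act (rev (y # zs')) (sroot t)) = word_act (y # zs') (word_act (rev (y # zs')) (sroot t))"
      unfolding word_act_z by (rule word_act_zx)
    also have "\<dots> = sroot t" using V' by (intro word_act_rev_right) auto
    finally have "word_act (rev zs) (sroot t) = word_act (rev (y # zs')) (sroot t)" using zV by (metis word_act_rev)
    moreover have "pos (word_act (rev (y # zs')) (sroot t))" using r reduced_word_Cons[of t "y # zs'"] tV V' by simp
    ultimately have "reduced_word (t # zs)" using red reduced_word_Cons[of t zs] tV zV by simp
    then show False using n by simp
  qed
  have "pos (word_act (ys @ y # zs') (vreflect x a))"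
    by (rule snoc.IH[OF Q' adm' red' a' za']) (use max' in blast)
  then show ?case by (simp add: word_act_z)
qed simp

text \<open>A letter that can be fired at once without loss of reducedness commutes past the letters
  of \<open>us\<close> fired before it and moves into the reduced part, which shortens
  \<open>us\<close>. All letters of \<open>us\<close> are tested, not just the next one, since
  \<open>pos_beyond_maximal_reduced\<close> needs this form of maximality.\<close>

lemma maximal_reduced_suffix:
  assumes Q: "orient Q" and "adm Q ys" "adm (state ys Q) us" "reduced_word ys"
  shows "\<exists>us' zs. trace_cong (us @ ys) (us' @ zs) \<and> reduced_word zs \<and>
    (\<forall>t\<in>set us'. sink (state zs Q) t \<longrightarrow> \<not> reduced_word (t # zs))"
  using assms(2-)
proof (induction "length us" arbitrary: us ys rule: less_induct)
  case less
  have V': "set us \<subseteq> V" "set ys \<subseteq> V" using less adm_verts by blast+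
  show ?case
  proof (cases "\<forall>t\<in>set us. sink (state ys Q) t \<longrightarrow> \<not> reduced_word (t # ys)")
    case True
    moreover have "trace_cong (us @ ys) (us @ ys)" using V' by (intro trace_cong_refl) auto
    ultimately show ?thesis using less(4) by blast
  next
    case False
    then obtain t where t: "t \<in> set us" "sink (state ys Q) t" "reduced_word (t # ys)" by blast
    obtain us1 us2 where us: "us = us1 @ t # us2" "t \<notin> set us2"
      using split_list_last[OF t(1)] by blast
    have "\<forall>u\<in>set us2. u \<noteq> t \<and> \<not> adj t u"
      using sink_no_neighbours[OF orient_state[OF Q] t(2), of us2] less(3) us by auto
    then have "trace_cong (t # us2) (us2 @ [t])" using V' us t by (intro trace_cong_move) auto
    then have c: "trace_cong us ((us1 @ us2) @ [t])"
      unfolding us using monoid_cong.app[OF trace_cong_refl[of us1]] V' us by simp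
    have "adm (state ys Q) ((us1 @ us2) @ [t])" using less(3) trace_cong_adm[OF c] Q by auto
    then have "\<exists>us' zs. trace_cong ((us1 @ us2) @ t # ys) (us' @ zs) \<and> reduced_word zs \<and>
      (\<forall>t\<in>set us'. sink (state zs Q) t \<longrightarrow> \<not> reduced_word (t # zs))"
      using less(2,3) t us by (intro less(1)) auto
    then show ?thesis
      using monoid_cong.app[OF c trace_cong_refl[OF V'(2)]] by (auto intro: monoid_cong.trans)
  qed
qed

lemma inverted_by_reduced_suffix:
  assumes Q: "orient Q" and ys: "adm Q ys" and a: "pos a" "\<not> pos (word_act ys a)"
  shows "\<exists>us zs. trace_cong ys (us @ zs) \<and> reduced_word zs \<and> \<not> pos (word_act zs a)"
proof -
  obtain us zs where c: "trace_cong ys (us @ zs)" "reduced_word zs"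
    and max: "\<forall>t\<in>set us. sink (state zs Q) t \<longrightarrow> \<not> reduced_word (t # zs)"
    using maximal_reduced_suffix[OF Q, of "[]" ys] ys by auto
  have "adm Q (us @ zs)" using ys trace_cong_adm[OF c(1) Q] by blast
  then have "\<not> pos (word_act zs a)"
    using pos_beyond_maximal_reduced[OF Q, of us zs a] c max a trace_cong_word_act[OF c(1)] by auto
  then show ?thesis using c by blast
qed

text \<open>The letter \<open>x\<close> fired first in \<open>xs\<close> is a sink and occurs in
  \<open>ys\<close>, where its first firing commutes to the start. What remains is compared for the
  orientation reversed at \<open>x\<close>. This turns \<preceq> into the pointwise order of
  counts.\<close>

lemma adm_count_le_extension:
  assumes "orient Q" "adm Q xs" "adm Q ys" "\<And>v. count_list xs v \<le> count_list ys v"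
  shows "\<exists>us. trace_cong ys (us @ xs)"
  using assms
proof (induction xs arbitrary: Q ys rule: rev_induct)
  case Nil
  then show ?case using adm_verts[of Q ys] by (auto intro: trace_cong_refl)
next
  case (snoc x xs)
  note Q = snoc.prems(1)
  have x: "sink Q x" using snoc.prems by simp
  have yV: "set ys \<subseteq> V" using snoc.prems adm_verts by blast
  have "count_list ys x > 0" using snoc.prems(4)[of x] by simp
  then have "x \<in> set ys" using count_notin by fastforce
  then obtain us vs where ys: "ys = us @ x # vs" "x \<notin> set vs" using split_list_last by metis
  have "\<forall>u\<in>set vs. u \<noteq> x \<and> \<not> adj x u"
    using sink_no_neighbours[OF Q x, of vs] snoc.prems(3) ys by auto
  then have "trace_cong (x # vs) (vs @ [x])" using yV ys by (intro trace_cong_move) auto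
  then have c: "trace_cong ys ((us @ vs) @ [x])"
    unfolding ys using monoid_cong.app[OF trace_cong_refl[of us]] yV ys by simp
  have a: "adm (reverse_at x Q) (us @ vs)" using snoc.prems(3) trace_cong_adm[OF c Q] by simp
  have "count_list xs v \<le> count_list (us @ vs) v" for v
    using snoc.prems(4)[of v] trace_cong_count[OF c, of v] by (simp split: if_splits)
  then obtain ws where "trace_cong (us @ vs) (ws @ xs)"
    using snoc.IH[of "reverse_at x Q" "us @ vs"] Q a snoc.prems(2) orient_reverse by auto
  then have "trace_cong ((us @ vs) @ [x]) ((ws @ xs) @ [x])"
    using monoid_cong.app trace_cong_refl[of "[x]"] x sink_verts by (metis empty_set empty_subsetI insert_subset list.simps(15))
  then show ?case using c by (auto intro: monoid_cong.trans)
qed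

lemma adm_count_eq_trace_cong:
  assumes "orient Q" "adm Q xs" "adm Q ys" "\<And>v. count_list xs v = count_list ys v"
  shows "trace_cong ys xs"
proof -
  obtain us where c: "trace_cong ys (us @ xs)" using adm_count_le_extension[OF assms(1-3)] assms(4) by auto
  have "count_list us v = 0" for v using trace_cong_count[OF c, of v] assms(4)[of v] by simp
  then have "us = []" by (cases us) (auto, metis add_eq_0_iff_both_eq_0 count_list.simps(2) nat_1_eq_mult_iff one_neq_zero)
  then show ?thesis using c by simp
qed

end

section \<open>Multiplicity vectors\<close>

locale coxeter_element_group = coxeter_group W for W :: "('w, 'v) coxeter_data" (structure) +
  fixes c :: 'w
  assumes coxeter_elem: "coxeter_element W c"
begin

abbreviation "Q \<equiv> c_quiver W c"

lemma ex_coxeter_word: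
  "\<exists>ss. distinct ss \<and> set ss = gens W \<and>
     Q = {(x, y). adj x y \<and> (\<exists>us vs ws. ss = us @ [gen x] @ vs @ [gen y] @ ws)}"
proof -
  define ss where "ss = (SOME ss. is_coxeter_word W c ss)"
  have "is_coxeter_word W c ss"
    unfolding ss_def using coxeter_elem by (auto simp: coxeter_element_def intro: someI_ex)
  moreover have "Q = {(x, y). adj x y \<and> (\<exists>us vs ws. ss = us @ [gen x] @ vs @ [gen y] @ ws)}"
    unfolding c_quiver_def ss_def Let_def ..
  ultimately show ?thesis unfolding is_coxeter_word_def by blast
qed

text \<open>The length of the \<open>takeWhile\<close> prefix is the position of a generator in the
  Coxeter word, which serves as a potential for the quiver.\<close>

lemma split_before:
  assumes "distinct ss" "ss = us @ [a] @ vs @ [b] @ ws"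
  shows "length (takeWhile (\<lambda>s. s \<noteq> a) ss) < length (takeWhile (\<lambda>s. s \<noteq> b) ss)"
proof -
  have "takeWhile (\<lambda>s. s \<noteq> a) ss = us"
    using assms by (auto simp: takeWhile_append)
  moreover have "takeWhile (\<lambda>s. s \<noteq> b) ss = us @ [a] @ vs"
    using assms by (auto simp: takeWhile_append)
  ultimately show ?thesis by simp
qed

lemma split_two:
  assumes "a \<in> set ss" "b \<in> set ss" "a \<noteq> b"
  shows "(\<exists>us vs ws. ss = us @ [a] @ vs @ [b] @ ws) \<or> (\<exists>us vs ws. ss = us @ [b] @ vs @ [a] @ ws)"
proof -
  obtain us rs where ss: "ss = us @ a # rs" using split_list assms(1) by metis
  have "b \<in> set us \<or> b \<in> set rs" using assms ss by auto
  then show ?thesis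
  proof
    assume "b \<in> set us"
    then obtain p q where "us = p @ b # q" using split_list by metis
    then have "ss = p @ [b] @ q @ [a] @ rs" using ss by simp
    then show ?thesis by blast
  next
    assume "b \<in> set rs"
    then obtain p q where "rs = p @ b # q" using split_list by metis
    then have "ss = us @ [a] @ p @ [b] @ q" using ss by simp
    then show ?thesis by blast
  qed
qed

lemma orient_c: "orient Q"
proof -
  obtain ss where ss: "distinct ss" "set ss = gens W"
    "Q = {(x, y). adj x y \<and> (\<exists>us vs ws. ss = us @ [gen x] @ vs @ [gen y] @ ws)}"
    using ex_coxeter_word by blast
  have "(x, y) \<in> Q \<or> (y, x) \<in> Q" if "adj x y" for x y
    using split_two[of "gen x" ss "gen y"] adj_verts[OF that] that adj_sym ss by auto
  moreover have "length (takeWhile (\<lambda>s. s \<noteq> gen x) ss) < length (takeWhile (\<lambda>s. s \<noteq> gen y) ss)"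
    if "(x, y) \<in> Q" for x y
    using that split_before[OF ss(1)] unfolding ss(3) by blast
  then have "(y, x) \<notin> Q" if "(x, y) \<in> Q" for x y
    using that by (meson less_asym)
  moreover have "adj x y" if "(x, y) \<in> Q" for x y using that ss by auto
  ultimately show ?thesis unfolding orient_def using adj_sym by blast
qed

text \<open>Arrows lead to later positions of the Coxeter word. A minimal element of a set is
  therefore a vertex entered by no arrow from the set.\<close>

lemma wf_c: "wf Q"
proof -
  obtain ss where ss: "distinct ss" "set ss = gens W"
    "Q = {(x, y). adj x y \<and> (\<exists>us vs ws. ss = us @ [gen x] @ vs @ [gen y] @ ws)}"
    using ex_coxeter_word by blast
  have "Q \<subseteq> measure (\<lambda>x. length (takeWhile (\<lambda>s. s \<noteq> gen x) ss))"
    using split_before[OF ss(1)] by (auto simp: ss(3))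
  then show ?thesis using wf_subset wf_measure by blast
qed

lemma Q_verts: "(x, y) \<in> Q \<Longrightarrow> x \<in> V" "(x, y) \<in> Q \<Longrightarrow> y \<in> V" "(x, y) \<in> Q \<Longrightarrow> x \<noteq> y"
  using orient_verts[OF orient_c] by auto

text \<open>Along an arrow \<open>y \<rightarrow> z\<close> the firings of \<open>z\<close> and \<open>y\<close> alternate, beginning with \<open>z\<close>.\<close>

definition valid :: "('v \<Rightarrow> nat) \<Rightarrow> bool" where
  "valid n \<longleftrightarrow> (\<forall>v. v \<notin> V \<longrightarrow> n v = 0) \<and> (\<forall>(y, z)\<in>Q. n y \<le> n z \<and> n z \<le> Suc (n y))"

lemma valid_arrow: "valid n \<Longrightarrow> (y, z) \<in> Q \<Longrightarrow> n y \<le> n z \<and> n z \<le> Suc (n y)"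
  unfolding valid_def by blast

lemma state_count:
  assumes "adm Q xs" "(y, z) \<in> Q"
  shows "count_list xs z = count_list xs y \<and> (y, z) \<in> state xs Q \<or>
    count_list xs z = Suc (count_list xs y) \<and> (z, y) \<in> state xs Q"
  using assms(1)
proof (induction xs)
  case (Cons x xs)
  then have "sink (state xs Q) x" by simp
  then show ?case
    using Cons Q_verts[OF assms(2)] by (auto simp: reverse_at_iff is_sink_def)
qed (use assms in auto)

lemma adm_valid: assumes "adm Q xs" shows "valid (count_list xs)"
proof -
  have "count_list xs v = 0" if "v \<notin> V" for v
    using adm_verts[OF assms] that by (auto intro: count_notin)
  then show ?thesis unfolding valid_def using state_count[OF assms] by fastforce
qed

text \<open>If an arrow left \<open>x\<close>, firing \<open>x\<close> would push the counts at its
  ends out of the permitted range.\<close>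

lemma valid_sink:
  assumes "adm Q xs" "x \<in> V" "valid (count_list (x # xs))"
  shows "sink (state xs Q) x"
proof -
  have "(x, y) \<notin> state xs Q" for y
  proof
    assume a: "(x, y) \<in> state xs Q"
    have o: "orient (state xs Q)" using orient_c by simp
    then have "adj x y" "(y, x) \<notin> state xs Q" using a unfolding orient_def by blast+
    then have "(x, y) \<in> Q \<or> (y, x) \<in> Q" "x \<noteq> y" using orient_c adj_verts unfolding orient_def by blast+
    then show False
      using state_count[OF assms(1), of x y] state_count[OF assms(1), of y x] \<open>(y, x) \<notin> state xs Q\<close>
        valid_arrow[OF assms(3), of x y] valid_arrow[OF assms(3), of y x] by auto
  qed
  then show ?thesis using assms by (simp add: is_sink_def)
qed

text \<open>To remove a letter from a count vector \<open>n\<close> above the vector of \<open>xs\<close>, take among the letters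
  where the two differ one with maximal \<open>n\<close>-value that is minimal for the arrows.\<close>

lemma extend_to_valid:
  assumes "valid n" "adm Q xs" "count_list xs \<le> n"
  shows "\<exists>us. adm Q (us @ xs) \<and> count_list (us @ xs) = n"
  using assms
proof (induction "\<Sum>v\<in>V. n v - count_list xs v" arbitrary: n rule: less_induct)
  case less
  let ?k = "count_list xs"
  have k: "valid ?k" using adm_valid less by blast
  define D where "D = {v. ?k v < n v}"
  have DV: "D \<subseteq> V" using less(2) unfolding D_def valid_def by force
  show ?case
  proof (cases "D = {}")
    case True
    then have "?k = n" using less(4) unfolding D_def by (auto simp: fun_eq_iff le_fun_def intro: antisym leI)
    then show ?thesis using less by (intro exI[of _ "[]"]) auto
  next
    case False
    have fin: "finite D" using finite_subset[OF DV] by simp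
    define M where "M = Max (n ` D)"
    have M: "\<And>v. v \<in> D \<Longrightarrow> n v \<le> M" using fin by (simp add: M_def)
    have "M \<in> n ` D" unfolding M_def using fin False by (intro Max_in) auto
    then obtain v where "v \<in> D \<inter> n -` {M}" by blast
    from wf_c[unfolded wf_eq_minimal, rule_format, OF this]
    obtain x where "x \<in> D \<inter> n -` {M}" "\<forall>y. (y, x) \<in> Q \<longrightarrow> y \<notin> D \<inter> n -` {M}" ..
    then have x: "x \<in> D" "n x = M" and min: "\<And>y. (y, x) \<in> Q \<Longrightarrow> \<not> (y \<in> D \<and> n y = M)"
      by blast+
    have xV: "x \<in> V" using x DV by blast
    have kx: "?k x < n x" using x by (simp add: D_def)
    define n' where "n' = n(x := n x - 1)"
    have n_eq: "n v = (if v = x then Suc (n' v) else n' v)" for v using kx by (auto simp: n'_def)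
    \<comment> \<open>Lowering \<open>n x\<close> by one needs a strict inequality along arrows into
      \<open>x\<close>, but only \<open>n z \<le> n x\<close> along arrows out of
      \<open>x\<close>.\<close>
    have in_arrow: "n y < n x" if "(y, x) \<in> Q" for y
    proof (cases "y \<in> D")
      case True
      then have "n y \<le> n x" "n y \<noteq> n x" using M[OF True] x(2) min[OF that] by auto
      then show ?thesis by simp
    next
      case False
      then have "n y \<le> ?k y" by (simp add: D_def)
      then show ?thesis using valid_arrow[OF k that] kx by linarith
    qed
    have out_arrow: "n z \<le> n x" if "(x, z) \<in> Q" for z
    proof (cases "z \<in> D")
      case True
      then show ?thesis using M[OF True] x(2) by simp
    next
      case False
      then have "n z \<le> ?k z" by (simp add: D_def)
      then show ?thesis using valid_arrow[OF k that] kx by linarith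
    qed
    have "valid n'"
      unfolding valid_def
    proof (intro conjI allI impI ballI, goal_cases)
      case (1 v)
      then have "n v = 0" "v \<noteq> x" using less(2) xV unfolding valid_def by blast+
      then show ?case by (simp add: n'_def)
    next
      case (2 p)
      obtain y z where p: "p = (y, z)" by force
      have "y \<noteq> z" "n y \<le> n z" "n z \<le> Suc (n y)" using 2 p Q_verts valid_arrow[OF less(2)] by auto
      then show ?case using 2 p in_arrow[of y] out_arrow[of z] kx by (auto simp: n'_def)
    qed
    moreover have "?k \<le> n'" using less(4) kx unfolding n'_def le_fun_def by simp
    moreover have "(\<Sum>v\<in>V. n' v - ?k v) < (\<Sum>v\<in>V. n v - ?k v)"
      using xV kx by (intro sum_strict_mono_ex1) (auto simp: n'_def)
    ultimately obtain us where us: "adm Q (us @ xs)" "count_list (us @ xs) = n'"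
      using less(1)[of n'] less(3) by blast
    have "count_list (x # us @ xs) = n" using us(2) n_eq by (auto simp: fun_eq_iff)
    moreover from this have "adm Q (x # us @ xs)"
      using valid_sink[OF us(1) xV] us(1) less(2) by simp
    ultimately show ?thesis by (intro exI[of _ "x # us"]) simp
  qed
qed

text \<open>Admissible words with equal counts are congruent, so the choice does not affect any
  notion invariant under commutations.\<close>

definition vec_word :: "('v \<Rightarrow> nat) \<Rightarrow> 'v list" where
  "vec_word n = (SOME xs. adm Q xs \<and> count_list xs = n)"

lemma vec_word:
  assumes "valid n" shows adm_vec_word: "adm Q (vec_word n)" and count_vec_word: "count_list (vec_word n) = n"
proof -
  have "\<exists>us. adm Q (us @ []) \<and> count_list (us @ []) = n"
    using assms by (intro extend_to_valid) (auto simp: le_fun_def)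
  then have "\<exists>xs. adm Q xs \<and> count_list xs = n" by auto
  from someI_ex[OF this] show "adm Q (vec_word n)" "count_list (vec_word n) = n" by (auto simp: vec_word_def)
qed

lemma vec_word_verts: "valid n \<Longrightarrow> set (vec_word n) \<subseteq> V"
  using adm_vec_word adm_verts by blast

lemma adm_trace_cong_vec_word: "adm Q xs \<Longrightarrow> trace_cong xs (vec_word (count_list xs))"
  using adm_count_eq_trace_cong[OF orient_c, of "vec_word (count_list xs)" xs] adm_valid vec_word by simp

lemma vec_word_extension: "valid n \<Longrightarrow> adm Q xs \<Longrightarrow> count_list xs \<le> n \<Longrightarrow> \<exists>us. trace_cong (vec_word n) (us @ xs)"
  using adm_count_le_extension[OF orient_c, of xs "vec_word n"] vec_word by (simp add: le_fun_def)

lemma vec_word_extension_vec_word: "valid m \<Longrightarrow> valid n \<Longrightarrow> m \<le> n \<Longrightarrow> \<exists>us. trace_cong (vec_word n) (us @ vec_word m)"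
  by (rule vec_word_extension) (simp_all add: vec_word)

lemma valid_inf: "valid m \<Longrightarrow> valid n \<Longrightarrow> valid (inf m n)"
  unfolding valid_def by (fastforce simp: inf_nat_def min_def)

lemma valid_sup: "valid m \<Longrightarrow> valid n \<Longrightarrow> valid (sup m n)"
  unfolding valid_def by (fastforce simp: sup_nat_def max_def)

lemma valid_0 [simp]: "valid (\<lambda>_. 0)"
  by (auto simp: valid_def)

section \<open>Least vectors inverting a root\<close>

definition inverts :: "('v \<Rightarrow> nat) \<Rightarrow> ('w \<Rightarrow> real) \<Rightarrow> bool" where
  "inverts n a \<longleftrightarrow> \<not> pos (word_act (vec_word n) a)"

abbreviation "reduced_vec n \<equiv> reduced_word (vec_word n)"

lemma inverts_adm: "adm Q xs \<Longrightarrow> inverts (count_list xs) a \<longleftrightarrow> \<not> pos (word_act xs a)"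
  using trace_cong_word_act[OF adm_trace_cong_vec_word[of xs]] by (simp add: inverts_def)

lemma reduced_vec_adm: "adm Q xs \<Longrightarrow> reduced_vec (count_list xs) \<longleftrightarrow> reduced_word xs"
  using trace_cong_reduced_word[OF adm_trace_cong_vec_word[of xs]] by simp

lemma reduced_vec_mono: assumes "valid m" "valid n" "m \<le> n" "reduced_vec n" shows "reduced_vec m"
proof -
  obtain us where us: "trace_cong (vec_word n) (us @ vec_word m)"
    using vec_word_extension_vec_word assms by blast
  then have "reduced_word (us @ vec_word m)" using trace_cong_reduced_word assms(4) by blast
  then show ?thesis by (rule reduced_word_append(2)) (rule trace_cong_verts(2)[OF us])
qed

definition least_inverting :: "('v \<Rightarrow> nat) \<Rightarrow> ('w \<Rightarrow> real) \<Rightarrow> bool" where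
  "least_inverting m a \<longleftrightarrow> pos a \<and> valid m \<and> inverts m a \<and> (\<forall>n. valid n \<longrightarrow> inverts n a \<longrightarrow> m \<le> n)"

lemma least_inverting_unique: "least_inverting m a \<Longrightarrow> least_inverting m' a \<Longrightarrow> m = m'"
  unfolding least_inverting_def by (meson antisym)

lemma ex_least_inverting:
  assumes a: "pos a" and n0: "valid n0" "inverts n0 a" shows "\<exists>m. least_inverting m a"
proof -
  obtain m where m: "valid m" "inverts m a" and min: "\<And>n. valid n \<Longrightarrow> inverts n a \<Longrightarrow> length (vec_word m) \<le> length (vec_word n)"
    using n0 ex_has_least_nat[of "\<lambda>m. valid m \<and> inverts m a" n0 "\<lambda>m. length (vec_word m)"] by blast
  have "m \<le> n" if n: "valid n" "inverts n a" for n
  proof -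
    define k where "k = inf m n"
    have k: "valid k" "k \<le> m" "k \<le> n" using m n valid_inf by (auto simp: k_def)
    obtain us where us: "trace_cong (vec_word m) (us @ vec_word k)"
      using vec_word_extension_vec_word m k by blast
    obtain vs where vs: "trace_cong (vec_word n) (vs @ vec_word k)"
      using vec_word_extension_vec_word n k by blast
    have V': "set us \<subseteq> V" "set vs \<subseteq> V" "set (vec_word k) \<subseteq> V"
      using trace_cong_verts(2)[OF us] trace_cong_verts(2)[OF vs] by auto
    have cu: "m v = count_list us v + k v" "n v = count_list vs v + k v" for v
      using trace_cong_count[OF us, of v] trace_cong_count[OF vs, of v] count_vec_word m n k by auto
    show ?thesis
    proof (cases "us = []")
      case True
      then have "m = k" using cu by auto
      then show ?thesis using k by simp
    next
      case False
      then have "length (vec_word k) < length (vec_word m)" using trace_cong_length[OF us] by simp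
      then have "\<not> inverts k a" using min[of k] k by force
      define d where "d = word_act (vec_word k) a"
      have dp: "pos d" using \<open>\<not> inverts k a\<close> by (simp add: inverts_def d_def)
      have "\<not> pos (word_act us d)" using m(2) trace_cong_word_act[OF us] by (simp add: inverts_def d_def)
      from sign_change[OF V'(1) dp this] obtain us1 x us2
        where x: "us = us1 @ x # us2" "word_act us2 d = sroot x" by blast
      \<comment> \<open>A word changes only the coordinates at its own letters, so every nonzero
        coordinate of \<open>d\<close> belongs to a letter of \<open>us\<close>.\<close>
      have d: "d = word_act (rev us2) (sroot x)" using V' x by (metis le_sup_iff list.simps(15) word_act_rev set_append insert_subset)
      obtain s where s: "s \<in> gens W" "d s \<noteq> 0" using root_nonzero[OF pos_roots[OF dp]] by blast
      then obtain z where z: "z \<in> V" "s = gen z" using gens_gen by blast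
      have "z \<in> set us"
      proof (rule ccontr)
        assume "z \<notin> set us"
        then have "d (gen z) = sroot x (gen z)" unfolding d using V' x z by (intro word_act_coord) auto
        then show False using s z x V' \<open>z \<notin> set us\<close> by (auto simp: simple_root_def)
      qed
      then have "count_list us z \<noteq> 0" by (auto simp: count_list_0_iff)
      moreover have "count_list us z = 0 \<or> count_list vs z = 0"
        using cu[of z] unfolding k_def inf_fun_def inf_nat_def by linarith
      ultimately have "z \<notin> set vs" by (simp add: count_list_0_iff)
      then have "word_act vs d (gen z) = d (gen z)" using word_act_coord V' z by blast
      moreover have "d (gen z) > 0" using s z dp pos_coord[of d z] by force
      moreover have "neg (word_act vs d)"
        using n(2) trace_cong_word_act[OF vs] root_pos_or_neg[of "word_act vs d"] V' pos_roots[OF dp] by (simp add: inverts_def d_def)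
      ultimately have False using gen_gens[OF z(1)] unfolding negative_root_def by fastforce
      then show ?thesis ..
    qed
  qed
  then show ?thesis using m a unfolding least_inverting_def by blast
qed

text \<open>Some reduced right factor already inverts \<open>a\<close>, and leastness leaves no room
  for further letters.\<close>

lemma least_inverting_reduced_vec: assumes "least_inverting m a" shows "reduced_vec m"
proof -
  have m: "pos a" "valid m" "inverts m a" "\<And>n. valid n \<Longrightarrow> inverts n a \<Longrightarrow> m \<le> n" using assms by (auto simp: least_inverting_def)
  obtain us zs where z: "trace_cong (vec_word m) (us @ zs)" "reduced_word zs" "\<not> pos (word_act zs a)"
    using inverted_by_reduced_suffix[OF orient_c adm_vec_word[OF m(2)] m(1)] m(3) by (auto simp: inverts_def)
  have "adm Q (us @ zs)" using trace_cong_adm[OF z(1) orient_c] adm_vec_word[OF m(2)] by blast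
  then have az: "adm Q zs" by simp
  then have "m \<le> count_list zs" using m(4)[OF adm_valid] z(3) inverts_adm by blast
  moreover have "m v = count_list us v + count_list zs v" for v
    using trace_cong_count[OF z(1), of v] count_vec_word[OF m(2)] by simp
  ultimately have "m = count_list zs" by (fastforce simp: le_fun_def)
  then show ?thesis using reduced_vec_adm az z(2) by simp
qed

text \<open>Without the letter fired last, the counts are no longer above \<open>m\<close>, so
  \<open>a\<close> is not yet inverted. The sign changes at this letter, and only its own simple
  root can do that.\<close>

lemma least_inverting_head:
  assumes "least_inverting m a" "adm Q (x # vs)" "count_list (x # vs) = m" shows "word_act vs a = sroot x"
proof -
  have v: "adm Q vs" using assms by simp
  have "\<not> m \<le> count_list vs" using assms(3) by (auto simp: le_fun_def intro: exI[of _ x])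
  then have "\<not> inverts (count_list vs) a" using assms(1) adm_valid[OF v] by (auto simp: least_inverting_def)
  then have "pos (word_act vs a)" using inverts_adm[OF v] by simp
  moreover have "\<not> pos (vreflect x (word_act vs a))" using inverts_adm[OF assms(2), of a] assms(1,3) by (simp add: least_inverting_def)
  ultimately show ?thesis using pos_refl_neg[of x "word_act vs a"] assms(2) sink_verts[of "state vs Q" x] by simp
qed

lemma least_inverting_nonempty: assumes "least_inverting m a" shows "vec_word m \<noteq> []"
  using assms by (auto simp: least_inverting_def inverts_def)

text \<open>A word for the vector recovers the root: pull back the simple root of the letter fired
  last.\<close>

lemma least_inverting_inj: assumes "least_inverting m a" "least_inverting m b" shows "a = b"
proof -
  have m: "valid m" using assms by (simp add: least_inverting_def)
  obtain x vs where w: "vec_word m = x # vs" using least_inverting_nonempty[OF assms(1)] by (cases "vec_word m") auto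
  have "word_act vs a = word_act vs b"
    using least_inverting_head[OF assms(1), of x vs] least_inverting_head[OF assms(2), of x vs] vec_word[OF m] w by simp
  then show ?thesis using word_act_inject[of vs] vec_word_verts[OF m] w by simp
qed

text \<open>Characterized by minimality instead of hulls: by \<open>principal_vec_le_iff\<close>,
  lying above this vector is a condition at the single vertex \<open>x\<close>. The link with the
  layered words is \<open>principal_word_eq\<close>.\<close>

definition principal_vec :: "nat \<Rightarrow> 'v \<Rightarrow> 'v \<Rightarrow> nat" where
  "principal_vec r x v = (LEAST k. \<exists>n. valid n \<and> r \<le> n x \<and> n v = k)"

lemma valid_const: "valid (\<lambda>v. if v \<in> V then r else 0)"
  unfolding valid_def using Q_verts by auto

lemma principal_vec_attained: assumes "x \<in> V" shows "\<exists>n. valid n \<and> r \<le> n x \<and> n v = principal_vec r x v"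
  unfolding principal_vec_def by (rule LeastI_ex) (use valid_const[of r] assms in force)

lemma principal_vec_le: "valid n \<Longrightarrow> r \<le> n x \<Longrightarrow> principal_vec r x v \<le> n v"
  unfolding principal_vec_def by (rule Least_le) auto

lemma valid_principal_vec: assumes "x \<in> V" shows "valid (principal_vec r x)"
  unfolding valid_def
proof (intro conjI allI impI ballI, goal_cases)
  case (1 v)
  then show ?case using principal_vec_le[OF valid_const[of r], of r x v] assms by simp
next
  case (2 p)
  obtain y z where p: "p = (y, z)" by force
  obtain n where n: "valid n" "r \<le> n x" "n z = principal_vec r x z" using principal_vec_attained[OF assms] by blast
  obtain n' where n': "valid n'" "r \<le> n' x" "n' y = principal_vec r x y" using principal_vec_attained[OF assms] by blast
  show ?case
    using 2 principal_vec_le[OF n(1,2), of y] principal_vec_le[OF n'(1,2), of z] n n'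
      valid_arrow[OF n(1), of y z] valid_arrow[OF n'(1), of y z] by (simp add: p)
qed

lemma principal_vec_self: assumes "x \<in> V" shows "principal_vec r x x = r"
proof (rule antisym)
  show "principal_vec r x x \<le> r" using principal_vec_le[OF valid_const[of r], of r x x] assms by simp
  show "r \<le> principal_vec r x x" using principal_vec_attained[OF assms, of r x] by auto
qed

lemma principal_vec_le_iff: "x \<in> V \<Longrightarrow> valid n \<Longrightarrow> principal_vec r x \<le> n \<longleftrightarrow> r \<le> n x"
  using principal_vec_le principal_vec_self unfolding le_fun_def by metis

lemma principal_vec_le_r: "x \<in> V \<Longrightarrow> principal_vec r x v \<le> r"
  using principal_vec_le[OF valid_const[of r], of r x v] by (auto split: if_splits)

text \<open>Let \<open>x\<close> be a letter fired last. If \<open>m\<close> exceeded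
  \<open>principal_vec (m x) x\<close>, another letter could be fired last as well, and by
  \<open>least_inverting_head\<close> the two simple roots would coincide.\<close>

lemma least_inverting_principal_vec: assumes "least_inverting m a" shows "\<exists>r x. r > 0 \<and> x \<in> V \<and> m = principal_vec r x"
proof -
  have m: "valid m" using assms by (simp add: least_inverting_def)
  obtain x vs where w: "vec_word m = x # vs" using least_inverting_nonempty[OF assms(1)] by (cases "vec_word m") auto
  have mx: "m x > 0" using count_vec_word[OF m] w by (metis count_list.simps(2) zero_less_Suc Suc_eq_plus1)
  have xV: "x \<in> V" using vec_word_verts[OF m] w by simp
  have hx: "word_act vs a = sroot x" using least_inverting_head[OF assms, of x vs] vec_word[OF m] w by simp
  define k where "k = principal_vec (m x) x"
  have k: "valid k" "k x = m x" "k \<le> m" using xV m by (auto simp: k_def valid_principal_vec principal_vec_self principal_vec_le_iff)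
  obtain us where us: "trace_cong (vec_word m) (us @ vec_word k)"
    using vec_word_extension_vec_word m k by blast
  have cu: "m v = count_list us v + k v" for v using trace_cong_count[OF us, of v] count_vec_word m k by auto
  have "us = []"
  proof (rule ccontr)
    assume "us \<noteq> []"
    then obtain u us' where u: "us = u # us'" by (cases us) auto
    have "u \<noteq> x" using cu[of x] k u by auto
    have au: "adm Q (u # us' @ vec_word k)" using trace_cong_adm[OF us orient_c] adm_vec_word[OF m] u by simp
    have "count_list (u # us' @ vec_word k) = m" using cu count_vec_word[OF k(1)] u by (auto simp: fun_eq_iff)
    from least_inverting_head[OF assms au this] have hu: "word_act (us' @ vec_word k) a = sroot u" .
    have uV: "u \<in> V" using adm_verts[OF au] by simp
    have "word_act (x # vs) a = word_act (u # us' @ vec_word k) a" using trace_cong_word_act[OF us] w u by simp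
    then have "(\<lambda>t. - sroot x t) = (\<lambda>t. - sroot u t)" using hx hu xV uV by simp
    then have "- sroot x (gen x) = - sroot u (gen x)" by metis
    then show False using \<open>u \<noteq> x\<close> xV uV by (auto simp: simple_root_def split: if_splits)
  qed
  then have "m = k" using cu by auto
  then show ?thesis using mx xV k_def by blast
qed

text \<open>If \<open>u\<close> made the negative image positive again, that image would be the
  negative of \<open>sroot u\<close>. The inverse of \<open>us @ ws\<close> would then send
  \<open>sroot u\<close> to \<open>- a\<close>, against the criterion for \<open>u # us @ ws\<close>
  to be reduced.\<close>

lemma inverts_stays:
  assumes "reduced_word (us @ ws)" "set (us @ ws) \<subseteq> V" "pos a" "\<not> pos (word_act ws a)"
  shows "\<not> pos (word_act (us @ ws) a)"
  using assms(1,2)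
proof (induction us)
  case (Cons u us)
  let ?b = "word_act (us @ ws) a"
  have V': "u \<in> V" "set (us @ ws) \<subseteq> V" using Cons by auto
  have red: "reduced_word (us @ ws)" "pos (word_act (rev (us @ ws)) (sroot u))"
    using Cons.prems reduced_word_Cons[of u "us @ ws"] by auto
  have b: "?b \<in> roots W" "\<not> pos ?b" using Cons red pos_roots[OF assms(3)] by auto
  show ?case
  proof
    assume p: "pos (word_act ((u # us) @ ws) a)"
    have "vreflect u (\<lambda>t. - ?b t) = (\<lambda>t. - vreflect u ?b t)" using word_act_neg[of "[u]"] V' by simp
    then have "\<not> pos (vreflect u (\<lambda>t. - ?b t))" using p pos_uminus[of "vreflect u ?b"] V' b by simp
    moreover have "pos (\<lambda>t. - ?b t)" using b pos_uminus by blast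
    ultimately have "(\<lambda>t. - ?b t) = sroot u" using pos_refl_neg V' by blast
    then have "word_act (rev (us @ ws)) (sroot u) = (\<lambda>t. - a t)"
      using word_act_neg[of "rev (us @ ws)" ?b] word_act_rev[OF V'(2), of a] V' by (metis set_rev)
    then show False using red pos_uminus[OF pos_roots[OF assms(3)]] assms(3) by simp
  qed
qed (use assms in simp)

text \<open>The letter fired last must be \<open>x\<close>, as any other could be dropped without
  lowering the value at \<open>x\<close>. The root is \<open>sroot x\<close> pulled back along the
  letters before it.\<close>

lemma principal_vec_least_inverting: assumes "r > 0" "x \<in> V" "reduced_vec (principal_vec r x)" shows "\<exists>a. least_inverting (principal_vec r x) a"
proof -
  define n where "n = principal_vec r x"
  have n: "valid n" using assms valid_principal_vec by (simp add: n_def)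
  have nx: "n x = r" using assms principal_vec_self by (simp add: n_def)
  have "vec_word n \<noteq> []" using nx assms count_vec_word[OF n] by auto
  then obtain y vs where w: "vec_word n = y # vs" by (cases "vec_word n") auto
  have av: "adm Q vs" "sink (state vs Q) y" using adm_vec_word[OF n] w by auto
  have cn: "n v = count_list vs v + (if v = y then 1 else 0)" for v
    using fun_cong[OF count_vec_word[OF n], of v] unfolding w by auto
  have "y = x"
  proof (rule ccontr)
    assume "y \<noteq> x"
    then have "n \<le> count_list vs" using cn[of x] nx principal_vec_le_iff[OF assms(2) adm_valid[OF av(1)]] by (simp add: n_def)
    then have "n y \<le> count_list vs y" unfolding le_fun_def by blast
    then show False using cn[of y] by simp
  qed
  have V': "x \<in> V" "set vs \<subseteq> V" using assms adm_verts[OF av(1)] by auto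
  have red: "reduced_word vs" "pos (word_act (rev vs) (sroot x))"
    using assms(3) reduced_word_Cons[OF V'] w \<open>y = x\<close> by (auto simp: n_def)
  define a where "a = word_act (rev vs) (sroot x)"
  have av': "word_act vs a = sroot x" using V' by (simp add: a_def)
  have "inverts n a" using w \<open>y = x\<close> av' V' pos_uminus[of "sroot x"] by (simp add: inverts_def)
  then obtain m where m: "least_inverting m a" using ex_least_inverting[of a n] red n by (auto simp: a_def)
  have mn: "m \<le> n" "valid m" using m n \<open>inverts n a\<close> by (auto simp: least_inverting_def)
  \<comment> \<open>Otherwise \<open>m\<close> lies below the counts of \<open>vs\<close>. Being
    reduced, \<open>vs\<close> would then still invert \<open>a\<close>, whereas it sends
    \<open>a\<close> to \<open>sroot x\<close>.\<close>
  have "n \<le> m"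
  proof (rule ccontr)
    assume "\<not> n \<le> m"
    then have "m x < r" using principal_vec_le_iff[OF assms(2) mn(2)] by (simp add: n_def)
    have "m v \<le> count_list vs v" for v
      using cn[of v] nx mn(1) \<open>y = x\<close> \<open>m x < r\<close> unfolding le_fun_def by (cases "v = x") (auto dest: spec[of _ v])
    then have "m \<le> count_list vs" by (rule le_funI)
    then obtain us where us: "trace_cong vs (us @ vec_word m)"
      using adm_count_le_extension[OF orient_c adm_vec_word[OF mn(2)] av(1)] count_vec_word[OF mn(2)]
      by (auto simp: le_fun_def)
    have "\<not> pos (word_act (us @ vec_word m) a)"
      using inverts_stays[of us "vec_word m" a] trace_cong_reduced_word[OF us] trace_cong_verts(2)[OF us] red m
      by (auto simp: least_inverting_def inverts_def)
    then show False using trace_cong_word_act[OF us] av' V' by simp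
  qed
  then have "m = n" using mn by simp
  then show ?thesis using m by (auto simp: n_def)
qed

text \<open>The letters of \<open>xs\<close> are added one by one. If \<open>x\<close> now exceeds
  its count in \<open>n\<close>, it does not occur in the part \<open>us\<close> by which the join
  exceeds \<open>xs\<close>. So it commutes past \<open>us\<close>, and the criterion for
  \<open>x # us @ xs\<close> reduces to that for \<open>x # xs\<close>.\<close>

lemma reduced_vec_sup_adm:
  assumes "adm Q xs" "reduced_word xs" "valid n" "reduced_vec n"
  shows "reduced_vec (sup (count_list xs) n)"
  using assms(1,2)
proof (induction xs)
  case Nil
  have "sup (count_list []) n = n" by (auto simp: fun_eq_iff sup_nat_def)
  then show ?case using assms(4) by (simp only:)
next
  case (Cons x xs)
  have V': "x \<in> V" "set xs \<subseteq> V" using adm_verts[OF Cons.prems(1)] by auto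
  have xs: "adm Q xs" "sink (state xs Q) x" "reduced_word xs" "pos (word_act (rev xs) (sroot x))"
    using Cons.prems reduced_word_Cons[OF V'] by auto
  define k where "k = sup (count_list xs) n"
  have k: "valid k" "reduced_vec k"
    unfolding k_def by (rule valid_sup[OF adm_valid[OF xs(1)] assms(3)], rule Cons.IH[OF xs(1,3)])
  show ?case
  proof (cases "n x \<le> count_list xs x")
    case False
    then have "sup (count_list (x # xs)) n = k" by (auto simp: k_def fun_eq_iff sup_nat_def)
    then show ?thesis using k(2) by (simp only:)
  next
    case True
    obtain us where us: "trace_cong (vec_word k) (us @ xs)"
      using vec_word_extension[OF k(1) xs(1)] unfolding k_def by (meson sup_ge1)
    have cu: "k v = count_list us v + count_list xs v" for v using trace_cong_count[OF us, of v] count_vec_word k by auto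
    have aus: "adm Q (us @ xs)" using trace_cong_adm[OF us orient_c] adm_vec_word[OF k(1)] by blast
    have uV: "set us \<subseteq> V" using adm_verts[OF aus] by simp
    have "x \<notin> set us" using cu[of x] True by (auto simp: k_def sup_nat_def count_list_0_iff)
    from sink_no_neighbours[OF orient_state[OF orient_c] xs(2) _ this]
    have free: "\<forall>t\<in>set us. t \<noteq> x \<and> \<not> adj x t" "sink (state us (state xs Q)) x" using aus by auto
    have a: "adm Q (x # us @ xs)" using aus free by simp
    have "count_list (x # us @ xs) = sup (count_list (x # xs)) n"
    proof
      fix v
      have "count_list us v + count_list xs v = max (count_list xs v) (n v)"
        using cu[of v] by (simp add: k_def sup_nat_def)
      then show "count_list (x # us @ xs) v = sup (count_list (x # xs)) n v"
        using True \<open>x \<notin> set us\<close> by (auto simp: sup_nat_def)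
    qed
    moreover have "reduced_word (us @ xs)" using k(2) trace_cong_reduced_word[OF us] by blast
    moreover have "word_act (rev us) (sroot x) = sroot x" using word_act_sroot_nonadj[of "rev us" x] uV V' free by simp
    moreover have "reduced_word (x # us @ xs)"
      using calculation(2,3) reduced_word_Cons[of x "us @ xs"] V' uV xs by simp
    ultimately show ?thesis using reduced_vec_adm[OF a] by (simp only:)
  qed
qed

lemma reduced_vec_sup: "valid m \<Longrightarrow> valid n \<Longrightarrow> reduced_vec m \<Longrightarrow> reduced_vec n \<Longrightarrow> reduced_vec (sup m n)"
  using reduced_vec_sup_adm[of "vec_word m" n] adm_vec_word[of m] count_vec_word[of m] by (simp only:)

end

section \<open>Joins of admissible elements\<close>

context coxeter_group
begin

section \<open>Elements of the graph monoid as classes of words\<close>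

abbreviation "word_class xs \<equiv> gm_rel W `` {xs}"

lemma gm_rel_iff: "(xs, ys) \<in> gm_rel W \<longleftrightarrow> trace_cong xs ys"
  by (simp add: gm_rel_def)

lemma in_word_class: "ys \<in> word_class xs \<longleftrightarrow> trace_cong xs ys"
  by (simp add: gm_rel_iff)

lemma equiv_gm_rel: "equiv (lists V) (gm_rel W)"
proof (rule equivI)
  show "gm_rel W \<subseteq> lists V \<times> lists V"
    using trace_cong_verts unfolding gm_rel_iff subset_iff by (fastforce simp: gm_rel_iff)
  show "refl_on (lists V) (gm_rel W)" unfolding refl_on_def gm_rel_iff by (auto intro: trace_cong_refl)
  show "Relation.sym (gm_rel W)" unfolding Relation.sym_def gm_rel_iff by (blast intro: monoid_cong.sym)
  show "Relation.trans (gm_rel W)" unfolding Relation.trans_def gm_rel_iff by (blast intro: monoid_cong.trans)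
qed

lemma word_class_eq_iff: "set xs \<subseteq> V \<Longrightarrow> word_class xs = word_class ys \<longleftrightarrow> trace_cong xs ys"
  by (metis equiv_class_eq equiv_gm_rel trace_cong_refl gm_rel_iff in_word_class monoid_cong.sym)

lemma word_class_self: "set xs \<subseteq> V \<Longrightarrow> xs \<in> word_class xs"
  unfolding in_word_class by (rule trace_cong_refl)

lemma carrier_graph_monoid: "X \<in> carrier (graph_monoid W) \<longleftrightarrow> (\<exists>xs. set xs \<subseteq> V \<and> X = word_class xs)"
  by (auto simp: graph_monoid_def quotient_def)

lemma word_class_mult:
  assumes "set xs \<subseteq> V" "set ys \<subseteq> V"
  shows "word_class xs \<otimes>\<^bsub>graph_monoid W\<^esub> word_class ys = word_class (xs @ ys)"
proof -
  have "word_class (xs' @ ys') = word_class (xs @ ys)" if "xs' \<in> word_class xs" "ys' \<in> word_class ys" for xs' ys'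
  proof -
    have "trace_cong (xs @ ys) (xs' @ ys')" using that monoid_cong.app unfolding in_word_class by blast
    then have "word_class (xs @ ys) = word_class (xs' @ ys')" using assms word_class_eq_iff[of "xs @ ys"] by simp
    then show ?thesis ..
  qed
  then have "(\<Union>xs'\<in>word_class xs. \<Union>ys'\<in>word_class ys. word_class (xs' @ ys')) = word_class (xs @ ys)"
    using word_class_self assms by blast
  then show ?thesis by (simp add: graph_monoid_def)
qed

lemma one_graph_monoid: "\<one>\<^bsub>graph_monoid W\<^esub> = word_class []"
  by (simp add: graph_monoid_def)

lemma the_elem_word_class:
  assumes "set xs \<subseteq> V" "\<And>ys. trace_cong xs ys \<Longrightarrow> f ys = f xs" shows "the_elem (f ` word_class xs) = f xs"
proof -
  have "f ` word_class xs = {f xs}" using assms word_class_self unfolding in_word_class[symmetric] by blast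
  then show ?thesis by simp
qed

lemma gm_rho_word_class: "set xs \<subseteq> V \<Longrightarrow> gm_rho W (word_class xs) = rho xs"
  unfolding gm_rho_def by (rule the_elem_word_class) (auto dest: trace_cong_rho)

lemma gm_length_word_class: "set xs \<subseteq> V \<Longrightarrow> gm_length (word_class xs) = length xs"
  unfolding gm_length_def by (rule the_elem_word_class) (auto dest: trace_cong_length)

lemma Supp_word_class: "set xs \<subseteq> V \<Longrightarrow> Supp (word_class xs) = set xs"
  unfolding Supp_def by (rule the_elem_word_class) (auto dest: trace_cong_set)

lemma mult_free_word_class: assumes "set xs \<subseteq> V" shows "mult_free (word_class xs) \<longleftrightarrow> distinct xs"
proof -
  have "distinct ys \<longleftrightarrow> distinct xs" if "trace_cong xs ys" for ys
    using trace_cong_length[OF that] trace_cong_set[OF that] distinct_card card_distinct by metis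
  then show ?thesis unfolding mult_free_def using word_class_self[OF assms] in_word_class by blast
qed

lemma reduced_word_class: "set xs \<subseteq> V \<Longrightarrow> reduced W (word_class xs) \<longleftrightarrow> reduced_word xs"
  by (auto simp: reduced_def gm_length_word_class gm_rho_word_class reduced_word_def)

lemma gm_le_word_class:
  assumes "set xs \<subseteq> V" "set ys \<subseteq> V"
  shows "gm_le W (word_class xs) (word_class ys) \<longleftrightarrow> (\<exists>us. trace_cong ys (us @ xs))"
proof
  assume "gm_le W (word_class xs) (word_class ys)"
  then obtain us where "set us \<subseteq> V" "word_class ys = word_class (us @ xs)"
    using assms unfolding gm_le_def by (auto simp: carrier_graph_monoid word_class_mult)
  then show "\<exists>us. trace_cong ys (us @ xs)" using word_class_eq_iff assms by blast
next
  assume "\<exists>us. trace_cong ys (us @ xs)"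
  then obtain us where us: "trace_cong ys (us @ xs)" by blast
  then have uV: "set us \<subseteq> V" using trace_cong_verts(2)[OF us] by simp
  have "word_class ys = word_class us \<otimes>\<^bsub>graph_monoid W\<^esub> word_class xs"
    unfolding word_class_mult[OF uV assms(1)] using us word_class_eq_iff[OF assms(2)] by blast
  moreover have "word_class us \<in> carrier (graph_monoid W)"
    unfolding carrier_graph_monoid using uV by (intro exI[of _ us]) simp
  ultimately show "gm_le W (word_class xs) (word_class ys)" unfolding gm_le_def by (rule bexI)
qed

end

context coxeter_element_group
begin

section \<open>Admissible elements as valid vectors\<close>

lemma valid_outside: "valid n \<Longrightarrow> v \<notin> V \<Longrightarrow> n v = 0"
  by (simp add: valid_def)

definition vec_class :: "('v \<Rightarrow> nat) \<Rightarrow> 'v list set" where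
  "vec_class n = word_class (vec_word n)"

lemma word_class_adm: "adm Q xs \<Longrightarrow> word_class xs = vec_class (count_list xs)"
  unfolding vec_class_def using adm_trace_cong_vec_word word_class_eq_iff adm_verts by blast

lemma Adm_eq: "Adm W c = vec_class ` Collect valid"
proof (intro Set.set_eqI iffI)
  fix X assume "X \<in> Adm W c"
  then obtain xs ys where xs: "set xs \<subseteq> V" "X = word_class xs" "ys \<in> X" "adm Q ys"
    by (auto simp: Adm_def carrier_graph_monoid admissible_word_def adm_def)
  then have "X = word_class ys" using word_class_eq_iff[OF xs(1)] in_word_class by blast
  then show "X \<in> vec_class ` Collect valid" using word_class_adm[OF xs(4)] adm_valid[OF xs(4)] by blast
next
  fix X assume "X \<in> vec_class ` Collect valid"
  then obtain n where n: "valid n" "X = vec_class n" by blast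
  then show "X \<in> Adm W c"
    using vec_word_verts[OF n(1)] adm_vec_word[OF n(1)] word_class_self[of "vec_word n"]
    by (auto simp: Adm_def carrier_graph_monoid admissible_word_def adm_def vec_class_def)
qed

lemma gm_le_vec_class: assumes "valid m" "valid n" shows "gm_le W (vec_class m) (vec_class n) \<longleftrightarrow> m \<le> n"
proof -
  have "gm_le W (vec_class m) (vec_class n) \<longleftrightarrow> (\<exists>us. trace_cong (vec_word n) (us @ vec_word m))"
    unfolding vec_class_def using assms by (intro gm_le_word_class vec_word_verts)
  also have "\<dots> \<longleftrightarrow> m \<le> n"
  proof
    assume "\<exists>us. trace_cong (vec_word n) (us @ vec_word m)"
    then obtain us where us: "trace_cong (vec_word n) (us @ vec_word m)" by blast
    show "m \<le> n"
    proof (rule le_funI)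
      fix v
      have "count_list (vec_word n) v = count_list us v + count_list (vec_word m) v" using trace_cong_count[OF us, of v] by simp
      then show "m v \<le> n v" using count_vec_word assms by simp
    qed
  qed (use assms vec_word_extension_vec_word in blast)
  finally show ?thesis .
qed

lemma vec_class_inject: assumes "valid m" "valid n" shows "vec_class m = vec_class n \<longleftrightarrow> m = n"
proof
  assume "vec_class m = vec_class n"
  then have "gm_le W (vec_class m) (vec_class n)" "gm_le W (vec_class n) (vec_class m)"
    using gm_le_vec_class[OF assms(1,1)] gm_le_vec_class[OF assms(2,2)] by auto
  then show "m = n" using gm_le_vec_class assms by (meson antisym)
qed simp

lemma gm_rho_vec_class: "valid n \<Longrightarrow> gm_rho W (vec_class n) = rho (vec_word n)"
  by (simp add: vec_class_def gm_rho_word_class vec_word_verts)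

lemma reduced_vec_class: "valid n \<Longrightarrow> reduced W (vec_class n) \<longleftrightarrow> reduced_vec n"
  by (simp add: vec_class_def reduced_word_class vec_word_verts)

lemma negative_vec_class:
  assumes "valid n" "pos a" shows "negative_root W (cox_act W (gm_rho W (vec_class n)) a) \<longleftrightarrow> inverts n a"
  using root_pos_or_neg[of "word_act (vec_word n) a"] pos_roots[OF assms(2)] vec_word_verts[OF assms(1)]
  by (simp add: gm_rho_vec_class assms cox_act_rho inverts_def)

lemma preproj_iff: "a \<in> preproj_roots W c \<longleftrightarrow> (\<exists>m. least_inverting m a)"
proof -
  have "a \<in> preproj_roots W c \<longleftrightarrow> pos a \<and> (\<exists>n. valid n \<and> inverts n a)"
    unfolding preproj_roots_def Adm_eq using negative_vec_class by auto
  also have "\<dots> \<longleftrightarrow> (\<exists>m. least_inverting m a)" using ex_least_inverting by (auto simp: least_inverting_def)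
  finally show ?thesis .
qed

text \<open>For preprojective \<open>a\<close>, the vector of letter counts of
  \<open>least_neg W c {a}\<close>.\<close>

definition inverting_vec :: "('w \<Rightarrow> real) \<Rightarrow> 'v \<Rightarrow> nat" where
  "inverting_vec a = (THE m. least_inverting m a)"

lemma inverting_vec_eq: "least_inverting m a \<Longrightarrow> inverting_vec a = m"
  unfolding inverting_vec_def using least_inverting_unique by blast

lemma least_inverting_inverting_vec: "a \<in> preproj_roots W c \<Longrightarrow> least_inverting (inverting_vec a) a"
  using preproj_iff inverting_vec_eq by blast

lemma inj_inverting_vec: "inj_on inverting_vec (preproj_roots W c)"
  using least_inverting_inverting_vec least_inverting_inj by (metis inj_onI)

lemma valid_inverting_vec: "a \<in> preproj_roots W c \<Longrightarrow> valid (inverting_vec a)"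
  using least_inverting_inverting_vec by (auto simp: least_inverting_def)

lemma reduced_vec_inverting_vec: "a \<in> preproj_roots W c \<Longrightarrow> reduced_vec (inverting_vec a)"
  using least_inverting_inverting_vec least_inverting_reduced_vec by blast

text \<open>Reducedness of \<open>n\<close> is essential to the argument: it rests on
  \<open>inverts_stays\<close>, and a nonreduced prolongation may make the root positive
  again.\<close>

lemma inverts_inverting_vec:
  assumes a: "a \<in> preproj_roots W c" and n: "valid n" "reduced_vec n" "inverting_vec a \<le> n" shows "inverts n a"
proof -
  obtain us where us: "trace_cong (vec_word n) (us @ vec_word (inverting_vec a))" using vec_word_extension_vec_word valid_inverting_vec a n by blast
  have "\<not> pos (word_act (us @ vec_word (inverting_vec a)) a)"
    using least_inverting_inverting_vec[OF a] n(2) trace_cong_reduced_word[OF us] trace_cong_verts(2)[OF us]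
    by (intro inverts_stays) (simp_all add: least_inverting_def inverts_def)
  then show ?thesis using trace_cong_word_act[OF us] by (simp add: inverts_def)
qed

lemma inverting_vec_le: "a \<in> preproj_roots W c \<Longrightarrow> valid n \<Longrightarrow> inverts n a \<Longrightarrow> inverting_vec a \<le> n"
  using least_inverting_inverting_vec by (auto simp: least_inverting_def)

section \<open>Least elements and joins\<close>

lemma least_vec_class_iff:
  assumes "A \<subseteq> Collect valid"
  shows "least (adm_order W c) X (vec_class ` A) \<longleftrightarrow> (\<exists>m\<in>A. X = vec_class m \<and> (\<forall>n\<in>A. m \<le> n))"
proof -
  have le: "gm_le W (vec_class m) (vec_class n) \<longleftrightarrow> m \<le> n" if "m \<in> A" "n \<in> A" for m n
    using gm_le_vec_class that assms by blast
  have "least (adm_order W c) X (vec_class ` A) \<longleftrightarrow> (\<exists>m\<in>A. X = vec_class m \<and> (\<forall>n\<in>A. gm_le W (vec_class m) (vec_class n)))"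
    unfolding least_def adm_order_def Adm_eq using assms by auto
  also have "\<dots> \<longleftrightarrow> (\<exists>m\<in>A. X = vec_class m \<and> (\<forall>n\<in>A. m \<le> n))"
    by (intro bex_cong ball_cong conj_cong HOL.refl le)
  finally show ?thesis .
qed

lemma least_vec_class_unique:
  assumes "A \<subseteq> Collect valid" "m \<in> A" "\<forall>n\<in>A. m \<le> n"
  shows "least (adm_order W c) X (vec_class ` A) \<longleftrightarrow> X = vec_class m"
proof -
  have "m' = m" if "m' \<in> A" "\<forall>n\<in>A. m' \<le> n" for m'
    using that assms by (intro antisym) auto
  then show ?thesis unfolding least_vec_class_iff[OF assms(1)] using assms(2,3) by blast
qed

text \<open>The inserted 0 makes the empty join the zero vector, that is, the element 1 of the
  monoid.\<close>

definition join_vec :: "('v \<Rightarrow> nat) set \<Rightarrow> 'v \<Rightarrow> nat" where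
  "join_vec A v = Max (insert 0 ((\<lambda>n. n v) ` A))"

lemma join_vec_le_iff: assumes "finite A" shows "join_vec A \<le> n \<longleftrightarrow> (\<forall>m\<in>A. m \<le> n)"
  using assms by (auto simp: join_vec_def le_fun_def)

lemma join_vec_upper: "finite A \<Longrightarrow> m \<in> A \<Longrightarrow> m \<le> join_vec A"
  using join_vec_le_iff[of A "join_vec A"] by simp

lemma join_vec_empty [simp]: "join_vec {} = (\<lambda>_. 0)"
  by (simp add: join_vec_def fun_eq_iff)

lemma join_vec_insert: assumes "finite A" shows "join_vec (insert m A) = sup m (join_vec A)"
proof (rule antisym)
  show "join_vec (insert m A) \<le> sup m (join_vec A)"
    using assms join_vec_upper[OF assms] by (auto simp: join_vec_le_iff intro: le_supI2)
  show "sup m (join_vec A) \<le> join_vec (insert m A)"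
    using assms join_vec_upper[of "insert m A"] by (auto simp: join_vec_le_iff)
qed

lemma valid_join_vec: "finite A \<Longrightarrow> A \<subseteq> Collect valid \<Longrightarrow> valid (join_vec A)"
proof (induction rule: finite_induct)
  case (insert m A)
  then have "valid m" "valid (join_vec A)" by auto
  then show ?case unfolding join_vec_insert[OF insert(1)] by (rule valid_sup)
qed (simp only: join_vec_empty valid_0)

lemma reduced_vec_join_vec: "finite A \<Longrightarrow> A \<subseteq> Collect valid \<Longrightarrow> \<forall>m\<in>A. reduced_vec m \<Longrightarrow> reduced_vec (join_vec A)"
proof (induction rule: finite_induct)
  case empty
  have "reduced_vec (count_list [])" using reduced_vec_adm[of "[]"] by simp
  moreover have "count_list [] = join_vec {}" by (simp add: fun_eq_iff)
  ultimately show ?case by simp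
next
  case (insert m A)
  then have "valid m" "valid (join_vec A)" "reduced_vec m" "reduced_vec (join_vec A)" using valid_join_vec by auto
  then show ?case unfolding join_vec_insert[OF insert(1)] by (rule reduced_vec_sup)
qed

lemma Upper_vec_class:
  assumes "A \<subseteq> Collect valid"
  shows "Upper (adm_order W c) (vec_class ` A) = vec_class ` {n. valid n \<and> (\<forall>m\<in>A. m \<le> n)}"
proof -
  have "Upper (adm_order W c) (vec_class ` A) = {X. (\<forall>m\<in>A. gm_le W (vec_class m) X) \<and> X \<in> vec_class ` Collect valid}"
    using assms unfolding Upper_def adm_order_def Adm_eq by auto
  also have "\<dots> = vec_class ` {n. valid n \<and> (\<forall>m\<in>A. gm_le W (vec_class m) (vec_class n))}" by blast
  also have "{n. valid n \<and> (\<forall>m\<in>A. gm_le W (vec_class m) (vec_class n))} = {n. valid n \<and> (\<forall>m\<in>A. m \<le> n)}"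
    using assms gm_le_vec_class by blast
  finally show ?thesis .
qed

lemma sup_vec_class:
  assumes "finite A" "A \<subseteq> Collect valid" shows "\<Squnion>\<^bsub>adm_order W c\<^esub> (vec_class ` A) = vec_class (join_vec A)"
proof -
  have "least (adm_order W c) X (Upper (adm_order W c) (vec_class ` A)) \<longleftrightarrow> X = vec_class (join_vec A)" for X
    unfolding Upper_vec_class[OF assms(2)] using valid_join_vec[OF assms] join_vec_le_iff[OF assms(1)] join_vec_upper[OF assms(1)]
    by (intro least_vec_class_unique) auto
  then show ?thesis unfolding Lattice.sup_def by simp
qed

text \<open>The join of the single vectors is reduced because each of them is; therefore it still
  inverts every root of \<open>\<Psi>\<close>.\<close>

lemma least_neg_vec_class:
  assumes "finite \<Psi>" "\<Psi> \<subseteq> preproj_roots W c"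
  shows "least_neg W c \<Psi> = vec_class (join_vec (inverting_vec ` \<Psi>))"
proof -
  define N where "N = {n. valid n \<and> (\<forall>a\<in>\<Psi>. inverts n a)}"
  have pa: "pos a" if "a \<in> \<Psi>" for a using that assms least_inverting_inverting_vec unfolding least_inverting_def by blast
  have e: "{X \<in> Adm W c. \<forall>a\<in>\<Psi>. negative_root W (cox_act W (gm_rho W X) a)} = vec_class ` N"
    unfolding Adm_eq N_def using negative_vec_class pa by auto
  have v: "inverting_vec ` \<Psi> \<subseteq> Collect valid" using assms valid_inverting_vec by blast
  have "valid (join_vec (inverting_vec ` \<Psi>))" "reduced_vec (join_vec (inverting_vec ` \<Psi>))"
    using assms v reduced_vec_inverting_vec by (auto intro!: valid_join_vec reduced_vec_join_vec)
  then have "join_vec (inverting_vec ` \<Psi>) \<in> N"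
    using assms join_vec_upper[of "inverting_vec ` \<Psi>"] inverts_inverting_vec unfolding N_def by blast
  moreover have "\<forall>n\<in>N. join_vec (inverting_vec ` \<Psi>) \<le> n"
    using assms inverting_vec_le unfolding N_def by (auto simp: join_vec_le_iff)
  ultimately have "least (adm_order W c) X (vec_class ` N) \<longleftrightarrow> X = vec_class (join_vec (inverting_vec ` \<Psi>))" for X
    by (intro least_vec_class_unique) (auto simp: N_def)
  then show ?thesis unfolding least_neg_def e by simp
qed

section \<open>Principal vectors as join irreducibles\<close>

definition principal_vecs :: "('v \<Rightarrow> nat) set" where
  "principal_vecs = {principal_vec r x | r x. r > 0 \<and> x \<in> V}"

lemma principal_vecs_valid: "principal_vecs \<subseteq> Collect valid"
  by (auto simp: principal_vecs_def valid_principal_vec)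

lemma principal_vecs_nonzero: assumes "p \<in> principal_vecs" shows "p \<noteq> (\<lambda>_. 0)"
proof
  assume "p = (\<lambda>_. 0)"
  moreover obtain r x where "p = principal_vec r x" "r > 0" "x \<in> V" using assms unfolding principal_vecs_def by blast
  ultimately show False using principal_vec_self[of x r] by simp
qed

text \<open>Lying above \<open>principal_vec r x\<close> concerns the value at \<open>x\<close>
  alone, and the pointwise maximum takes its positive value there in some member of
  \<open>A\<close>.\<close>

lemma principal_vecs_join_prime:
  assumes "p \<in> principal_vecs" "finite A" "A \<subseteq> Collect valid" "p \<le> join_vec A" shows "\<exists>n\<in>A. p \<le> n"
proof -
  obtain r x where p: "p = principal_vec r x" "r > 0" "x \<in> V" using assms by (auto simp: principal_vecs_def)
  have "r \<le> join_vec A x" using principal_vec_le_iff[OF p(3) valid_join_vec[OF assms(2,3)]] assms p by blast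
  moreover have "join_vec A x \<in> insert 0 ((\<lambda>n. n x) ` A)" unfolding join_vec_def using assms by (intro Max_in) auto
  ultimately obtain n where "n \<in> A" "r \<le> n x" using p by auto
  then show ?thesis using principal_vec_le_iff p assms by blast
qed

definition antichain :: "('v \<Rightarrow> nat) set \<Rightarrow> bool" where
  "antichain A \<longleftrightarrow> (\<forall>p\<in>A. \<forall>q\<in>A. p \<le> q \<longrightarrow> p = q)"

text \<open>Each \<open>p\<close> lies below a member of \<open>B\<close>, which lies below a member
  of \<open>A\<close>; the antichain condition makes all three equal. The zero vector is allowed in
  \<open>B\<close> because the empty word counts as principal.\<close>

lemma antichain_subset_join:
  assumes A: "A \<subseteq> principal_vecs" "finite A" "antichain A" and B: "finite B" "B \<subseteq> insert (\<lambda>_. 0) principal_vecs" and e: "join_vec A = join_vec B"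
  shows "A \<subseteq> B"
proof
  fix p assume p: "p \<in> A"
  have Bv: "B \<subseteq> Collect valid" and Av: "A \<subseteq> Collect valid" using A B principal_vecs_valid valid_0 by auto
  have "p \<le> join_vec B" using join_vec_upper[OF A(2) p] e by simp
  then obtain q where q: "q \<in> B" "p \<le> q" using principal_vecs_join_prime[of p B] p A B Bv by blast
  have "q \<noteq> (\<lambda>_. 0)"
  proof
    assume "q = (\<lambda>_. 0)"
    then have "p = (\<lambda>_. 0)" using q by (auto simp: le_fun_def)
    then show False using principal_vecs_nonzero p A by blast
  qed
  then have "q \<in> principal_vecs" using q B by blast
  moreover have "q \<le> join_vec A" using join_vec_upper[OF B(1) q(1)] e by simp
  ultimately obtain p' where "p' \<in> A" "q \<le> p'" using principal_vecs_join_prime[of q A] A Av by blast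
  then have "p = p'" "q = p" using A(3) p q(2) unfolding antichain_def by (metis order.trans, metis order.antisym order.trans)
  then show "p \<in> B" using q by blast
qed

lemma antichain_join_inject:
  "A \<subseteq> principal_vecs \<Longrightarrow> finite A \<Longrightarrow> antichain A \<Longrightarrow> B \<subseteq> principal_vecs \<Longrightarrow> finite B \<Longrightarrow> antichain B \<Longrightarrow> join_vec A = join_vec B \<Longrightarrow> A = B"
  using antichain_subset_join[of A B] antichain_subset_join[of B A] by auto

text \<open>The maximal principal vectors below \<open>n\<close> suffice, since
  \<open>principal_vec (n x) x\<close> is below \<open>n\<close> and already attains the value
  \<open>n x\<close>.\<close>

lemma ex_antichain_join:
  assumes n: "valid n" shows "\<exists>A. A \<subseteq> principal_vecs \<and> finite A \<and> antichain A \<and> join_vec A = n"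
proof -
  define P where "P = {p \<in> principal_vecs. p \<le> n}"
  have "P \<subseteq> (\<lambda>(r, x). principal_vec r x) ` (SIGMA r:{..Max (n ` V)}. V)"
  proof
    fix p assume "p \<in> P"
    then obtain r x where p: "p = principal_vec r x" "x \<in> V" "p \<le> n" by (auto simp: P_def principal_vecs_def)
    then have "r \<le> n x" using principal_vec_le_iff n by blast
    also have "n x \<le> Max (n ` V)" using p by simp
    finally show "p \<in> (\<lambda>(r, x). principal_vec r x) ` (SIGMA r:{..Max (n ` V)}. V)" using p by force
  qed
  then have fin: "finite P" by (rule finite_subset) auto
  define A where "A = {p \<in> P. \<forall>q\<in>P. p \<le> q \<longrightarrow> p = q}"
  have AP: "A \<subseteq> P" by (auto simp: A_def)
  have A: "A \<subseteq> principal_vecs" "finite A" "antichain A"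
    using finite_subset[OF AP fin] AP by (auto simp: A_def P_def antichain_def)
  have "join_vec A \<le> n" unfolding join_vec_le_iff[OF A(2)] using AP unfolding P_def by blast
  moreover have "n \<le> join_vec A"
  proof (rule le_funI)
    fix x
    show "n x \<le> join_vec A x"
    proof (cases "n x = 0")
      case False
      then have x: "x \<in> V" using valid_outside[OF n, of x] by auto
      have "principal_vec (n x) x \<in> P" using False x principal_vec_le_iff[OF x n] by (auto simp: P_def principal_vecs_def)
      from finite_has_maximal2[OF fin this]
      obtain p where p: "p \<in> P" "principal_vec (n x) x \<le> p" "\<forall>q\<in>P. p \<le> q \<longrightarrow> p = q" by auto
      then have "p \<in> A" by (simp add: A_def)
      then have "principal_vec (n x) x \<le> join_vec A" using p(2) join_vec_upper[OF A(2)] order.trans by blast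
      then have "principal_vec (n x) x x \<le> join_vec A x" by (rule le_funD)
      then show ?thesis using principal_vec_self[OF x, of "n x"] by simp
    qed simp
  qed
  ultimately have "join_vec A = n" by (rule antisym)
  then show ?thesis using A by blast
qed

end

section \<open>Principal words and independent sets of roots\<close>

context coxeter_element_group
begin

lemma filter_iff:
  "is_vertex_filter W c F \<longleftrightarrow> F \<subseteq> V \<and> (\<forall>(y, z)\<in>Q. y \<in> F \<longrightarrow> z \<in> F)"
proof
  assume F: "is_vertex_filter W c F"
  have "z \<in> F" if "(y, z) \<in> Q" "y \<in> F" for y z
    using F that Q_verts[OF that(1)] unfolding is_vertex_filter_def vertex_le_def by blast
  then show "F \<subseteq> V \<and> (\<forall>(y, z)\<in>Q. y \<in> F \<longrightarrow> z \<in> F)"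
    using F unfolding is_vertex_filter_def by blast
next
  assume F: "F \<subseteq> V \<and> (\<forall>(y, z)\<in>Q. y \<in> F \<longrightarrow> z \<in> F)"
  have "y \<in> F" if "(x, y) \<in> Q\<^sup>*" "x \<in> F" for x y
    using that by (induction rule: rtrancl_induct) (use F in auto)
  then show "is_vertex_filter W c F" using F unfolding is_vertex_filter_def vertex_le_def by blast
qed

text \<open>The support of the factor \<open>X j\<close> when a word with counts \<open>n\<close> is
  written as a product of multiplicity-free layers.\<close>

definition level :: "('v \<Rightarrow> nat) \<Rightarrow> nat \<Rightarrow> 'v set" where
  "level n j = {v. j \<le> n v}"

lemma level_verts: "valid n \<Longrightarrow> j > 0 \<Longrightarrow> level n j \<subseteq> V"
  using valid_outside by (force simp: level_def)

lemma level_filter: assumes "valid n" "j > 0" shows "is_vertex_filter W c (level n j)"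
proof -
  have "z \<in> level n j" if "(y, z) \<in> Q" "y \<in> level n j" for y z
    using valid_arrow[OF assms(1) that(1)] that(2) by (simp add: level_def)
  then show ?thesis unfolding filter_iff using level_verts[OF assms] by blast
qed

lemma adj_Q: "adj x y \<Longrightarrow> (x, y) \<in> Q \<or> (y, x) \<in> Q"
  using orient_c unfolding orient_def by blast

lemma Q_adj: "(x, y) \<in> Q \<Longrightarrow> adj x y"
  using orient_c unfolding orient_def by blast

lemma principal_vec_top_level:
  assumes "x \<in> V" "r > 0" shows "level (principal_vec r x) r = principal_filter W c x"
proof
  have f: "is_vertex_filter W c (level (principal_vec r x) r)" using level_filter valid_principal_vec assms by blast
  have "x \<in> level (principal_vec r x) r" using principal_vec_self assms by (simp add: level_def)
  then show "principal_filter W c x \<subseteq> level (principal_vec r x) r"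
    using f unfolding is_vertex_filter_def principal_filter_def by blast
next
  let ?F = "principal_filter W c x"
  have F: "?F \<subseteq> V" "x \<in> ?F" using assms by (auto simp: principal_filter_def vertex_le_def)
  have up: "z \<in> ?F" if "(y, z) \<in> Q" "y \<in> ?F" for y z
    using that Q_verts[OF that(1)] by (auto simp: principal_filter_def vertex_le_def)
  \<comment> \<open>A competitor for the minimum: \<open>r\<close> on the filter and one less
    elsewhere. It is valid because no arrow leaves the filter, so \<open>principal_vec r x\<close>
    stays below \<open>r\<close> outside.\<close>
  define n where "n = (\<lambda>v. if v \<in> ?F then r else if v \<in> V then r - 1 else 0)"
  have "valid n" unfolding valid_def
  proof (intro conjI allI impI ballI, goal_cases)
    case (1 v)
    then show ?case using F by (auto simp: n_def)
  next
    case (2 p)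
    obtain y z where p: "p = (y, z)" by force
    show ?case using 2 up[of y z] Q_verts[of y z] by (auto simp: p n_def)
  qed
  moreover have "r \<le> n x" using F by (simp add: n_def)
  ultimately have "principal_vec r x v \<le> n v" for v by (rule principal_vec_le)
  then show "level (principal_vec r x) r \<subseteq> ?F"
    using assms(2) by (force simp: level_def n_def split: if_splits)
qed

lemma principal_vec_hull:
  assumes x: "x \<in> V" and j: "0 < j" "j < r"
  shows "vertex_hull W c (level (principal_vec r x) (j + 1)) = level (principal_vec r x) j"
proof
  let ?l = "principal_vec r x"
  have l: "valid ?l" using valid_principal_vec x by blast
  have "?l y \<ge> j" if "z \<in> level ?l (j + 1)" "adj z y" for y z
    using that(1) adj_Q[OF that(2)] valid_arrow[OF l, of y z] valid_arrow[OF l, of z y] by (auto simp: level_def)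
  then have "{y \<in> V - level ?l (j + 1). \<exists>z\<in>level ?l (j + 1). adj z y} \<subseteq> level ?l j"
    by (auto simp: level_def)
  moreover have "level ?l (j + 1) \<subseteq> level ?l j" by (auto simp: level_def)
  ultimately show "vertex_hull W c (level ?l (j + 1)) \<subseteq> level ?l j"
    unfolding vertex_hull_def using level_filter[OF l j(1)] by (intro Inter_lower CollectI conjI)
next
  let ?l = "principal_vec r x"
  have l: "valid ?l" using valid_principal_vec x by blast
  show "level ?l j \<subseteq> vertex_hull W c (level ?l (j + 1))"
    unfolding vertex_hull_def
  proof (rule Inter_greatest)
    fix H assume "H \<in> {F'. is_vertex_filter W c F' \<and> level ?l (j + 1) \<subseteq> F' \<and>
      {y \<in> V - level ?l (j + 1). \<exists>x\<in>level ?l (j + 1). adj x y} \<subseteq> F'}"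
    then have H: "H \<subseteq> V" "\<And>y z. (y, z) \<in> Q \<Longrightarrow> y \<in> H \<Longrightarrow> z \<in> H" "level ?l (j + 1) \<subseteq> H"
      and nb: "{y \<in> V - level ?l (j + 1). \<exists>x\<in>level ?l (j + 1). adj x y} \<subseteq> H"
      unfolding filter_iff by auto
    \<comment> \<open>A competitor for the minimum: values outside \<open>H\<close> are cut down to
      \<open>j - 1\<close>. Once it is valid, minimality of \<open>?l\<close> forces level
      \<open>j\<close> into \<open>H\<close>.\<close>
    define n where "n = (\<lambda>v. if v \<in> H then ?l v else min (?l v) (j - 1))"
    have "valid n" unfolding valid_def
    proof (intro conjI allI impI ballI, goal_cases)
      case (1 v)
      then show ?case using valid_outside[OF l] by (simp add: n_def)
    next
      case (2 p)
      obtain y z where p: "p = (y, z)" by force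
      then have yz: "(y, z) \<in> Q" using 2 by simp
      note a = valid_arrow[OF l yz]
      consider "y \<in> H" "z \<in> H" | "y \<notin> H" "z \<notin> H" | "y \<notin> H" "z \<in> H" using H(2)[OF yz] by blast
      then have "n y \<le> n z \<and> n z \<le> Suc (n y)"
      proof cases
        \<comment> \<open>\<open>H\<close> contains level \<open>j + 1\<close> and its neighbours,
          so neither end of the arrow has a value above \<open>j\<close>, and the cut at
          \<open>y\<close> keeps the difference at most 1.\<close>
        case 3
        then have "y \<notin> level ?l (j + 1)" using H(3) by blast
        moreover have "z \<notin> level ?l (j + 1)"
        proof
          assume "z \<in> level ?l (j + 1)"
          then have "y \<in> H" using nb \<open>y \<notin> level ?l (j + 1)\<close> Q_verts[OF yz] Q_adj[OF yz] adj_sym by blast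
          then show False using 3 by blast
        qed
        ultimately show ?thesis using 3 a by (auto simp: n_def level_def)
      qed (use a in \<open>auto simp: n_def\<close>)
      then show ?case by (simp add: p)
    qed
    moreover have "x \<in> level ?l (j + 1)" using principal_vec_self[OF x] j by (simp add: level_def)
    then have "r \<le> n x" using H(3) principal_vec_self[OF x] by (auto simp: n_def)
    ultimately have "?l v \<le> n v" for v by (rule principal_vec_le)
    then show "level ?l j \<subseteq> H"
      using j by (force simp: level_def n_def split: if_splits)
  qed
qed

section \<open>Layers of admissible words\<close>

definition indicator_vec :: "'v set \<Rightarrow> 'v \<Rightarrow> nat" where
  "indicator_vec F v = (if v \<in> F then 1 else 0)"

lemma valid_indicator_vec: "is_vertex_filter W c F \<Longrightarrow> valid (indicator_vec F)"
  unfolding filter_iff valid_def indicator_vec_def by auto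

lemma count_distinct: "distinct xs \<Longrightarrow> count_list xs = indicator_vec (set xs)"
  by (rule ext, induction xs) (auto simp: indicator_vec_def)

lemma distinct_vec_word: assumes "is_vertex_filter W c F" shows "distinct (vec_word (indicator_vec F)) \<and> set (vec_word (indicator_vec F)) = F"
proof -
  have c: "count_list (vec_word (indicator_vec F)) = indicator_vec F" using count_vec_word valid_indicator_vec assms by blast
  have "distinct xs" if "\<And>v. count_list xs v \<le> 1" for xs :: "'v list"
    using that
  proof (induction xs)
    case (Cons x xs)
    have "count_list xs v \<le> 1" for v using Cons.prems[of v] by (simp split: if_splits)
    moreover have "x \<notin> set xs" using Cons.prems[of x] by (simp add: count_list_0_iff)
    ultimately show ?case using Cons.IH by simp
  qed simp
  then have "distinct (vec_word (indicator_vec F))" using c by (simp add: indicator_vec_def)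
  moreover have "v \<in> set (vec_word (indicator_vec F)) \<longleftrightarrow> v \<in> F" for v
    using count_list_0_iff[of "vec_word (indicator_vec F)" v] c by (simp add: indicator_vec_def split: if_splits)
  ultimately show ?thesis by blast
qed

text \<open>Along an arrow into a letter of \<open>ws\<close>, both counts truncated at
  \<open>k\<close> equal \<open>k\<close>. Along any other arrow \<open>ws\<close> adds nothing at
  either end. So every firing keeps the counts valid.\<close>

lemma adm_layer:
  assumes n: "valid n" and ys: "adm Q ys" "count_list ys = (\<lambda>v. min (n v) k)"
    and ws: "adm Q ws" "distinct ws" "set ws \<subseteq> level n (Suc k)"
  shows "adm Q (ws @ ys)"
  using ws
proof (induction ws)
  case Nil
  then show ?case using ys by simp
next
  case (Cons w ws)
  then have IH: "adm Q (ws @ ys)" by simp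
  have wV: "w \<in> V" using adm_verts[OF Cons.prems(1)] by simp
  have "valid (indicator_vec (set (w # ws)))"
    using adm_valid[OF Cons.prems(1)] count_distinct[OF Cons.prems(2)] by simp
  note i = valid_arrow[OF this]
  have c: "count_list (w # ws @ ys) v = indicator_vec (set (w # ws)) v + min (n v) k" for v
  proof -
    have "count_list (w # ws @ ys) v = count_list (w # ws) v + count_list ys v" by simp
    then show ?thesis unfolding count_distinct[OF Cons.prems(2)] ys(2) .
  qed
  have "valid (count_list (w # ws @ ys))" unfolding valid_def
  proof (intro conjI allI impI ballI, goal_cases)
    case (1 v)
    then show ?case using adm_verts[OF Cons.prems(1)] valid_outside[OF n, of v] unfolding c by (auto simp: indicator_vec_def)
  next
    case (2 p)
    obtain y z where p: "p = (y, z)" by force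
    then have yz: "(y, z) \<in> Q" using 2 by simp
    have "count_list (w # ws @ ys) y \<le> count_list (w # ws @ ys) z \<and>
      count_list (w # ws @ ys) z \<le> Suc (count_list (w # ws @ ys) y)"
    proof (cases "z \<in> set (w # ws)")
      case True
      then have "Suc k \<le> n z" using Cons.prems(3) unfolding level_def by blast
      then have "min (n z) k = k" "min (n y) k = k" using valid_arrow[OF n yz] by auto
      then show ?thesis using i[OF yz] unfolding c by simp
    next
      case False
      then have "indicator_vec (set (w # ws)) z = 0" by (simp add: indicator_vec_def)
      moreover from this have "indicator_vec (set (w # ws)) y = 0" using i[OF yz] by simp
      ultimately show ?thesis using valid_arrow[OF n yz] unfolding c by auto
    qed
    then show ?case by (simp add: p)
  qed
  then show ?case using valid_sink[OF IH wV] IH by simp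
qed

lemma layers_product:
  assumes n: "valid n"
    and X: "\<And>j. 0 < j \<Longrightarrow> j \<le> k \<Longrightarrow> X j \<in> Adm W c \<and> mult_free (X j) \<and> Supp (X j) = level n j"
  shows "foldr (\<lambda>A B. A \<otimes>\<^bsub>graph_monoid W\<^esub> B) (map X (rev [1..<k + 1])) \<one>\<^bsub>graph_monoid W\<^esub>
      = vec_class (\<lambda>v. min (n v) k)
    \<and> valid (\<lambda>v. min (n v) k)"
  using X
proof (induction k)
  case 0
  have e: "(\<lambda>v. min (n v) 0) = count_list []" by (simp add: fun_eq_iff)
  show ?case unfolding e using adm_valid[of "[]"] word_class_adm[of "[]"] by (simp add: one_graph_monoid del: count_list.simps)
next
  case (Suc k)
  let ?t = "\<lambda>k v. min (n v) k"
  let ?ys = "vec_word (?t k)"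
  have IH: "foldr (\<lambda>A B. A \<otimes>\<^bsub>graph_monoid W\<^esub> B) (map X (rev [1..<k + 1])) \<one>\<^bsub>graph_monoid W\<^esub> = vec_class (?t k)"
    "valid (?t k)" using Suc by auto
  obtain m where m: "valid m" "X (Suc k) = vec_class m" using Suc.prems[of "Suc k"] by (auto simp: Adm_eq)
  define ws where "ws = vec_word m"
  have ws: "adm Q ws" "X (Suc k) = word_class ws" using m adm_vec_word by (auto simp: ws_def vec_class_def)
  have wV: "set ws \<subseteq> V" using adm_verts[OF ws(1)] .
  have d: "distinct ws" "set ws = level n (Suc k)"
    using Suc.prems[of "Suc k"] mult_free_word_class[OF wV] Supp_word_class[OF wV] ws(2) by auto
  have ys: "adm Q ?ys" "count_list ?ys = ?t k" using adm_vec_word[OF IH(2)] count_vec_word[OF IH(2)] by auto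
  have a: "adm Q (ws @ ?ys)" using adm_layer[OF n ys ws(1) d(1)] d(2) by simp
  have "count_list (ws @ ?ys) = ?t (Suc k)"
    using fun_cong[OF count_distinct[OF d(1)]] fun_cong[OF ys(2)] d(2)
    by (auto simp: fun_eq_iff indicator_vec_def level_def)
  then have "word_class (ws @ ?ys) = vec_class (?t (Suc k))" "valid (?t (Suc k))"
    using word_class_adm[OF a] adm_valid[OF a] by auto
  moreover have "word_class ws \<otimes>\<^bsub>graph_monoid W\<^esub> vec_class (?t k) = word_class (ws @ ?ys)"
    unfolding vec_class_def using word_class_mult[OF wV] adm_verts[OF ys(1)] by blast
  moreover have "map X (rev [1..<Suc k + 1]) = X (Suc k) # map X (rev [1..<k + 1])" by simp
  ultimately show ?case using IH(1) ws(2) by simp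
qed

text \<open>The supports are forced from the top down: the last layer has the principal filter as
  support, and each hull is the next lower level. Hence all permitted choices of layers have the
  same product.\<close>

lemma principal_word_eq:
  assumes r: "r > 0" and x: "x \<in> V" shows "principal_word W c r x = vec_class (principal_vec r x)"
proof -
  let ?l = "principal_vec r x"
  have l: "valid ?l" using valid_principal_vec x by blast
  have min: "(\<lambda>v. min (?l v) r) = ?l" using principal_vec_le_r[OF x] by (simp add: fun_eq_iff min_def)
  let ?P = "\<lambda>X. (\<forall>j\<in>{1..r}. X j \<in> Adm W c \<and> mult_free (X j)) \<and>
        Supp (X r) = principal_filter W c x \<and>
        (\<forall>j. 0 < j \<and> j < r \<longrightarrow> vertex_hull W c (Supp (X (j + 1))) = Supp (X j))"
  let ?prod = "\<lambda>X. foldr (\<lambda>A B. A \<otimes>\<^bsub>graph_monoid W\<^esub> B) (map X (rev [1..<r + 1])) \<one>\<^bsub>graph_monoid W\<^esub>"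
  have uniq: "?prod X = vec_class ?l" if P: "?P X" for X
  proof -
    have "Supp (X j) = level ?l j" if "j \<le> r" "0 < j" for j
      using that
    proof (induction j rule: inc_induct)
      case base
      then show ?case using P principal_vec_top_level[OF x r] by simp
    next
      case (step j)
      then show ?case using P principal_vec_hull[OF x, of j r] by auto
    qed
    then show ?thesis using layers_product[OF l, of r X] P min by simp
  qed
  define Y where "Y = (\<lambda>j. vec_class (indicator_vec (level ?l j)))"
  have Y: "Y j \<in> Adm W c \<and> mult_free (Y j) \<and> Supp (Y j) = level ?l j" if "0 < j" for j
  proof -
    have f: "is_vertex_filter W c (level ?l j)" using level_filter[OF l that] .
    have v: "set (vec_word (indicator_vec (level ?l j))) \<subseteq> V" using vec_word_verts[OF valid_indicator_vec[OF f]] .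
    show ?thesis
      using valid_indicator_vec[OF f] distinct_vec_word[OF f] mult_free_word_class[OF v] Supp_word_class[OF v]
      by (auto simp: Y_def Adm_eq vec_class_def)
  qed
  have PY: "?P Y" using Y principal_vec_top_level[OF x r] principal_vec_hull[OF x] r by auto
  show ?thesis unfolding principal_word_def
  proof (rule the_equality)
    show "\<exists>X. (\<forall>j\<in>{1..r}. X j \<in> Adm W c \<and> mult_free (X j)) \<and>
        Supp (X r) = principal_filter W c x \<and>
        (\<forall>j. 0 < j \<and> j < r \<longrightarrow> vertex_hull W c (Supp (X (j + 1))) = Supp (X j)) \<and>
        vec_class ?l = ?prod X"
      using PY uniq[OF PY] by (intro exI[of _ Y]) simp
  qed (use uniq in blast)
qed

lemma Principal_eq: "Principal W c = vec_class ` insert (\<lambda>_. 0) principal_vecs"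
proof -
  have "{principal_word W c r x | r x. r > 0 \<and> x \<in> V} = vec_class ` principal_vecs"
  proof -
    have "{principal_word W c r x | r x. r > 0 \<and> x \<in> V} = {vec_class (principal_vec r x) | r x. r > 0 \<and> x \<in> V}"
      by (intro Collect_cong iff_exI) (auto simp: principal_word_eq)
    also have "\<dots> = vec_class ` principal_vecs" unfolding principal_vecs_def by blast
    finally show ?thesis .
  qed
  moreover have "\<one>\<^bsub>graph_monoid W\<^esub> = vec_class (\<lambda>_. 0)"
  proof -
    have "count_list [] = (\<lambda>_::'v. 0)" by (simp add: fun_eq_iff)
    then show ?thesis using word_class_adm[of "[]"] adm_Nil unfolding one_graph_monoid by (simp only: simp_thms)
  qed
  ultimately show ?thesis unfolding Principal_def by simp
qed

lemma PV0_valid: "insert (\<lambda>_. 0) principal_vecs \<subseteq> Collect valid"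
  using principal_vecs_valid by simp

lemma inj_vec_class: "A \<subseteq> Collect valid \<Longrightarrow> inj_on vec_class A"
  using vec_class_inject unfolding inj_on_def by blast

text \<open>A member below another one can be omitted from the join. Conversely, an antichain is
  contained in every finite set of principal vectors with the same join, so no list with that join
  is shorter.\<close>

lemma independent_principal_vec_class:
  assumes A: "finite A" "A \<subseteq> principal_vecs"
  shows "independent_principal W c (vec_class ` A) \<longleftrightarrow> antichain A"
proof -
  have Av: "A \<subseteq> Collect valid" using A principal_vecs_valid by blast
  have cardA: "card (vec_class ` A) = card A" using card_image[OF inj_vec_class[OF Av]] .
  have sub: "vec_class ` A \<subseteq> Principal W c" using A unfolding Principal_eq by blast
  show ?thesis
  proof
    assume indicator_vec: "independent_principal W c (vec_class ` A)"
    show "antichain A" unfolding antichain_def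
    proof (intro ballI impI, rule ccontr)
      fix p q assume pq: "p \<in> A" "q \<in> A" "p \<le> q" "p \<noteq> q"
      let ?B = "A - {p}"
      have fB: "finite ?B" and Bv: "?B \<subseteq> Collect valid" using A Av by auto
      have JB: "join_vec A = join_vec ?B"
      proof (rule antisym)
        show "join_vec ?B \<le> join_vec A" unfolding join_vec_le_iff[OF fB] using join_vec_upper[OF A(1)] by blast
        have "q \<in> ?B" using pq by blast
        then have "p \<le> join_vec ?B" using join_vec_upper[OF fB] pq(3) order.trans by blast
        then show "join_vec A \<le> join_vec ?B" unfolding join_vec_le_iff[OF A(1)] using join_vec_upper[OF fB] by blast
      qed
      obtain ms where ms: "set ms = ?B" "length ms = card ?B"
        using finite_distinct_list[OF fB] distinct_card by metis
      have "set (map vec_class ms) \<subseteq> vec_class ` A" using ms(1) by auto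
      then have "map vec_class ms \<in> lists (Principal W c)" using sub by (intro in_listsI) blast
      moreover have "\<Squnion>\<^bsub>adm_order W c\<^esub> (vec_class ` A) = \<Squnion>\<^bsub>adm_order W c\<^esub> (set (map vec_class ms))"
        using sup_vec_class[OF A(1) Av] sup_vec_class[OF fB Bv] JB ms(1) by simp
      ultimately have "card (vec_class ` A) \<le> length (map vec_class ms)"
        using indicator_vec unfolding independent_principal_def by blast
      then show False using cardA ms(2) pq(1) A(1) card_Diff1_less[OF A(1) pq(1)] by simp
    qed
  next
    assume anti: "antichain A"
    have "card (vec_class ` A) \<le> length Ys"
      if Ys: "Ys \<in> lists (Principal W c)" and e: "\<Squnion>\<^bsub>adm_order W c\<^esub> (vec_class ` A) = \<Squnion>\<^bsub>adm_order W c\<^esub> (set Ys)" for Ys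
    proof -
      have "set Ys \<subseteq> vec_class ` insert (\<lambda>_. 0) principal_vecs" using Ys unfolding Principal_eq by auto
      then obtain B where B: "B \<subseteq> insert (\<lambda>_. 0) principal_vecs" "finite B" "set Ys = vec_class ` B"
        using finite_subset_image[of "set Ys" vec_class "insert (\<lambda>_. 0) principal_vecs"] by auto
      have Bv: "B \<subseteq> Collect valid" using B(1) PV0_valid by blast
      have "vec_class (join_vec A) = vec_class (join_vec B)" using e sup_vec_class[OF A(1) Av] sup_vec_class[OF B(2) Bv] B(3) by simp
      then have "join_vec A = join_vec B" using vec_class_inject[OF valid_join_vec[OF A(1) Av] valid_join_vec[OF B(2) Bv]] by blast
      then have "A \<subseteq> B" using antichain_subset_join[OF A(2,1) anti B(2,1)] by blast
      then have "card (vec_class ` A) \<le> card (set Ys)" unfolding B(3) by (intro card_mono image_mono finite_imageI B(2))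
      also have "\<dots> \<le> length Ys" by (rule card_length)
      finally show ?thesis .
    qed
    then show "independent_principal W c (vec_class ` A)"
      unfolding independent_principal_def using A(1) sub by blast
  qed
qed

lemma inverting_vec_principal_vecs: "a \<in> preproj_roots W c \<Longrightarrow> inverting_vec a \<in> principal_vecs"
  using least_inverting_principal_vec[OF least_inverting_inverting_vec] unfolding principal_vecs_def by blast

lemma independent_roots_iff:
  "\<Psi> \<in> independent_roots W c \<longleftrightarrow> finite \<Psi> \<and> \<Psi> \<subseteq> preproj_roots W c \<and> antichain (inverting_vec ` \<Psi>)"
proof (cases "finite \<Psi> \<and> \<Psi> \<subseteq> preproj_roots W c")
  case True
  have s: "least_neg W c {a} = vec_class (inverting_vec a)" if "a \<in> \<Psi>" for a
  proof -
    have "join_vec {inverting_vec a} = inverting_vec a" by (simp add: join_vec_def fun_eq_iff)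
    then show ?thesis using least_neg_vec_class[of "{a}"] that True by auto
  qed
  have "(\<lambda>a. least_neg W c {a}) ` \<Psi> = vec_class ` inverting_vec ` \<Psi>" unfolding image_image by (intro image_cong HOL.refl s)
  moreover have "inverting_vec ` \<Psi> \<subseteq> principal_vecs" using True inverting_vec_principal_vecs by blast
  ultimately show ?thesis
    unfolding independent_roots_def using True independent_principal_vec_class[of "inverting_vec ` \<Psi>"] by simp
qed (auto simp: independent_roots_def)

lemma least_neg_independent:
  "\<Psi> \<in> independent_roots W c \<Longrightarrow> least_neg W c \<Psi> = vec_class (join_vec (inverting_vec ` \<Psi>))"
  using least_neg_vec_class unfolding independent_roots_iff by blast

lemma inverting_vec_image_valid: "\<Psi> \<in> independent_roots W c \<Longrightarrow> inverting_vec ` \<Psi> \<subseteq> Collect valid"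
  using valid_inverting_vec unfolding independent_roots_iff by blast

lemma inj_least_neg: "inj_on (least_neg W c) (independent_roots W c)"
proof (rule inj_onI)
  fix \<Psi> \<Phi> assume i: "\<Psi> \<in> independent_roots W c" "\<Phi> \<in> independent_roots W c"
    and e: "least_neg W c \<Psi> = least_neg W c \<Phi>"
  have p: "finite \<Psi>" "\<Psi> \<subseteq> preproj_roots W c" "antichain (inverting_vec ` \<Psi>)"
    "finite \<Phi>" "\<Phi> \<subseteq> preproj_roots W c" "antichain (inverting_vec ` \<Phi>)"
    using i unfolding independent_roots_iff by auto
  have "valid (join_vec (inverting_vec ` \<Psi>))" "valid (join_vec (inverting_vec ` \<Phi>))"
    using valid_join_vec[OF _ inverting_vec_image_valid[OF i(1)]] valid_join_vec[OF _ inverting_vec_image_valid[OF i(2)]] p(1,4) by simp_all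
  then have "join_vec (inverting_vec ` \<Psi>) = join_vec (inverting_vec ` \<Phi>)" using e least_neg_independent i vec_class_inject by simp
  then have "inverting_vec ` \<Psi> = inverting_vec ` \<Phi>"
    using p inverting_vec_principal_vecs by (intro antichain_join_inject finite_imageI) blast+
  then show "\<Psi> = \<Phi>" using inj_on_image_eq_iff[OF inj_inverting_vec p(2,5)] by simp
qed

lemma Red_eq: "Red W (Adm W c) = vec_class ` {n. valid n \<and> reduced_vec n}"
  unfolding Red_def Adm_eq using reduced_vec_class by auto

lemma least_neg_image: "least_neg W c ` independent_roots W c = Red W (Adm W c)"
proof (intro Set.set_eqI iffI)
  fix X assume "X \<in> least_neg W c ` independent_roots W c"
  then obtain \<Psi> where P: "\<Psi> \<in> independent_roots W c" "X = vec_class (join_vec (inverting_vec ` \<Psi>))"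
    using least_neg_independent by blast
  have f: "finite (inverting_vec ` \<Psi>)" "\<forall>m\<in>inverting_vec ` \<Psi>. reduced_vec m"
    using P(1) reduced_vec_inverting_vec unfolding independent_roots_iff by blast+
  show "X \<in> Red W (Adm W c)"
    unfolding Red_eq P(2) using valid_join_vec[OF f(1) inverting_vec_image_valid[OF P(1)]] reduced_vec_join_vec[OF f(1) inverting_vec_image_valid[OF P(1)] f(2)]
    by blast
next
  fix X assume "X \<in> Red W (Adm W c)"
  then obtain n where n: "valid n" "reduced_vec n" "X = vec_class n" unfolding Red_eq by blast
  obtain A where A: "A \<subseteq> principal_vecs" "finite A" "antichain A" "join_vec A = n" using ex_antichain_join[OF n(1)] by blast
  \<comment> \<open>A principal vector below a reduced vector is reduced, and so comes from a
    root.\<close>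
  have Ala: "A \<subseteq> inverting_vec ` preproj_roots W c"
  proof
    fix p assume p: "p \<in> A"
    then obtain r x where rx: "r > 0" "x \<in> V" "p = principal_vec r x" using A(1) unfolding principal_vecs_def by blast
    have "p \<le> n" using join_vec_upper[OF A(2) p] A(4) by simp
    then have "reduced_vec p" using reduced_vec_mono[OF valid_principal_vec[OF rx(2), of r] n(1)] n(2) rx(3) by simp
    then obtain a where "least_inverting p a" using principal_vec_least_inverting[OF rx(1,2)] rx(3) by blast
    then show "p \<in> inverting_vec ` preproj_roots W c" using preproj_iff inverting_vec_eq by blast
  qed
  then obtain \<Psi> where P: "\<Psi> \<subseteq> preproj_roots W c" "finite \<Psi>" "A = inverting_vec ` \<Psi>"
    using finite_subset_image[OF A(2)] by blast
  then have i: "\<Psi> \<in> independent_roots W c" unfolding independent_roots_iff using A(3) by blast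
  have "least_neg W c \<Psi> = X" using least_neg_independent[OF i] P(3) A(4) n(3) by simp
  then show "X \<in> least_neg W c ` independent_roots W c" using i by blast
qed

text \<open>The word \<open>us\<close> given by the weak order need not be admissible, so counts
  cannot be compared directly. Instead, \<open>m\<close> is a join of least inverting vectors of
  roots; \<open>us @ vec_word m\<close> is reduced, hence still inverts these roots, and acts as
  \<open>vec_word n\<close>.\<close>

lemma left_weak_le_vec_class:
  assumes m: "valid m" "reduced_vec m" and n: "valid n" "reduced_vec n"
  shows "left_weak_le W (rho (vec_word m)) (rho (vec_word n)) \<longleftrightarrow> m \<le> n"
proof
  have mV: "set (vec_word m) \<subseteq> V" and nV: "set (vec_word n) \<subseteq> V" using vec_word_verts m n by auto
  assume "left_weak_le W (rho (vec_word m)) (rho (vec_word n))"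
  then obtain ss where "ss \<in> lists (gens W)" and s2: "rho (vec_word n) = val (rev ss) \<otimes> rho (vec_word m)"
    and s3: "\<forall>i\<le>length ss. len (val (rev (take i ss)) \<otimes> rho (vec_word m)) = len (rho (vec_word m)) + i"
    unfolding left_weak_le_def by blast
  then have ss: "set ss \<subseteq> gens W" "rho (vec_word n) = val (rev ss) \<otimes> rho (vec_word m)"
    "len (val (rev ss) \<otimes> rho (vec_word m)) = len (rho (vec_word m)) + length ss"
    using s3[rule_format, of "length ss"] by auto
  obtain us where us: "set us \<subseteq> V" "map gen us = rev ss" using word_lift[of "rev ss"] ss by auto
  have "rho (us @ vec_word m) = val (rev ss) \<otimes> rho (vec_word m)" using rho_append[OF us(1) mV] us(2) by simp
  then have e: "rho (us @ vec_word m) = rho (vec_word n)" "reduced_word (us @ vec_word m)"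
    using ss m(2) arg_cong[OF us(2), of length] by (simp_all add: reduced_word_def)
  have re: "word_act (us @ vec_word m) = word_act (vec_word n)"
    using cox_act_rho[of "us @ vec_word m"] cox_act_rho[OF nV] e(1) us(1) mV by simp
  obtain A where A: "A \<subseteq> principal_vecs" "finite A" "antichain A" "join_vec A = m" using ex_antichain_join[OF m(1)] by blast
  have "p \<le> n" if p: "p \<in> A" for p
  proof -
    obtain r x where rx: "r > 0" "x \<in> V" "p = principal_vec r x" using A(1) p unfolding principal_vecs_def by blast
    have pm: "p \<le> m" using join_vec_upper[OF A(2) p] A(4) by simp
    then have "reduced_vec p" using reduced_vec_mono[OF valid_principal_vec[OF rx(2), of r] m(1)] m(2) rx(3) by simp
    then obtain a where a: "least_inverting p a" using principal_vec_least_inverting[OF rx(1,2)] rx(3) by blast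
    then have ap: "a \<in> preproj_roots W c" "inverting_vec a = p" "pos a" using preproj_iff inverting_vec_eq unfolding least_inverting_def by blast+
    have "\<not> pos (word_act (vec_word m) a)" using inverts_inverting_vec[OF ap(1) m] pm ap(2) by (simp add: inverts_def)
    then have "\<not> pos (word_act (us @ vec_word m) a)" using us mV by (intro inverts_stays[OF e(2) _ ap(3)]) auto
    then have "inverts n a" unfolding re inverts_def .
    then show "p \<le> n" using inverting_vec_le[OF ap(1) n(1)] ap(2) by simp
  qed
  then show "m \<le> n" using join_vec_le_iff[OF A(2)] A(4) by blast
next
  have mV: "set (vec_word m) \<subseteq> V" and nV: "set (vec_word n) \<subseteq> V" using vec_word_verts m n by auto
  assume "m \<le> n"
  then obtain us where us: "trace_cong (vec_word n) (us @ vec_word m)" using vec_word_extension_vec_word m n by blast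
  have uV: "set us \<subseteq> V" using trace_cong_verts(2)[OF us] by simp
  have red: "reduced_word (us @ vec_word m)" using trace_cong_reduced_word[OF us] n by blast
  define ss where "ss = map gen (rev us)"
  have "rho (vec_word n) = val (rev ss) \<otimes> rho (vec_word m)"
    using trace_cong_rho[OF us] rho_append[OF uV mV] by (simp add: ss_def rev_map)
  moreover have "len (val (rev (take i ss)) \<otimes> rho (vec_word m)) = len (rho (vec_word m)) + i" if i: "i \<le> length ss" for i
  proof -
    \<comment> \<open>The \<open>i\<close> letters fired first stand at the end of
      \<open>us\<close>, while \<open>ss\<close> lists them in order of firing.\<close>
    define vs where "vs = drop (length us - i) us"
    have l: "length vs = i" using i by (simp add: vs_def ss_def)
    have "rev (take i ss) = map gen vs"
      by (simp add: ss_def vs_def take_map rev_map take_rev)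
    moreover have "us = take (length us - i) us @ vs" by (simp add: vs_def)
    then have "reduced_word (take (length us - i) us @ vs @ vec_word m)" using red by (metis append.assoc)
    then have "reduced_word (vs @ vec_word m)"
      by (rule reduced_word_append(2)) (use uV mV in \<open>auto simp: vs_def dest: in_set_takeD in_set_dropD\<close>)
    moreover have "set vs \<subseteq> V" using uV by (auto simp: vs_def dest: in_set_dropD)
    ultimately show ?thesis
      using rho_append[of vs "vec_word m"] mV m(2) l unfolding reduced_word_def by simp
  qed
  moreover have "ss \<in> lists (gens W)" using map_gen_gens[OF uV] by (auto simp: ss_def)
  ultimately show "left_weak_le W (rho (vec_word m)) (rho (vec_word n))"
    unfolding left_weak_le_def using rho_closed[OF mV] rho_closed[OF nV] by blast
qed

lemma gm_le_left_weak_le: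
  assumes "X \<in> Red W (Adm W c)" "Y \<in> Red W (Adm W c)"
  shows "gm_le W X Y \<longleftrightarrow> left_weak_le W (gm_rho W X) (gm_rho W Y)"
proof -
  obtain m n where "valid m" "reduced_vec m" "X = vec_class m" "valid n" "reduced_vec n" "Y = vec_class n"
    using assms unfolding Red_eq by blast
  then show ?thesis using left_weak_le_vec_class gm_le_vec_class gm_rho_vec_class by simp
qed

lemma inj_gm_rho: "inj_on (gm_rho W) (Red W (Adm W c))"
proof (rule inj_onI)
  fix X Y assume XY: "X \<in> Red W (Adm W c)" "Y \<in> Red W (Adm W c)" "gm_rho W X = gm_rho W Y"
  obtain m n where mn: "valid m" "reduced_vec m" "X = vec_class m" "valid n" "reduced_vec n" "Y = vec_class n"
    using XY(1,2) unfolding Red_eq by blast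
  have "m \<le> n" "n \<le> m"
    using left_weak_le_vec_class[of m n] left_weak_le_vec_class[of n m] left_weak_le_vec_class[of m m] XY(3) mn
    by (auto simp: gm_rho_vec_class)
  then show "X = Y" using mn by simp
qed

lemma gm_rho_image: "gm_rho W ` Red W (Adm W c) = {w \<in> carrier W. has_adm_reduced_expr W c w}"
proof -
  have "gm_rho W X \<in> carrier W" if "X \<in> Adm W c" for X
    using that vec_word_verts unfolding Adm_eq by (auto simp: gm_rho_vec_class)
  then show ?thesis unfolding has_adm_reduced_expr_def Red_def by auto
qed

end

theorem theorem4p6:
  fixes W :: "('w, 'v) coxeter_data" and c :: 'w
  assumes "coxeter_system W"
    and "irreducible_coxeter W"
    and "finite (gens W)"
    and "coxeter_element W c"
  shows
    "((\<forall>X\<in>Adm W c. reduced W X \<longleftrightarrow> (\<exists>\<Psi>\<in>independent_roots W c. X = least_neg W c \<Psi>)) \<and>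
      Red W (Adm W c) = least_neg W c ` independent_roots W c \<and>
      bij_betw (least_neg W c) (independent_roots W c) (Red W (Adm W c))) \<and>
     ((\<forall>X\<in>Red W (Adm W c). \<forall>Y\<in>Red W (Adm W c).
         gm_le W X Y \<longleftrightarrow> left_weak_le W (gm_rho W X) (gm_rho W Y)) \<and>
      inj_on (gm_rho W) (Red W (Adm W c))) \<and>
     (bij_betw (least_neg W c) (independent_roots W c) (Red W (Adm W c)) \<and>
      bij_betw (gm_rho W) (Red W (Adm W c)) {w \<in> carrier W. has_adm_reduced_expr W c w})"
proof -
  interpret group W using assms(1) unfolding coxeter_system_def by blast
  interpret coxeter_element_group W c by unfold_locales (use assms in auto)
  have "reduced W X \<longleftrightarrow> (\<exists>\<Psi>\<in>independent_roots W c. X = least_neg W c \<Psi>)" if "X \<in> Adm W c" for X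
  proof -
    have "reduced W X \<longleftrightarrow> X \<in> least_neg W c ` independent_roots W c"
      unfolding least_neg_image Red_def using that by blast
    then show ?thesis by blast
  qed
  then show ?thesis
    unfolding bij_betw_def
    using least_neg_image inj_least_neg gm_le_left_weak_le inj_gm_rho gm_rho_image by simp
qed

end
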